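(* Consider the linearized log--KdV equation $u_t = \partial_x L u$ with $L = -\partial_x^2 + \frac14(x^2-6)$. Assume that the initial data $u(0) \in X_c$ is represented by the convolution form $$u(t,x) = a(t) u_0(x) + b(t) u_1(x) + y(t,x), \qquad y(t,x) = \int_{-\infty}^0 u_0(x-z)\, w(t,z)\, dz \qquad ( * )$$ at $t=0$ with some $a(0)$, $b(0)$, and $w(0) \in {\rm Dom}(H)$. Then there exists a solution of the linearized log--KdV equation represented in the convolution form $( * )$ with unique $(a,b) \in C^1(\mathbb{R}^+,\mathbb{R}^2)$ and $w \in C(\mathbb{R}^+,{\rm Dom}(H)) \cap C^1(\mathbb{R}^+,L^2(\mathbb{R}^-))$. Moreover, there is a $b_{\infty} \in \mathbb{R}$ such that $$\lim_{t \to \infty} \| u(t) - b_{\infty} u_1 \|_{L^2(\mathbb{R}) \cap L^{\infty}(\mathbb{R})} = 0.$$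
   Context: $\mathbb{R}^- = (-\infty,0)$; functions are real-valued. $u_0(x) = (2\pi)^{-1/4} e^{-x^2/4}$ and $u_1(x) = -2u_0'(x) = x\,u_0(x)$ (Hermite functions with $Lu_0=-u_0$, $Lu_1=0$). $X_c := \{ u \in H^1(\mathbb{R}) \cap L^2_1(\mathbb{R}) : \langle u_0, u\rangle_{L^2} = 0\}$, where $L^2_1(\mathbb{R})$ is the $L^2$ space with weight $(1+x^2)^{1/2}$. The operator $H : {\rm Dom}(H) \to L^2(\mathbb{R}^-)$ is $$(Hw)(z) = -z w_{zz} - 3 w_z + \tfrac14 (z^2 w)_z, \quad z<0, \qquad {\rm Dom}(H) = \{ w \in L^2(\mathbb{R}^-) : Hw \in L^2(\mathbb{R}^-)\}.$$ Under the decomposition $( * )$, the linearized log--KdV equation becomes the evolution problem $w_t = Hw$ together with the modulation equations $\dot a(t) = 2 w(t,0)$, $\dot b(t) = \frac12 a(t)$. *)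

theory Defs
  imports "HOL-Analysis.Analysis" "HOL-Probability.Essential_Supremum"
begin

text \<open>Elements of Lebesgue spaces are represented by functions of type \<open>real \<Rightarrow> real\<close>;
  equality of such elements is always stated as equality almost everywhere. The half-line
  \<open>(-\<infinity>,0)\<close> is \<open>{..<0}\<close>, and \<open>lebesgue_on {..<0}\<close> ignores values outside it.\<close>

definition L2 :: "'a measure \<Rightarrow> ('a \<Rightarrow> real) set" where
  "L2 M = {f \<in> borel_measurable M. integrable M (\<lambda>x. (f x)\<^sup>2)}"

definition L2_norm :: "'a measure \<Rightarrow> ('a \<Rightarrow> real) \<Rightarrow> real" where
  "L2_norm M f = sqrt (\<integral>x. (f x)\<^sup>2 \<partial>M)"

definition Linf_norm :: "'a measure \<Rightarrow> ('a \<Rightarrow> real) \<Rightarrow> ereal" where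
  "Linf_norm M f = esssup M (\<lambda>x. ereal \<bar>f x\<bar>)"

definition Linf :: "'a measure \<Rightarrow> ('a \<Rightarrow> real) set" where
  "Linf M = {f \<in> borel_measurable M. Linf_norm M f < \<infinity>}"

subsection \<open>Distributional derivatives\<close>

definition test_functions :: "real set \<Rightarrow> (real \<Rightarrow> real) set" where
  "test_functions U = {\<phi>. (\<forall>n x. (deriv ^^ n) \<phi> differentiable at x) \<and>
                          (\<exists>K. compact K \<and> K \<subseteq> U \<and> (\<forall>x. x \<notin> K \<longrightarrow> \<phi> x = 0))}"

text \<open>\<open>distr_deriv U n f \<phi>\<close> is the pairing of the \<open>n\<close>-th distributional derivative on \<open>U\<close>
  of the locally integrable function \<open>f\<close> with the test function \<open>\<phi>\<close>.\<close>

definition distr_deriv :: "real set \<Rightarrow> nat \<Rightarrow> (real \<Rightarrow> real) \<Rightarrow> (real \<Rightarrow> real) \<Rightarrow> real" where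
  "distr_deriv U n f \<phi> = (-1) ^ n * (\<integral>x. f x * (deriv ^^ n) \<phi> x \<partial>lebesgue_on U)"

definition H1 :: "(real \<Rightarrow> real) set" where
  "H1 = {v \<in> L2 lebesgue. \<exists>v' \<in> L2 lebesgue. \<forall>\<phi> \<in> test_functions UNIV.
           distr_deriv UNIV 1 v \<phi> = (\<integral>x. v' x * \<phi> x \<partial>lebesgue)}"

text \<open>The \<open>L\<^sup>2\<close> space with norm \<open>\<parallel>(1 + x\<^sup>2)\<^bsup>1/2\<^esup> v\<parallel>\<close>: the weight multiplies the function,
  not its square.\<close>

definition L2_weighted :: "(real \<Rightarrow> real) set" where
  "L2_weighted = {v. (\<lambda>x. sqrt (1 + x\<^sup>2) * v x) \<in> L2 lebesgue}"

subsection \<open>Hermite functions, the operator \<open>L\<close> and the linearized log-KdV equation\<close>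

definition u0 :: "real \<Rightarrow> real" where
  "u0 x = (2 * pi) powr (-1/4) * exp (- x\<^sup>2 / 4)"

definition u1 :: "real \<Rightarrow> real" where
  "u1 x = - 2 * deriv u0 x"

lemma u1_eq: "u1 x = x * u0 x"
proof -
  have "(u0 has_real_derivative - (x / 2) * u0 x) (at x)"
    unfolding u0_def by (auto intro!: derivative_eq_intros simp: field_simps)
  then show ?thesis
    by (simp add: u1_def DERIV_imp_deriv)
qed

definition X_c :: "(real \<Rightarrow> real) set" where
  "X_c = {v \<in> H1 \<inter> L2_weighted. (\<integral>x. u0 x * v x \<partial>lebesgue) = 0}"

definition L_op :: "(real \<Rightarrow> real) \<Rightarrow> real \<Rightarrow> real" where
  "L_op v x = - (deriv ^^ 2) v x + 1/4 * (x\<^sup>2 - 6) * v x"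

text \<open>Classical solutions on \<open>[0,\<infinity>) \<times> \<real>\<close>; the time derivative at \<open>t = 0\<close> is one-sided.\<close>

definition solves_lin_logKdV :: "(real \<Rightarrow> real \<Rightarrow> real) \<Rightarrow> bool" where
  "solves_lin_logKdV u \<longleftrightarrow> (\<forall>t\<ge>0. \<forall>x.
     (\<forall>n<3. (deriv ^^ n) (u t) differentiable at x) \<and>
     ((\<lambda>s. u s x) has_real_derivative deriv (L_op (u t)) x) (at t within {0..}))"

subsection \<open>The operator \<open>H\<close> on the half-line\<close>

text \<open>\<open>is_H w f\<close>: the distribution \<open>-z w\<^sub>z\<^sub>z - 3 w\<^sub>z + 1/4 (z\<^sup>2 w)\<^sub>z\<close> on \<open>(-\<infinity>,0)\<close> is the function \<open>f\<close>.
  A smooth factor in front of a distribution is moved onto the test function.\<close>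

definition is_H :: "(real \<Rightarrow> real) \<Rightarrow> (real \<Rightarrow> real) \<Rightarrow> bool" where
  "is_H w f \<longleftrightarrow> (\<forall>\<phi> \<in> test_functions {..<0}.
     distr_deriv {..<0} 2 w (\<lambda>z. - z * \<phi> z)
     + distr_deriv {..<0} 1 w (\<lambda>z. - 3 * \<phi> z)
     + 1/4 * distr_deriv {..<0} 1 (\<lambda>z. z\<^sup>2 * w z) \<phi>
     = (\<integral>z. f z * \<phi> z \<partial>lebesgue_on {..<0}))"

definition Dom_H :: "(real \<Rightarrow> real) set" where
  "Dom_H = {w \<in> L2 (lebesgue_on {..<0}). \<exists>f \<in> L2 (lebesgue_on {..<0}). is_H w f}"

text \<open>For \<open>w \<in> Dom_H\<close> this is determined up to a null set.\<close>

definition H_op :: "(real \<Rightarrow> real) \<Rightarrow> real \<Rightarrow> real" where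
  "H_op w = (SOME f. f \<in> L2 (lebesgue_on {..<0}) \<and> is_H w f)"

definition graph_norm_H :: "(real \<Rightarrow> real) \<Rightarrow> real" where
  "graph_norm_H w = L2_norm (lebesgue_on {..<0}) w + L2_norm (lebesgue_on {..<0}) (H_op w)"

subsection \<open>Vector-valued functions of time \<open>t \<in> [0,\<infinity>)\<close>\<close>

text \<open>Here \<open>X\<close> is a space of functions and \<open>N\<close> its norm; derivatives at \<open>t = 0\<close> are one-sided.\<close>

definition C0_halfline ::
    "(real \<Rightarrow> real) set \<Rightarrow> ((real \<Rightarrow> real) \<Rightarrow> real) \<Rightarrow> (real \<Rightarrow> real \<Rightarrow> real) \<Rightarrow> bool" where
  "C0_halfline X N w \<longleftrightarrow> (\<forall>t\<ge>0. w t \<in> X \<and>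
     ((\<lambda>s. N (\<lambda>z. w s z - w t z)) \<longlongrightarrow> 0) (at t within {0..}))"

definition C1_halfline ::
    "(real \<Rightarrow> real) set \<Rightarrow> ((real \<Rightarrow> real) \<Rightarrow> real) \<Rightarrow> (real \<Rightarrow> real \<Rightarrow> real) \<Rightarrow> bool" where
  "C1_halfline X N w \<longleftrightarrow> C0_halfline X N w \<and> (\<exists>w'. C0_halfline X N w' \<and>
     (\<forall>t\<ge>0. ((\<lambda>s. N (\<lambda>z. (w s z - w t z) / (s - t) - w' t z)) \<longlongrightarrow> 0) (at t within {0..})))"

definition C1_real_halfline :: "(real \<Rightarrow> real) \<Rightarrow> bool" where
  "C1_real_halfline a \<longleftrightarrow> (\<exists>a'. continuous_on {0..} a' \<and>
     (\<forall>t\<ge>0. (a has_real_derivative a' t) (at t within {0..})))"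

subsection \<open>The convolution form\<close>

definition conv_form :: "real \<Rightarrow> real \<Rightarrow> (real \<Rightarrow> real) \<Rightarrow> real \<Rightarrow> real" where
  "conv_form a b w x = a * u0 x + b * u1 x + (\<integral>z. u0 (x - z) * w z \<partial>lebesgue_on {..<0})"

definition conv_solution ::
    "(real \<Rightarrow> real) \<Rightarrow> (real \<Rightarrow> real) \<Rightarrow> (real \<Rightarrow> real) \<Rightarrow> (real \<Rightarrow> real \<Rightarrow> real) \<Rightarrow> bool" where
  "conv_solution u_init a b w \<longleftrightarrow>
     C1_real_halfline a \<and> C1_real_halfline b \<and>
     C0_halfline Dom_H graph_norm_H w \<and>
     C1_halfline (L2 (lebesgue_on {..<0})) (L2_norm (lebesgue_on {..<0})) w \<and>
     solves_lin_logKdV (\<lambda>t. conv_form (a t) (b t) (w t)) \<and>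
     (AE x in lebesgue. conv_form (a 0) (b 0) (w 0) x = u_init x)"

end

theory Submission
  imports Defs "HOL-Probability.Distributions" "HOL-Probability.Sinc_Integral" "HOL-Real_Asymp.Real_Asymp"
begin

text \<open>On \<open>(-\<infinity>,0)\<close> the operator is \<open>H w = (- z w' - 2 w + z\<^sup>2 w / 4)'\<close>, so \<open>H w = f\<close> is solved by two
  integrations. The two constants are fixed by square integrability at \<open>0\<close> and at \<open>-\<infinity>\<close>, where the
  kernel elements \<open>z\<^sup>-\<^sup>2\<close> and \<open>z\<^sup>-\<^sup>2 exp (z\<^sup>2/8)\<close> misbehave. Hence \<open>H\<close> with its maximal domain is the inverse of an explicit
  bounded injective operator \<open>G\<close> on \<open>L\<^sup>2\<close>, and integration by parts gives
  \<open>\<langle>G f, f\<rangle> \<le> - \<parallel>G f\<parallel>\<^sup>2 / 2\<close>. The Yosida approximations \<open>(G - \<epsilon>)\<^sup>-\<^sup>1\<close> of \<open>H\<close> are bounded, and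
  their exponentials converge to a function \<open>\<gamma>\<close> with \<open>(G \<gamma>)' = \<gamma>\<close>; then \<open>w = G \<gamma>\<close> solves \<open>w' = H w\<close>, and
  the energy inequality gives uniqueness and \<open>\<parallel>w(t)\<parallel> \<le> exp (-t/2) \<parallel>w(0)\<parallel>\<close>.

  Since \<open>u\<^sub>0(x - z) = u\<^sub>0(x) exp (x z/2 - z\<^sup>2/4)\<close>, the convolution form is \<open>u\<^sub>0\<close> times \<open>a + b x\<close>
  plus an exponential moment of \<open>w\<close>. Integration by parts turns \<open>\<partial>\<^sub>x L\<close> of the form \<open>(a, b, w)\<close> into the
  form \<open>(2 w(0), a/2, H w)\<close>, and the form determines its data because exponential moments decay as
  \<open>x \<rightarrow> \<infinity>\<close> and determine \<open>w\<close> by the Weierstrass theorem. Orthogonality to \<open>u\<^sub>0\<close> gives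
  \<open>a = - \<integral> exp (-z\<^sup>2/8) w dz\<close>, so \<open>a\<close> decays and \<open>b\<close> converges.\<close>

section \<open>Semigroups generated by inverses of dissipative operators\<close>

text \<open>The maximal domain \<open>Dom_H\<close> is given by a distributional condition and names
  no boundary value at 0. Passing to the bounded operator G = \<open>Hinv\<close> removes the domain
  question: for square integrable w and f, \<open>is_H w f\<close> means w = G f almost everywhere.
  The evolved unknown is then \<gamma> = H w and not w. Its initial value is just an element of the
  Hilbert space and it has to be continuous in time only; w = G \<gamma> then comes out continuous
  in the graph norm and continuously differentiable in the weaker norm. Density of the range of G is
  not computed from the kernel but falls out of dissipativity and injectivity.

  Dissipativity holds with no boundary value prescribed because the boundary term at 0 in the energy
  identity is - w(0)^2. The same trace w(0) drives a. It is a bounded functional of H w, and 2 w(0)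
  is \<open>kap\<close> of H w. Orthogonality to \<open>u0\<close> says that a is \<open>kap\<close>
  of w, so a single functional governs all modulation data: applied to \<gamma> it gives a', applied
  to w = G \<gamma> it gives a, and applied to G w it gives 2 b up to a constant.\<close>

typedef (overloaded) ('a::real_normed_vector) endo = "UNIV :: ('a \<Rightarrow>\<^sub>L 'a) set"
  morphisms blin Endo by simp

setup_lifting type_definition_endo

section \<open>The Banach algebra of bounded operators on a space\<close>

instantiation endo :: (real_normed_vector) real_normed_vector
begin
lift_definition zero_endo :: "'a endo" is 0 .
lift_definition plus_endo :: "'a endo \<Rightarrow> 'a endo \<Rightarrow> 'a endo" is "(+)" .
lift_definition minus_endo :: "'a endo \<Rightarrow> 'a endo \<Rightarrow> 'a endo" is "(-)" .
lift_definition uminus_endo :: "'a endo \<Rightarrow> 'a endo" is uminus .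
lift_definition scaleR_endo :: "real \<Rightarrow> 'a endo \<Rightarrow> 'a endo" is scaleR .
lift_definition norm_endo :: "'a endo \<Rightarrow> real" is norm .
definition dist_endo :: "'a endo \<Rightarrow> 'a endo \<Rightarrow> real" where "dist_endo A B = norm (A - B)"
definition sgn_endo :: "'a endo \<Rightarrow> 'a endo" where "sgn_endo A = inverse (norm A) *\<^sub>R A"
definition uniformity_endo :: "('a endo \<times> 'a endo) filter"
  where "uniformity_endo = (INF e\<in>{0<..}. principal {(x, y). dist x y < e})"
definition open_endo :: "'a endo set \<Rightarrow> bool"
  where "open_endo U \<longleftrightarrow> (\<forall>x\<in>U. \<forall>\<^sub>F (x', y) in uniformity. x' = x \<longrightarrow> y \<in> U)"
instance
  by standard
    (transfer; auto simp: dist_endo_def sgn_endo_def uniformity_endo_def open_endo_def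
       algebra_simps norm_triangle_ineq)+
end

text \<open>This instance is the purpose of the type \<open>endo\<close>: with composition as
  multiplication, geometric series and \<open>exp\<close> of operators come from the theory of
  Banach algebras. The sort \<open>perfect_space\<close> rules out the zero space, on which 0 and 1
  would coincide.\<close>

instantiation endo :: ("{real_normed_vector, perfect_space}") real_normed_algebra_1
begin
lift_definition one_endo :: "'a endo" is id_blinfun .
lift_definition times_endo :: "'a endo \<Rightarrow> 'a endo \<Rightarrow> 'a endo" is "(o\<^sub>L)" .
instance
proof
  fix a b c :: "'a endo" and r :: real
  show "a * b * c = a * (b * c)" by transfer (auto intro!: blinfun_eqI)
  show "(a + b) * c = a * c + b * c" by transfer (auto intro!: blinfun_eqI simp: blinfun.bilinear_simps)
  show "a * (b + c) = a * b + a * c" by transfer (auto intro!: blinfun_eqI simp: blinfun.bilinear_simps)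
  show "r *\<^sub>R a * b = r *\<^sub>R (a * b)" by transfer (auto intro!: blinfun_eqI simp: blinfun.bilinear_simps)
  show "a * r *\<^sub>R b = r *\<^sub>R (a * b)" by transfer (auto intro!: blinfun_eqI simp: blinfun.bilinear_simps)
  show "1 * a = a" by transfer (auto intro!: blinfun_eqI)
  show "a * 1 = a" by transfer (auto intro!: blinfun_eqI)
  show "(0::'a endo) \<noteq> 1" by transfer (metis norm_blinfun_id norm_zero zero_neq_one)
  show "norm (a * b) \<le> norm a * norm b" by transfer (rule norm_blinfun_compose)
  show "norm (1::'a endo) = 1" by transfer (rule norm_blinfun_id)
qed
end

instance endo :: (banach) banach
proof
  fix X :: "nat \<Rightarrow> 'a endo" assume "Cauchy X"
  then have "Cauchy (\<lambda>n. blin (X n))"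
    by (simp add: Cauchy_def dist_norm dist_endo_def norm_endo.rep_eq minus_endo.rep_eq)
  then obtain L where "(\<lambda>n. blin (X n)) \<longlonglongrightarrow> L"
    by (metis Cauchy_convergent convergent_def)
  then have "X \<longlonglongrightarrow> Endo L"
    by (simp add: LIMSEQ_def dist_norm dist_endo_def norm_endo.rep_eq minus_endo.rep_eq Endo_inverse)
  then show "convergent X" by (auto simp: convergent_def)
qed

definition app :: "'a::real_normed_vector endo \<Rightarrow> 'a \<Rightarrow> 'a"  (infixr "\<bullet>\<^sub>e" 75)
  where "A \<bullet>\<^sub>e x = blinfun_apply (blin A) x"

lemma app_simps:
  "(A + B) \<bullet>\<^sub>e x = A \<bullet>\<^sub>e x + B \<bullet>\<^sub>e x" "(A - B) \<bullet>\<^sub>e x = A \<bullet>\<^sub>e x - B \<bullet>\<^sub>e x"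
  "(- A) \<bullet>\<^sub>e x = - (A \<bullet>\<^sub>e x)" "(r *\<^sub>R A) \<bullet>\<^sub>e x = r *\<^sub>R (A \<bullet>\<^sub>e x)" "0 \<bullet>\<^sub>e x = 0"
  "A \<bullet>\<^sub>e (x + y) = A \<bullet>\<^sub>e x + A \<bullet>\<^sub>e y" "A \<bullet>\<^sub>e (x - y) = A \<bullet>\<^sub>e x - A \<bullet>\<^sub>e y"
  "A \<bullet>\<^sub>e (- x) = - (A \<bullet>\<^sub>e x)" "A \<bullet>\<^sub>e (r *\<^sub>R x) = r *\<^sub>R (A \<bullet>\<^sub>e x)" "A \<bullet>\<^sub>e 0 = 0"
  by (simp_all add: app_def plus_endo.rep_eq minus_endo.rep_eq uminus_endo.rep_eq
      scaleR_endo.rep_eq zero_endo.rep_eq blinfun.bilinear_simps)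

lemma app_mult:
  fixes A B :: "'a::{real_normed_vector, perfect_space} endo"
  shows "(A * B) \<bullet>\<^sub>e x = A \<bullet>\<^sub>e B \<bullet>\<^sub>e x" and app_one: "(1 :: 'a endo) \<bullet>\<^sub>e x = x"
  by (simp_all add: app_def times_endo.rep_eq one_endo.rep_eq)

lemma norm_app: "norm (A \<bullet>\<^sub>e x) \<le> norm A * norm x"
  by (simp add: app_def norm_endo.rep_eq norm_blinfun)

lemma norm_endo_bound:
  assumes "0 \<le> b" "\<And>x. norm (A \<bullet>\<^sub>e x) \<le> b * norm x"
  shows "norm A \<le> b"
  using norm_blinfun_bound[OF assms(1), of "blin A"] assms(2) by (simp add: app_def norm_endo.rep_eq)

lemma bounded_bilinear_app: "bounded_bilinear (\<bullet>\<^sub>e)"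
  by unfold_locales (auto simp: app_simps intro!: exI[of _ 1] norm_app)

lemma endo_eqI: "(\<And>x. A \<bullet>\<^sub>e x = B \<bullet>\<^sub>e x) \<Longrightarrow> A = B"
  by (metis app_def blin_inject blinfun_eqI)

text \<open>The geometric series telescopes. A one-sided inverse suffices, since coercivity turns
  the right inverses built from it into two-sided ones.\<close>

lemma neumann_right_inverse:
  fixes x :: "'a::{real_normed_algebra_1, banach}"
  assumes "norm x < 1"
  shows "\<exists>y. (1 - x) * y = 1"
proof -
  have s: "summable (\<lambda>n. x ^ n)" by (rule complete_algebra_summable_geometric[OF assms])
  have "x * (\<Sum>n. x ^ n) = (\<Sum>n. x ^ Suc n)"
    using suminf_mult[OF s, of x] by simp
  also have "\<dots> = (\<Sum>n. x ^ n) - 1"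
    using suminf_split_head[OF s] by simp
  finally show ?thesis by (intro exI[of _ "\<Sum>n. x ^ n"]) (simp add: algebra_simps)
qed

lemma halfline_antimono:
  fixes f :: "real \<Rightarrow> real"
  assumes "\<And>t. t \<ge> 0 \<Longrightarrow> (f has_real_derivative f' t) (at t within {0..})"
    and "\<And>t. t \<ge> 0 \<Longrightarrow> f' t \<le> 0" and "0 \<le> t"
  shows "f t \<le> f 0"
proof (cases "t = 0")
  case False
  have "\<exists>x\<in>{0<..<t}. f t - f 0 = (*) (f' x) (t - 0)"
  proof (rule mvt_simple)
    fix x assume "0 \<le> x" "x \<le> t"
    then show "(f has_derivative (*) (f' x)) (at x within {0..t})"
      using assms(1)[of x] unfolding has_field_derivative_def by (rule_tac has_derivative_subset) auto
  qed (use False assms(3) in auto)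
  then obtain x where "0 < x" "f t - f 0 = f' x * t" by auto
  then show ?thesis using assms(2)[of x] assms(3) mult_nonpos_nonneg[of "f' x" t] by linarith
qed simp

section \<open>Resolvents of a bounded dissipative operator\<close>

text \<open>\<open>G\<close> stands for the inverse of a generator: for w = G x the first assumption
  is dissipativity of the generator at w, and the second makes the inverse single-valued. The
  generator itself is never formed here.\<close>

locale dissipative =
  fixes G :: "'a::{real_inner, banach, perfect_space} endo"
  assumes dissip: "inner (G \<bullet>\<^sub>e x) x \<le> 0"
    and inj: "G \<bullet>\<^sub>e x = 0 \<Longrightarrow> x = 0"
begin

lemma coercive:
  assumes "0 < e" shows "e * norm x \<le> norm ((e *\<^sub>R 1 - G) \<bullet>\<^sub>e x)"
proof (cases "x = 0")
  case False
  have "e * (norm x * norm x) \<le> inner ((e *\<^sub>R 1 - G) \<bullet>\<^sub>e x) x"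
    using dissip[of x] by (simp add: app_simps app_one inner_diff_left power2_norm_eq_inner[symmetric] power2_eq_square)
  also have "\<dots> \<le> norm ((e *\<^sub>R 1 - G) \<bullet>\<^sub>e x) * norm x"
    by (rule norm_cauchy_schwarz)
  finally show ?thesis using False by (simp add: mult.assoc[symmetric])
qed (simp add: app_simps)

text \<open>Both parts come from \<open>coercive\<close>: applied to R x it bounds R, and applied to
  R (e - G) x - x, which e - G annihilates, it shows that this vector is 0.\<close>

lemma resolvent_bound:
  assumes "0 < e" "(e *\<^sub>R 1 - G) * R = 1"
  shows "norm R \<le> 1 / e" "R * (e *\<^sub>R 1 - G) = 1"
proof -
  show "norm R \<le> 1 / e"
  proof (rule norm_endo_bound)
    fix x
    have "e * norm (R \<bullet>\<^sub>e x) \<le> norm x"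
      using coercive[OF assms(1), of "R \<bullet>\<^sub>e x"] assms(2) by (simp add: app_mult[symmetric] app_one)
    then show "norm (R \<bullet>\<^sub>e x) \<le> 1 / e * norm x" using assms(1) by (simp add: field_simps)
  qed (use assms in simp)
  show "R * (e *\<^sub>R 1 - G) = 1"
  proof (rule endo_eqI)
    fix x
    let ?d = "(R * (e *\<^sub>R 1 - G)) \<bullet>\<^sub>e x - x"
    have "(e *\<^sub>R 1 - G) * (R * (e *\<^sub>R 1 - G)) = e *\<^sub>R 1 - G"
      using assms(2) by (simp add: mult.assoc[symmetric])
    then have "(e *\<^sub>R 1 - G) \<bullet>\<^sub>e (R * (e *\<^sub>R 1 - G)) \<bullet>\<^sub>e x = (e *\<^sub>R 1 - G) \<bullet>\<^sub>e x"
      by (metis app_mult)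
    then have "(e *\<^sub>R 1 - G) \<bullet>\<^sub>e ?d = 0"
      by (simp only: app_simps(7)) simp
    then have "?d = 0" using coercive[OF assms(1), of ?d] assms(1)
      by (simp add: mult_le_0_iff)
    then show "(R * (e *\<^sub>R 1 - G)) \<bullet>\<^sub>e x = 1 \<bullet>\<^sub>e x" by (simp add: app_one)
  qed
qed

text \<open>The Neumann series alone needs e above the norm of G. It is used at c = norm G + 1;
  coercivity bounds R = (c - G)^-1 by 1/c, and in the factorization e - G = (c - G) (1 - (c - e) R)
  the second factor is again a Neumann perturbation of 1, because (c - e)/c < 1 for every e in (0,
  c).\<close>

lemma resolvent_exists:
  assumes "0 < e" "e < norm G + 1"
  shows "\<exists>R. (e *\<^sub>R 1 - G) * R = 1"
proof -
  define c where "c = norm G + 1"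
  have c: "c > 0" "e < c" unfolding c_def using assms by (auto intro: add_nonneg_pos)
  have "norm ((1 / c) *\<^sub>R G) < 1" using c by (simp add: c_def divide_simps)
  then obtain Y where Y: "(1 - (1 / c) *\<^sub>R G) * Y = 1" using neumann_right_inverse by blast
  define R where "R = (1 / c) *\<^sub>R Y"
  have "(c *\<^sub>R 1 - G) * R = (1 - (1 / c) *\<^sub>R G) * Y"
    using c by (simp add: R_def algebra_simps)
  then have R: "(c *\<^sub>R 1 - G) * R = 1" using Y by simp
  have "norm ((c - e) *\<^sub>R R) \<le> (c - e) * (1 / c)"
    using resolvent_bound(1)[OF c(1) R] c(2) by (simp del: times_divide_eq_right add: mult_left_mono)
  also have "\<dots> < 1" using c assms by (simp add: divide_simps)
  finally obtain Z where Z: "(1 - (c - e) *\<^sub>R R) * Z = 1" using neumann_right_inverse by blast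
  have *: "(c *\<^sub>R 1 - G) * (1 - (c - e) *\<^sub>R R) = e *\<^sub>R 1 - G"
  proof -
    have "(c *\<^sub>R 1 - G) * (1 - (c - e) *\<^sub>R R) = (c *\<^sub>R 1 - G) - (c - e) *\<^sub>R ((c *\<^sub>R 1 - G) * R)"
      by (simp add: algebra_simps)
    then show ?thesis unfolding R by (simp add: algebra_simps)
  qed
  have "(e *\<^sub>R 1 - G) * (Z * R) = (c *\<^sub>R 1 - G) * ((1 - (c - e) *\<^sub>R R) * Z) * R"
    unfolding *[symmetric] by (simp add: mult.assoc)
  then have "(e *\<^sub>R 1 - G) * (Z * R) = 1" using Z R by simp
  then show ?thesis by blast
qed

section \<open>Yosida approximations\<close>

text \<open>A strictly decreasing null sequence. The summand 2 keeps even its first term strictly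
  below norm G + 1, the range in which \<open>resolvent_exists\<close> applies.\<close>

definition \<epsilon> :: "nat \<Rightarrow> real" where "\<epsilon> n = (norm G + 1) / (real n + 2)"

definition R :: "nat \<Rightarrow> 'a endo" where "R n = (SOME R. (\<epsilon> n *\<^sub>R 1 - G) * R = 1)"

text \<open>In terms of the generator H = G^-1 and e = \<open>\<epsilon> n\<close>, the operator - R
  n is the Yosida approximation H (1 - e H)^-1, and J n is the resolvent (1 - e H)^-1.\<close>

definition J :: "nat \<Rightarrow> 'a endo" where "J n = 1 - \<epsilon> n *\<^sub>R R n"

lemma eps_pos: "0 < \<epsilon> n" and eps_less: "\<epsilon> n < norm G + 1" and eps_lim: "\<epsilon> \<longlonglongrightarrow> 0"
  and eps_mono: "m < n \<Longrightarrow> \<epsilon> n < \<epsilon> m"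
proof -
  have p: "norm G + 1 > 0" by (auto intro: add_nonneg_pos)
  show "0 < \<epsilon> n" using p by (simp add: \<epsilon>_def)
  show "\<epsilon> n < norm G + 1" using p by (simp add: \<epsilon>_def divide_less_eq distrib_left add_pos_nonneg)
  show "\<epsilon> \<longlonglongrightarrow> 0"     unfolding \<epsilon>_def using LIMSEQ_ignore_initial_segment[OF lim_const_over_n[of "norm G + 1"], of 2] by (simp add: add.commute)
  show "m < n \<Longrightarrow> \<epsilon> n < \<epsilon> m" using p by (simp add: \<epsilon>_def divide_strict_left_mono)
qed

lemma R_right: "(\<epsilon> n *\<^sub>R 1 - G) * R n = 1"
  unfolding R_def using resolvent_exists[OF eps_pos eps_less] by (rule someI_ex)

lemma R_left: "R n * (\<epsilon> n *\<^sub>R 1 - G) = 1"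
  by (rule resolvent_bound(2)[OF eps_pos R_right])

lemma R_G: "R n * G = G * R n"
  using R_right[of n] R_left[of n] by (simp add: algebra_simps)

lemma J_eq: "J n = - (G * R n)"
  using R_right[of n] by (simp add: J_def algebra_simps)

lemma R_R: "R m * R n = R n * R m"
proof -
  have "R m * (\<epsilon> n *\<^sub>R 1 - G) = (\<epsilon> n *\<^sub>R 1 - G) * R m"
    by (simp add: algebra_simps R_G)
  then have "R n * (R m * (\<epsilon> n *\<^sub>R 1 - G)) * R n = R n * ((\<epsilon> n *\<^sub>R 1 - G) * R m) * R n"
    by (simp only:)
  then have "R n * R m * ((\<epsilon> n *\<^sub>R 1 - G) * R n) = R n * (\<epsilon> n *\<^sub>R 1 - G) * R m * R n"
    by (simp only: mult.assoc)
  then show ?thesis unfolding R_left R_right by simp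
qed

text \<open>Writing x = e g - G g, the expansion of the squared norm of x has the cross term - 2 e
  (G g, g), which is nonnegative by dissipativity; J n x is - G g.\<close>

lemma J_contr: "norm (J n \<bullet>\<^sub>e x) \<le> norm x"
proof -
  define g where "g = R n \<bullet>\<^sub>e x"
  have x: "x = \<epsilon> n *\<^sub>R g - G \<bullet>\<^sub>e g"
    using R_right[of n] by (metis app_mult app_one app_simps(2) app_simps(4) g_def)
  have "J n \<bullet>\<^sub>e x = - (G \<bullet>\<^sub>e g)" by (simp add: J_eq app_simps app_mult g_def)
  moreover have "(norm (G \<bullet>\<^sub>e g))\<^sup>2 \<le> (norm x)\<^sup>2"
  proof -
    have "(norm x)\<^sup>2 = (\<epsilon> n)\<^sup>2 * (norm g)\<^sup>2 - 2 * \<epsilon> n * inner (G \<bullet>\<^sub>e g) g + (norm (G \<bullet>\<^sub>e g))\<^sup>2"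
      unfolding x power2_norm_eq_inner
      by (simp add: inner_diff_left inner_diff_right inner_commute algebra_simps power2_eq_square)
    moreover have "0 \<le> (\<epsilon> n)\<^sup>2 * (norm g)\<^sup>2" by simp
    moreover have "2 * \<epsilon> n * inner (G \<bullet>\<^sub>e g) g \<le> 0"
      using eps_pos[of n] dissip[of g] by (simp add: mult_le_0_iff)
    ultimately show ?thesis by linarith
  qed
  ultimately show ?thesis by (simp add: power2_le_iff_abs_le)
qed

lemma J_norm: "norm (J n) \<le> 1"
  by (rule norm_endo_bound) (use J_contr in auto)

text \<open>The sequence \<open>n \<mapsto> \<parallel>J n x\<parallel>\<^sup>2\<close> is increasing and bounded, and its increments dominate
  \<open>\<parallel>J m x - J n x\<parallel>\<^sup>2\<close>; hence \<open>x - J n x\<close> converges, and its limit lies in the kernel of \<open>G\<close>.\<close>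

lemma J_lim: "(\<lambda>n. J n \<bullet>\<^sub>e x) \<longlonglongrightarrow> x"
proof -
  define p where "p n = J n \<bullet>\<^sub>e x" for n
  have Gg: "G \<bullet>\<^sub>e (x - p n) = - (\<epsilon> n *\<^sub>R p n)" for n
  proof -
    have "x - p n = \<epsilon> n *\<^sub>R (R n \<bullet>\<^sub>e x)" by (simp add: p_def J_def app_simps app_one)
    then have "G \<bullet>\<^sub>e (x - p n) = \<epsilon> n *\<^sub>R ((G * R n) \<bullet>\<^sub>e x)" by (simp add: app_simps app_mult)
    then show ?thesis by (simp add: p_def J_eq app_simps)
  qed
  \<comment> \<open>Dissipativity is applied to the difference of x - p n and x - p m. Since G maps
    x - p k to - \<open>\<epsilon> k\<close> p k, this yields (p n, p m - p n) \<ge> 0, that is, the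
    angle at p n is obtuse.\<close>
  have key: "(norm (p m - p n))\<^sup>2 \<le> (norm (p m))\<^sup>2 - (norm (p n))\<^sup>2" if "n < m" for m n
  proof -
    let ?d = "\<epsilon> m" and ?e = "\<epsilon> n" and ?q = "p m" and ?p = "p n"
    have "inner (G \<bullet>\<^sub>e ((x - ?p) - (x - ?q))) ((x - ?p) - (x - ?q)) \<le> 0" by (rule dissip)
    then have "inner (?d *\<^sub>R ?q - ?e *\<^sub>R ?p) (?q - ?p) \<le> 0"
      unfolding app_simps(7)[of G "x - p n"] Gg by simp
    moreover have "inner (?d *\<^sub>R ?q - ?e *\<^sub>R ?p) (?q - ?p)
        = ?d * (norm (?q - ?p))\<^sup>2 - (?e - ?d) * inner ?p (?q - ?p)"
      unfolding power2_norm_eq_inner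
      by (simp add: inner_diff_left inner_diff_right inner_commute) (simp add: algebra_simps)
    moreover have "0 \<le> ?d * (norm (?q - ?p))\<^sup>2" using eps_pos[of m] by simp
    ultimately have "0 \<le> (?e - ?d) * inner ?p (?q - ?p)" by linarith
    then have "0 \<le> inner ?p (?q - ?p)" using eps_mono[OF that] by (simp add: zero_le_mult_iff)
    moreover have "(norm ?q)\<^sup>2 = (norm ?p)\<^sup>2 + (norm (?q - ?p))\<^sup>2 + 2 * inner ?p (?q - ?p)"
      unfolding power2_norm_eq_inner
      by (simp add: inner_diff_left inner_diff_right inner_commute)
    ultimately show ?thesis by linarith
  qed
  have "incseq (\<lambda>n. (norm (p n))\<^sup>2)"
    by (rule incseq_SucI) (smt (verit) key lessI zero_le_power2)
  moreover have "(norm (p n))\<^sup>2 \<le> (norm x)\<^sup>2" for n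
    unfolding p_def using J_contr by (simp add: power_mono)
  ultimately have "convergent (\<lambda>n. (norm (p n))\<^sup>2)"
    using incseq_convergent[of "\<lambda>n. (norm (p n))\<^sup>2"] by (metis convergent_def)
  then have C: "Cauchy (\<lambda>n. (norm (p n))\<^sup>2)" by (simp add: Cauchy_convergent_iff)
  have "Cauchy p"
  proof (rule CauchyI')
    fix e :: real assume "0 < e"
    then obtain N where N: "\<And>m n. m \<ge> N \<Longrightarrow> n \<ge> N \<Longrightarrow> norm ((norm (p m))\<^sup>2 - (norm (p n))\<^sup>2) < e\<^sup>2"
      using CauchyD[OF C, of "e\<^sup>2"] by auto
    show "\<exists>M. \<forall>m\<ge>M. \<forall>n>m. dist (p m) (p n) < e"
    proof (intro exI allI impI)
      fix m n assume "N \<le> m" "m < n"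
      then have "(norm (p n - p m))\<^sup>2 < e\<^sup>2"
        using key[of m n] N[of n m] by auto
      then show "dist (p m) (p n) < e"
        using \<open>0 < e\<close> by (simp add: dist_norm norm_minus_commute power_less_imp_less_base)
    qed
  qed
  then obtain l where l: "p \<longlonglongrightarrow> l" by (metis Cauchy_convergent convergent_def)
  have "(\<lambda>n. G \<bullet>\<^sub>e (x - p n)) \<longlonglongrightarrow> G \<bullet>\<^sub>e (x - l)"
    by (intro bounded_bilinear.tendsto[OF bounded_bilinear_app] tendsto_intros l)
  moreover have "(\<lambda>n. G \<bullet>\<^sub>e (x - p n)) \<longlonglongrightarrow> - (0 *\<^sub>R l)"
    unfolding Gg by (intro tendsto_intros eps_lim l)
  ultimately have "G \<bullet>\<^sub>e (x - l) = 0" using LIMSEQ_unique by fastforce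
  then have "l = x" using inj by fastforce
  then show ?thesis using l by (simp add: p_def[abs_def])
qed

section \<open>Contraction semigroups of the approximants\<close>

definition E :: "nat \<Rightarrow> real \<Rightarrow> 'a endo" where "E n t = exp (t *\<^sub>R (- R n))"

text \<open>Since - R n = (J n - 1)/e, the exponential factors as exp(-t/e) times exp((t/e) J n).
  The norm bound 1 on J n makes the two scalar factors cancel.\<close>

lemma E_norm: assumes "0 \<le> t" shows "norm (E n t) \<le> 1"
proof -
  let ?c = "t / \<epsilon> n"
  have e: "\<epsilon> n \<noteq> 0" using eps_pos[of n] by simp
  have "t *\<^sub>R (- R n) = ?c *\<^sub>R J n + (- ?c) *\<^sub>R 1"
    using e by (simp add: J_def algebra_simps)
  then have "E n t = exp (?c *\<^sub>R J n) * exp ((- ?c) *\<^sub>R 1)"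
    unfolding E_def by (simp only:) (rule exp_add_commuting, simp)
  also have "exp ((- ?c) *\<^sub>R 1) = exp (- ?c) *\<^sub>R (1 :: 'a endo)"
    using exp_of_real[of "- ?c", where 'a = "'a endo"] by (simp add: of_real_def)
  finally have "norm (E n t) = norm (exp (?c *\<^sub>R J n)) * exp (- ?c)" by simp
  also have "\<dots> \<le> exp (norm (?c *\<^sub>R J n)) * exp (- ?c)"
    by (intro mult_right_mono norm_exp) simp
  also have "norm (?c *\<^sub>R J n) \<le> ?c * 1"
    using assms eps_pos[of n] J_norm[of n] by (simp add: divide_right_mono mult_left_le)
  finally show ?thesis by (simp add: exp_minus field_simps)
qed

lemma E_contr: "0 \<le> t \<Longrightarrow> norm (E n t \<bullet>\<^sub>e x) \<le> norm x"
  using norm_app[of "E n t" x] E_norm[of t n] mult_right_mono[of "norm (E n t)" 1 "norm x"] by simp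

lemma exp_commute:
  fixes A B :: "'b::{real_normed_algebra_1, banach}"
  assumes "A * B = B * A" shows "exp A * B = B * exp A"
proof -
  have "A ^ n * B = B * A ^ n" for n
    by (induction n) (simp_all add: assms mult.assoc, metis assms mult.assoc)
  then have "(\<Sum>n. (A ^ n /\<^sub>R fact n) * B) = (\<Sum>n. B * (A ^ n /\<^sub>R fact n))" by simp
  then show ?thesis
    unfolding exp_def using suminf_mult[OF summable_exp_generic[of A], of B]
      suminf_mult2[OF summable_exp_generic[of A], of B] by simp
qed

lemma E_comm: "B * R n = R n * B \<Longrightarrow> E n t * B = B * E n t"
  unfolding E_def by (rule exp_commute) simp

lemma E_deriv: "((\<lambda>t. E n t \<bullet>\<^sub>e x) has_vector_derivative - (E n t \<bullet>\<^sub>e R n \<bullet>\<^sub>e x)) (at t within S)"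
proof -
  have "((\<lambda>t. E n t) has_vector_derivative E n t * (- R n)) (at t within S)"
    unfolding E_def by (rule exp_scaleR_has_vector_derivative_right)
  from bounded_linear.has_vector_derivative[OF bounded_bilinear.bounded_linear_left[OF bounded_bilinear_app] this]
  show ?thesis by (simp add: app_simps app_mult)
qed

lemma E_diff:
  assumes "0 \<le> t"
  shows "norm (E m t \<bullet>\<^sub>e x - E n t \<bullet>\<^sub>e x) \<le> t * norm (R m \<bullet>\<^sub>e x - R n \<bullet>\<^sub>e x)"
proof -
  define h where "h s = E m s \<bullet>\<^sub>e E n (t - s) \<bullet>\<^sub>e x" for s
  have d1: "((\<lambda>s. E n (t - s)) has_vector_derivative E n (t - s) * R n) (at s within S)" for s S
  proof -
    have "(E n has_vector_derivative E n (t - s) * (- R n)) (at (t - s))"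
      unfolding E_def[abs_def] by (rule exp_scaleR_has_vector_derivative_right)
    moreover have "((\<lambda>s. t - s) has_vector_derivative -1) (at s)"
      by (auto intro!: derivative_eq_intros)
    ultimately have "((E n \<circ> (\<lambda>s. t - s)) has_vector_derivative (-1) *\<^sub>R (E n (t - s) * (- R n))) (at s)"
      by (intro vector_diff_chain_at) auto
    then show ?thesis by (auto simp: o_def intro: has_vector_derivative_at_within)
  qed
  have hd: "(h has_vector_derivative (E m s \<bullet>\<^sub>e E n (t - s) \<bullet>\<^sub>e (R n \<bullet>\<^sub>e x - R m \<bullet>\<^sub>e x))) (at s within S)" for s S
  proof -
    have d2: "((\<lambda>t. E m t) has_vector_derivative E m s * (- R m)) (at s within S)"
      unfolding E_def by (rule exp_scaleR_has_vector_derivative_right)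
    have "((\<lambda>s. E m s * E n (t - s)) has_vector_derivative
        E m s * (E n (t - s) * R n) + E m s * (- R m) * E n (t - s)) (at s within S)"
      by (rule bounded_bilinear.has_vector_derivative[OF bounded_bilinear_mult d2 d1])
    moreover have "E m s * (E n (t - s) * R n) + E m s * (- R m) * E n (t - s)
        = E m s * E n (t - s) * (R n - R m)"
      using E_comm[of "R m" n "t - s"] R_R[of m n] by (simp add: algebra_simps mult.assoc)
    ultimately have "((\<lambda>s. E m s * E n (t - s)) has_vector_derivative E m s * E n (t - s) * (R n - R m)) (at s within S)"
      by simp
    from bounded_linear.has_vector_derivative[OF bounded_bilinear.bounded_linear_left[OF bounded_bilinear_app] this, of x]
    show ?thesis by (simp add: h_def[abs_def] app_mult app_simps)
  qed
  have "norm (h t - h 0) \<le> norm (R n \<bullet>\<^sub>e x - R m \<bullet>\<^sub>e x) * norm (t - 0)"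
  proof (rule differentiable_bound)
    show "convex {0..t}" by simp
    fix s assume s: "s \<in> {0..t}"
    show "(h has_derivative (\<lambda>r. r *\<^sub>R (E m s \<bullet>\<^sub>e E n (t - s) \<bullet>\<^sub>e (R n \<bullet>\<^sub>e x - R m \<bullet>\<^sub>e x)))) (at s within {0..t})"
      using hd[of s "{0..t}"] by (simp add: has_vector_derivative_def)
    have "norm (E m s \<bullet>\<^sub>e E n (t - s) \<bullet>\<^sub>e (R n \<bullet>\<^sub>e x - R m \<bullet>\<^sub>e x)) \<le> norm (R n \<bullet>\<^sub>e x - R m \<bullet>\<^sub>e x)"
      using s by (intro order_trans[OF E_contr E_contr]) auto
    then show "onorm (\<lambda>r. r *\<^sub>R (E m s \<bullet>\<^sub>e E n (t - s) \<bullet>\<^sub>e (R n \<bullet>\<^sub>e x - R m \<bullet>\<^sub>e x))) \<le> norm (R n \<bullet>\<^sub>e x - R m \<bullet>\<^sub>e x)"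
      by (intro onorm_bound) (auto simp: mult.commute intro: mult_left_mono)
  qed (use assms in auto)
  moreover have "E k 0 = 1" for k by (simp add: E_def)
  ultimately show ?thesis using assms
    by (simp add: h_def app_one norm_minus_commute mult.commute)
qed

text \<open>For x = G h the estimate \<open>E_diff\<close> involves R n G h = - J n h, which
  converges. A general x is approximated by J k x, which lies in the range of G; contractivity
  controls the remainder uniformly in n and t.\<close>

lemma E_uniformly_Cauchy: "uniformly_Cauchy_on {0..T} (\<lambda>n t. E n t \<bullet>\<^sub>e x)"
proof (cases "T \<ge> 0")
  case T: True
  show ?thesis
  proof (rule uniformly_Cauchy_onI)
    fix e :: real assume e: "0 < e"
    have "\<forall>\<^sub>F k in sequentially. dist (J k \<bullet>\<^sub>e x) x < e / 4"
      using tendstoD[OF J_lim, of "e / 4"] e by simp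
    then obtain k where k: "dist (J k \<bullet>\<^sub>e x) x < e / 4"
      using eventually_happens[of _ sequentially] by auto
    define h where "h = - (R k \<bullet>\<^sub>e x)"
    have h: "norm (x - G \<bullet>\<^sub>e h) < e / 4"
      using k by (simp add: h_def J_eq app_simps app_mult dist_norm norm_minus_commute)
    have RG: "R n \<bullet>\<^sub>e G \<bullet>\<^sub>e h = - (J n \<bullet>\<^sub>e h)" for n
      by (simp add: J_eq R_G app_mult[symmetric] app_simps)
    have "Cauchy (\<lambda>n. J n \<bullet>\<^sub>e h)" using J_lim LIMSEQ_imp_Cauchy by blast
    moreover have "0 < e / (4 * (T + 1))" using e T by simp
    ultimately obtain N where N: "\<And>m n. m \<ge> N \<Longrightarrow> n \<ge> N \<Longrightarrow> norm (J m \<bullet>\<^sub>e h - J n \<bullet>\<^sub>e h) < e / (4 * (T + 1))"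
      using CauchyD[of "\<lambda>n. J n \<bullet>\<^sub>e h"] by blast
    show "\<exists>N. \<forall>t\<in>{0..T}. \<forall>m\<ge>N. \<forall>n\<ge>N. dist (E m t \<bullet>\<^sub>e x) (E n t \<bullet>\<^sub>e x) < e"
    proof (intro exI ballI allI impI)
      fix t m n assume t: "t \<in> {0..T}" and mn: "N \<le> m" "N \<le> n"
      let ?y = "x - G \<bullet>\<^sub>e h"
      have "norm (E m t \<bullet>\<^sub>e (G \<bullet>\<^sub>e h) - E n t \<bullet>\<^sub>e (G \<bullet>\<^sub>e h)) \<le> t * norm (J m \<bullet>\<^sub>e h - J n \<bullet>\<^sub>e h)"
        using E_diff[of t m "G \<bullet>\<^sub>e h" n] t by (simp add: RG norm_minus_commute)
      also have "\<dots> \<le> (T + 1) * (e / (4 * (T + 1)))"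
        using t N[OF mn] by (intro mult_mono) auto
      also have "\<dots> = e / 4" using T by (simp add: divide_simps)
      finally have 1: "norm (E m t \<bullet>\<^sub>e (G \<bullet>\<^sub>e h) - E n t \<bullet>\<^sub>e (G \<bullet>\<^sub>e h)) \<le> e / 4" .
      have 2: "norm (E m t \<bullet>\<^sub>e ?y) < e / 4" "norm (E n t \<bullet>\<^sub>e ?y) < e / 4"
        using E_contr[of t _ ?y] t h by (meson atLeastAtMost_iff order_le_less_trans)+
      have eq: "E m t \<bullet>\<^sub>e x - E n t \<bullet>\<^sub>e x
          = (E m t \<bullet>\<^sub>e (G \<bullet>\<^sub>e h) - E n t \<bullet>\<^sub>e (G \<bullet>\<^sub>e h)) + (E m t \<bullet>\<^sub>e ?y - E n t \<bullet>\<^sub>e ?y)"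
        by (simp add: app_simps)
      show "dist (E m t \<bullet>\<^sub>e x) (E n t \<bullet>\<^sub>e x) < e"
        unfolding dist_norm eq using 1 2 e norm_triangle_ineq4[of "E m t \<bullet>\<^sub>e ?y" "E n t \<bullet>\<^sub>e ?y"]
          norm_triangle_ineq[of "E m t \<bullet>\<^sub>e (G \<bullet>\<^sub>e h) - E n t \<bullet>\<^sub>e (G \<bullet>\<^sub>e h)" "E m t \<bullet>\<^sub>e ?y - E n t \<bullet>\<^sub>e ?y"]
        by linarith
    qed
  qed
qed (simp add: uniformly_Cauchy_on_def)

section \<open>The limit evolution\<close>

definition evolution :: "real \<Rightarrow> 'a \<Rightarrow> 'a" where "evolution t x = lim (\<lambda>n. E n t \<bullet>\<^sub>e x)"

lemma E_uniform_limit: "uniform_limit {0..T} (\<lambda>n t. E n t \<bullet>\<^sub>e x) (\<lambda>t. evolution t x) sequentially"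
  using E_uniformly_Cauchy[of T x] unfolding evolution_def
  by (simp add: Cauchy_uniformly_convergent uniformly_convergent_uniform_limit_iff[symmetric])

text \<open>Convergence is uniform on compact time intervals only, while derivatives are taken
  within the closed half-line. Ending the interval at t + 1 keeps t away from its right end, so both
  neighbourhood filters agree.\<close>

lemma at_within_ge: "0 \<le> t \<Longrightarrow> at t within {0..t+1} = at t within {0::real..}"
  by (rule at_within_nhd[of _ "{..<t+1}"]) auto

lemma evolution_0: "evolution 0 x = x"
  by (simp add: evolution_def E_def app_one)

lemma evolution_continuous: "continuous_on {0..} (\<lambda>t. evolution t x)"
proof -
  have "continuous_on {0..T} (\<lambda>t. evolution t x)" for T
  proof (rule uniform_limit_theorem[OF _ E_uniform_limit])
    show "\<forall>\<^sub>F n in sequentially. continuous_on {0..T} (\<lambda>t. E n t \<bullet>\<^sub>e x)"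
      using E_deriv by (auto intro!: always_eventually continuous_on_vector_derivative)
  qed simp
  then have "continuous (at t within {0..t+1}) (\<lambda>t. evolution t x)" if "t \<ge> 0" for t
    using that by (simp add: continuous_on_eq_continuous_within)
  then show ?thesis
    by (auto simp: continuous_on_eq_continuous_within at_within_ge)
qed

text \<open>The derivative of G E n t x is E n t (J n x), because - G R n = J n. The derivatives
  converge locally uniformly to the evolution, so limit and derivative may be exchanged;
  differentiating the evolution itself would call for the generator.\<close>

lemma evolution_deriv:
  assumes "0 \<le> t"
  shows "((\<lambda>t. G \<bullet>\<^sub>e evolution t x) has_vector_derivative evolution t x) (at t within {0..})"
proof -
  let ?S = "{0..t+1}"
  have d: "((\<lambda>s. G \<bullet>\<^sub>e E n s \<bullet>\<^sub>e x) has_vector_derivative E n s \<bullet>\<^sub>e J n \<bullet>\<^sub>e x) (at s within ?S)" for n s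
  proof -
    have "((\<lambda>s. G \<bullet>\<^sub>e E n s \<bullet>\<^sub>e x) has_vector_derivative G \<bullet>\<^sub>e (- (E n s \<bullet>\<^sub>e R n \<bullet>\<^sub>e x))) (at s within ?S)"
      by (rule bounded_linear.has_vector_derivative[OF bounded_bilinear.bounded_linear_right[OF bounded_bilinear_app] E_deriv])
    moreover have "G \<bullet>\<^sub>e (- (E n s \<bullet>\<^sub>e R n \<bullet>\<^sub>e x)) = E n s \<bullet>\<^sub>e J n \<bullet>\<^sub>e x"
      using E_comm[of G n s] by (simp add: J_eq app_simps R_G app_mult[symmetric] mult.assoc[symmetric])
    ultimately show ?thesis by simp
  qed
  have "\<exists>g. \<forall>s\<in>?S. (\<lambda>n. G \<bullet>\<^sub>e E n s \<bullet>\<^sub>e x) \<longlonglongrightarrow> g s \<and> (g has_derivative (\<lambda>h. h *\<^sub>R evolution s x)) (at s within ?S)"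
  proof (rule has_derivative_sequence)
    show "((\<lambda>s. G \<bullet>\<^sub>e E n s \<bullet>\<^sub>e x) has_derivative (\<lambda>h. h *\<^sub>R (E n s \<bullet>\<^sub>e J n \<bullet>\<^sub>e x))) (at s within ?S)" for n s
      using d by (simp add: has_vector_derivative_def)
    show "\<forall>\<^sub>F n in sequentially. \<forall>s\<in>?S. \<forall>h. norm (h *\<^sub>R (E n s \<bullet>\<^sub>e J n \<bullet>\<^sub>e x) - h *\<^sub>R evolution s x) \<le> e * norm h"
      if "0 < e" for e
    proof -
      have "\<forall>\<^sub>F n in sequentially. dist (J n \<bullet>\<^sub>e x) x < e / 2"
        using tendstoD[OF J_lim, of "e / 2"] that by simp
      moreover have "\<forall>\<^sub>F n in sequentially. \<forall>s\<in>?S. dist (E n s \<bullet>\<^sub>e x) (evolution s x) < e / 2"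
        using uniform_limitD[OF E_uniform_limit, of "e / 2"] that by simp
      ultimately show ?thesis
      proof eventually_elim
        case (elim n)
        show ?case
        proof (intro ballI allI)
          fix s h assume s: "s \<in> ?S"
          have "norm (E n s \<bullet>\<^sub>e (J n \<bullet>\<^sub>e x - x)) \<le> e / 2"
            using E_contr[of s n "J n \<bullet>\<^sub>e x - x"] s elim(1) by (simp add: dist_norm)
          moreover have "norm (E n s \<bullet>\<^sub>e x - evolution s x) \<le> e / 2"
            using elim(2) s by (auto simp: dist_norm less_imp_le)
          ultimately have "norm (E n s \<bullet>\<^sub>e J n \<bullet>\<^sub>e x - evolution s x) \<le> e"
            using norm_triangle_ineq[of "E n s \<bullet>\<^sub>e (J n \<bullet>\<^sub>e x - x)" "E n s \<bullet>\<^sub>e x - evolution s x"]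
            by (simp add: app_simps)
          then show "norm (h *\<^sub>R (E n s \<bullet>\<^sub>e J n \<bullet>\<^sub>e x) - h *\<^sub>R evolution s x) \<le> e * norm h"
            using mult_left_mono[of _ e "\<bar>h\<bar>"]
            by (simp add: scaleR_diff_right[symmetric] mult.commute[of e])
        qed
      qed
    qed
    show "0 \<in> ?S" using assms by simp
    show "(\<lambda>n. G \<bullet>\<^sub>e E n 0 \<bullet>\<^sub>e x) \<longlonglongrightarrow> G \<bullet>\<^sub>e x" by (simp add: E_def app_one)
  qed simp
  then obtain g where g: "\<And>s. s \<in> ?S \<Longrightarrow> (\<lambda>n. G \<bullet>\<^sub>e E n s \<bullet>\<^sub>e x) \<longlonglongrightarrow> g s"
    "\<And>s. s \<in> ?S \<Longrightarrow> (g has_vector_derivative evolution s x) (at s within ?S)"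
    unfolding has_vector_derivative_def by metis
  have "g s = G \<bullet>\<^sub>e evolution s x" if "s \<in> ?S" for s
  proof (rule LIMSEQ_unique[OF g(1)[OF that]])
    have "(\<lambda>n. E n s \<bullet>\<^sub>e x) \<longlonglongrightarrow> evolution s x"
      using tendsto_uniform_limitI[OF E_uniform_limit that] .
    then show "(\<lambda>n. G \<bullet>\<^sub>e E n s \<bullet>\<^sub>e x) \<longlonglongrightarrow> G \<bullet>\<^sub>e evolution s x"
      by (intro bounded_bilinear.tendsto[OF bounded_bilinear_app] tendsto_const)
  qed
  then have "((\<lambda>s. G \<bullet>\<^sub>e evolution s x) has_vector_derivative evolution t x) (at t within ?S)"
    using g(2)[of t] assms by (auto intro: has_vector_derivative_transform[rotated 2])
  then show ?thesis by (simp add: at_within_ge assms)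
qed

end

text \<open>The weighted energy exp(2 c t) (\<omega> t, \<omega> t) has nonpositive
  derivative.\<close>

lemma energy_decay:
  fixes \<omega> \<gamma> :: "real \<Rightarrow> 'a::real_inner"
  assumes d: "\<And>t. 0 \<le> t \<Longrightarrow> (\<omega> has_vector_derivative \<gamma> t) (at t within {0..})"
    and i: "\<And>t. 0 \<le> t \<Longrightarrow> inner (\<omega> t) (\<gamma> t) \<le> - c * (norm (\<omega> t))\<^sup>2" and t: "0 \<le> t"
  shows "norm (\<omega> t) \<le> exp (- c * t) * norm (\<omega> 0)"
proof -
  have *: "((\<lambda>t. exp (2 * c * t) * inner (\<omega> t) (\<omega> t)) has_real_derivative
      exp (2 * c * s) * (2 * (inner (\<omega> s) (\<gamma> s) + c * inner (\<omega> s) (\<omega> s)))) (at s within {0..})" if "0 \<le> s" for s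
  proof -
    have "((\<lambda>t. inner (\<omega> t) (\<omega> t)) has_vector_derivative inner (\<omega> s) (\<gamma> s) + inner (\<gamma> s) (\<omega> s)) (at s within {0..})"
      by (rule bounded_bilinear.has_vector_derivative[OF bounded_bilinear_inner d[OF that] d[OF that]])
    then have "((\<lambda>t. inner (\<omega> t) (\<omega> t)) has_real_derivative 2 * inner (\<omega> s) (\<gamma> s)) (at s within {0..})"
      by (simp add: has_real_derivative_iff_has_vector_derivative inner_commute)
    then show ?thesis by (auto intro!: derivative_eq_intros simp: algebra_simps)
  qed
  have "exp (2 * c * t) * inner (\<omega> t) (\<omega> t) \<le> exp (2 * c * 0) * inner (\<omega> 0) (\<omega> 0)"
  proof (rule halfline_antimono[OF * _ t])
    fix s :: real assume "0 \<le> s"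
    then show "exp (2 * c * s) * (2 * (inner (\<omega> s) (\<gamma> s) + c * inner (\<omega> s) (\<omega> s))) \<le> 0"
      using i[of s] by (simp add: mult_le_0_iff power2_norm_eq_inner)
  qed
  then have "(exp (c * t) * norm (\<omega> t))\<^sup>2 \<le> (norm (\<omega> 0))\<^sup>2"
    by (simp add: power_mult_distrib power2_norm_eq_inner exp_double[symmetric] mult.assoc)
  then have "exp (c * t) * norm (\<omega> t) \<le> norm (\<omega> 0)"
    by (rule power2_le_imp_le) simp
  then show ?thesis by (simp add: exp_minus field_simps)
qed

section \<open>The Hilbert space \<open>L\<^sup>2\<close> on the half-line\<close>

lemma L2_measurable: "f \<in> L2 M \<Longrightarrow> f \<in> borel_measurable M"
  and L2_square_integrable: "f \<in> L2 M \<Longrightarrow> integrable M (\<lambda>x. (f x)\<^sup>2)"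
  by (auto simp: L2_def)

lemma L2_mult_integrable:
  assumes "f \<in> L2 M" "g \<in> L2 M"
  shows "integrable M (\<lambda>x. f x * g x)"
proof (rule Bochner_Integration.integrable_bound)
  show "integrable M (\<lambda>x. (f x)\<^sup>2 + (g x)\<^sup>2)" using assms by (auto simp: L2_def)
  show "(\<lambda>x. f x * g x) \<in> borel_measurable M" using assms by (auto simp: L2_def)
  show "AE x in M. norm (f x * g x) \<le> norm ((f x)\<^sup>2 + (g x)\<^sup>2)"
  proof (rule AE_I2)
    fix x
    have "0 \<le> (\<bar>f x\<bar> - \<bar>g x\<bar>)\<^sup>2" "0 \<le> \<bar>f x\<bar> * \<bar>g x\<bar>" by simp_all
    then have "\<bar>f x\<bar> * \<bar>g x\<bar> \<le> (f x)\<^sup>2 + (g x)\<^sup>2"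
      by (simp only: power2_diff power2_abs)
    then show "norm (f x * g x) \<le> norm ((f x)\<^sup>2 + (g x)\<^sup>2)"
      by (simp add: abs_mult)
  qed
qed

lemma L2_bound:
  assumes "g \<in> L2 M" "f \<in> borel_measurable M" "AE x in M. \<bar>f x\<bar> \<le> C * \<bar>g x\<bar>"
  shows "f \<in> L2 M"
proof -
  have "integrable M (\<lambda>x. (f x)\<^sup>2)"
  proof (rule Bochner_Integration.integrable_bound)
    show "integrable M (\<lambda>x. C\<^sup>2 * (g x)\<^sup>2)" using assms(1) by (auto simp: L2_def)
    show "AE x in M. norm ((f x)\<^sup>2) \<le> norm (C\<^sup>2 * (g x)\<^sup>2)"
      using assms(3)
    proof eventually_elim
      case (elim x)
      then have "\<bar>f x\<bar>\<^sup>2 \<le> (C * \<bar>g x\<bar>)\<^sup>2" by (intro power_mono) auto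
      then show ?case by (simp add: power_mult_distrib)
    qed
  qed (use assms in auto)
  then show ?thesis using assms by (auto simp: L2_def)
qed

lemma L2_scale: "f \<in> L2 M \<Longrightarrow> (\<lambda>x. c * f x) \<in> L2 M"
  by (rule L2_bound[of f M _ "\<bar>c\<bar>"]) (auto simp: L2_def abs_mult)

lemma L2_add:
  assumes "f \<in> L2 M" "g \<in> L2 M" shows "(\<lambda>x. f x + g x) \<in> L2 M"
proof -
  have "(\<lambda>x. (f x + g x)\<^sup>2) = (\<lambda>x. (f x)\<^sup>2 + (g x)\<^sup>2 + 2 * (f x * g x))"
    by (auto simp: power2_sum)
  then show ?thesis using assms L2_mult_integrable[OF assms] by (auto simp: L2_def)
qed

lemma L2_uminus: "f \<in> L2 M \<Longrightarrow> (\<lambda>x. - f x) \<in> L2 M"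
  using L2_scale[of f M "-1"] by simp

lemma L2_diff: "f \<in> L2 M \<Longrightarrow> g \<in> L2 M \<Longrightarrow> (\<lambda>x. f x - g x) \<in> L2 M"
  using L2_add[of f M "\<lambda>x. - g x"] L2_uminus[of g M] by simp

lemma L2_zero: "(\<lambda>_. 0) \<in> L2 M"
  by (auto simp: L2_def)

abbreviation half :: "real measure" where "half \<equiv> lebesgue_on {..<0}"

lemma space_half [simp]: "space half = {..<0}"
  by (simp add: space_restrict_space)

lemma sigma_finite_half: "sigma_finite_measure half"
proof (rule sigma_finite_measure_restrict_space)
  show "sigma_finite_measure (lebesgue :: real measure)"
  proof
    show "\<exists>A. countable A \<and> A \<subseteq> sets lebesgue \<and> \<Union> A = space lebesgue \<and> (\<forall>a\<in>A. emeasure lebesgue (a :: real set) \<noteq> \<infinity>)"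
      by (intro exI[of _ "range (\<lambda>n. {- real n..real n})"])
        (auto, metis abs_le_iff minus_le_iff real_arch_simple)
  qed
qed auto

interpretation half: sigma_finite_measure half by (rule sigma_finite_half)

lemma measurable_half [measurable]: "(\<lambda>x. x) \<in> borel_measurable half"
  by (rule measurable_restrict_space1) (simp add: id_def[symmetric] lebesgue_measurable_vimage_borel measurable_completion)

lemma borel_measurable_half: "f \<in> borel_measurable borel \<Longrightarrow> f \<in> borel_measurable half"
  using measurable_compose[OF measurable_half] by auto

\<comment> \<open>The locale needs a Hilbert space that is a type, so functions are identified
  almost everywhere. The relation is partial because a function outside \<open>L2 half\<close>
  represents nothing.\<close>
quotient_type l2 = "real \<Rightarrow> real" / partial:
  "\<lambda>f g. f \<in> L2 half \<and> g \<in> L2 half \<and> (AE x in half. f x = g x)"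
  morphisms rep_l2' abs_l2
proof (rule part_equivpI)
  show "\<exists>x. x \<in> L2 half \<and> x \<in> L2 half \<and> (AE xa in half. x xa = x xa)"
    by (intro exI[of _ "\<lambda>_. 0"]) (simp add: L2_zero)
  show "symp (\<lambda>f g. f \<in> L2 half \<and> g \<in> L2 half \<and> (AE x in half. f x = g x))"
    by (simp add: symp_def eq_commute)
  show "transp (\<lambda>f g. f \<in> L2 half \<and> g \<in> L2 half \<and> (AE x in half. f x = g x))"
  proof (rule transpI, intro conjI)
    fix f g h :: "real \<Rightarrow> real"
    assume fg: "f \<in> L2 half \<and> g \<in> L2 half \<and> (AE x in half. f x = g x)"
      and gh: "g \<in> L2 half \<and> h \<in> L2 half \<and> (AE x in half. g x = h x)"
    from fg have "AE x in half. f x = g x" by simp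
    moreover from gh have "AE x in half. g x = h x" by simp
    ultimately show "AE x in half. f x = h x" by eventually_elim simp
    show "f \<in> L2 half" "h \<in> L2 half" using fg gh by simp_all
  qed
qed

lemma integral_mult_cong_AE:
  assumes "f \<in> L2 M" "f' \<in> L2 M" "AE x in M. f x = f' x"
    and "g \<in> L2 M" "g' \<in> L2 M" "AE x in M. g x = g' x"
  shows "(\<integral>x. f x * g x \<partial>M) = (\<integral>x. f' x * g' x \<partial>M)"
  by (rule integral_cong_AE) (use assms in \<open>auto simp: L2_def\<close>)

instantiation l2 :: real_inner
begin
lift_definition zero_l2 :: l2 is "\<lambda>_. 0" by (simp add: L2_zero)
lift_definition plus_l2 :: "l2 \<Rightarrow> l2 \<Rightarrow> l2" is "\<lambda>f g x. f x + g x" by (auto simp: L2_add)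
lift_definition minus_l2 :: "l2 \<Rightarrow> l2 \<Rightarrow> l2" is "\<lambda>f g x. f x - g x" by (auto simp: L2_diff)
lift_definition uminus_l2 :: "l2 \<Rightarrow> l2" is "\<lambda>f x. - f x" by (auto simp: L2_uminus)
lift_definition scaleR_l2 :: "real \<Rightarrow> l2 \<Rightarrow> l2" is "\<lambda>c f x. c * f x" by (auto simp: L2_scale)
lift_definition inner_l2 :: "l2 \<Rightarrow> l2 \<Rightarrow> real" is "\<lambda>f g. \<integral>x. f x * g x \<partial>half"
  by (rule integral_mult_cong_AE) auto
definition norm_l2 :: "l2 \<Rightarrow> real" where "norm_l2 x = sqrt (inner x x)"
definition sgn_l2 :: "l2 \<Rightarrow> l2" where "sgn_l2 x = inverse (norm x) *\<^sub>R x"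
definition dist_l2 :: "l2 \<Rightarrow> l2 \<Rightarrow> real" where "dist_l2 x y = norm (x - y)"
definition uniformity_l2 :: "(l2 \<times> l2) filter"
  where "uniformity_l2 = (INF e\<in>{0<..}. principal {(x, y). dist x y < e})"
definition open_l2 :: "l2 set \<Rightarrow> bool"
  where "open_l2 U \<longleftrightarrow> (\<forall>x\<in>U. \<forall>\<^sub>F (x', y) in uniformity. x' = x \<longrightarrow> y \<in> U)"
instance
proof
  fix x y z :: l2 and a b :: real and U :: "l2 set"
  show "x + y + z = x + (y + z)" by transfer (auto simp: add.assoc intro!: L2_add)
  show "x + y = y + x" by transfer (auto simp: add.commute intro!: L2_add)
  show "0 + x = x" by transfer auto
  show "- x + x = 0" by transfer (auto simp: L2_zero)
  show "x - y = x + - y" by transfer (auto intro!: L2_diff)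
  show "a *\<^sub>R (x + y) = a *\<^sub>R x + a *\<^sub>R y"
    by transfer (auto simp: distrib_left intro!: L2_add L2_scale)
  show "(a + b) *\<^sub>R x = a *\<^sub>R x + b *\<^sub>R x"
    by transfer (auto simp: distrib_right intro!: L2_add L2_scale)
  show "a *\<^sub>R b *\<^sub>R x = (a * b) *\<^sub>R x" by transfer (auto simp: mult.assoc intro!: L2_scale)
  show "1 *\<^sub>R x = x" by transfer auto
  show "dist x y = norm (x - y)" by (simp add: dist_l2_def)
  show "sgn x = inverse (norm x) *\<^sub>R x" by (simp add: sgn_l2_def)
  show "uniformity = (INF e\<in>{0 <..}. principal {(x, y). dist (x::l2) y < e})"
    by (simp add: uniformity_l2_def)
  show "open U \<longleftrightarrow> (\<forall>x\<in>U. \<forall>\<^sub>F (x', y) in uniformity. x' = x \<longrightarrow> y \<in> U)"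
    by (simp add: open_l2_def)
  show "inner x y = inner y x" by transfer (simp add: mult.commute)
  show "inner (x + y) z = inner x z + inner y z"
    by transfer (simp add: distrib_right L2_mult_integrable)
  show "inner (a *\<^sub>R x) y = a * inner x y" by transfer (simp add: mult.assoc)
  show "0 \<le> inner x x" by transfer simp
  show "inner x x = 0 \<longleftrightarrow> x = 0"
  proof transfer
    fix f :: "real \<Rightarrow> real" assume "f \<in> L2 half \<and> f \<in> L2 half \<and> (AE x in half. f x = f x)"
    then have f: "f \<in> L2 half" by simp
    have "(\<integral>x. f x * f x \<partial>half) = 0 \<longleftrightarrow> (AE x in half. f x * f x = 0)"
      by (rule integral_nonneg_eq_0_iff_AE) (use L2_mult_integrable[OF f f] in auto)
    then show "((\<integral>x. f x * f x \<partial>half) = 0) = (f \<in> L2 half \<and> (\<lambda>_. 0) \<in> L2 half \<and> (AE x in half. f x = 0))"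
      using f by (simp add: L2_zero)
  qed
  show "norm x = sqrt (inner x x)" by (simp add: norm_l2_def)
qed
end

definition l2_rep :: "l2 \<Rightarrow> real \<Rightarrow> real" where "l2_rep x = (SOME f. f \<in> L2 half \<and> abs_l2 f = x)"

lemma l2_rep_L2: "l2_rep x \<in> L2 half" and abs_fn: "abs_l2 (l2_rep x) = x"
proof -
  obtain f where "f \<in> L2 half" "abs_l2 f = x"
    using Quotient_l2 by (metis (no_types, lifting) Quotient_abs_rep Quotient_rep_reflp)
  then have "l2_rep x \<in> L2 half \<and> abs_l2 (l2_rep x) = x"
    unfolding l2_rep_def by (intro someI[of "\<lambda>f. f \<in> L2 half \<and> abs_l2 f = x" f]) simp
  then show "l2_rep x \<in> L2 half" "abs_l2 (l2_rep x) = x" by auto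
qed

lemma l2_rep_measurable [measurable]: "l2_rep x \<in> borel_measurable half"
  by (rule L2_measurable[OF l2_rep_L2])

lemma abs_l2_eq_iff: "f \<in> L2 half \<Longrightarrow> g \<in> L2 half \<Longrightarrow> abs_l2 f = abs_l2 g \<longleftrightarrow> (AE x in half. f x = g x)"
  using Quotient_rel[OF Quotient_l2, of f g] by auto

lemma l2_rep_abs: "f \<in> L2 half \<Longrightarrow> AE x in half. l2_rep (abs_l2 f) x = f x"
  using abs_l2_eq_iff[of "l2_rep (abs_l2 f)" f] l2_rep_L2 abs_fn by auto

lemma abs_l2_add: "f \<in> L2 half \<Longrightarrow> g \<in> L2 half \<Longrightarrow> abs_l2 f + abs_l2 g = abs_l2 (\<lambda>x. f x + g x)"
  and abs_l2_diff: "f \<in> L2 half \<Longrightarrow> g \<in> L2 half \<Longrightarrow> abs_l2 f - abs_l2 g = abs_l2 (\<lambda>x. f x - g x)"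
  and abs_l2_scaleR: "f \<in> L2 half \<Longrightarrow> c *\<^sub>R abs_l2 f = abs_l2 (\<lambda>x. c * f x)"
  and inner_abs_l2: "f \<in> L2 half \<Longrightarrow> g \<in> L2 half \<Longrightarrow> inner (abs_l2 f) (abs_l2 g) = (\<integral>x. f x * g x \<partial>half)"
  by (auto simp: plus_l2.abs_eq minus_l2.abs_eq scaleR_l2.abs_eq inner_l2.abs_eq)

lemma abs_l2_zero: "abs_l2 (\<lambda>_. 0) = 0"
  by (simp add: zero_l2_def)

lemma norm_abs_l2: "f \<in> L2 half \<Longrightarrow> norm (abs_l2 f) = L2_norm half f"
  by (simp add: norm_eq_sqrt_inner inner_abs_l2 L2_norm_def power2_eq_square)

lemma inner_fn_right: "f \<in> L2 half \<Longrightarrow> inner (abs_l2 f) x = (\<integral>z. f z * l2_rep x z \<partial>half)"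
  using inner_abs_l2[OF _ l2_rep_L2] by (simp add: abs_fn)

lemma Cauchy_Schwarz_half:
  assumes "f \<in> L2 half" "g \<in> L2 half"
  shows "\<bar>\<integral>x. f x * g x \<partial>half\<bar> \<le> L2_norm half f * L2_norm half g"
  using Cauchy_Schwarz_ineq2[of "abs_l2 f" "abs_l2 g"] assms by (simp add: inner_abs_l2 norm_abs_l2)

lemma L2_norm_nonneg: "0 \<le> L2_norm M f"
  by (simp add: L2_norm_def)

lemma integrable_half: "integrable lborel f \<Longrightarrow> integrable half f"
  for f :: "real \<Rightarrow> real"
  by (auto simp: integrable_restrict_space integrable_completion
      intro!: integrable_mult_indicator[where 'b = real] simp del: real_scaleR_def)

lemma integrable_gaussian: "0 < c \<Longrightarrow> integrable lborel (\<lambda>x. exp (- c * x\<^sup>2))" for c :: real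
proof -
  assume c: "0 < c"
  define s where "s = sqrt (1 / (2 * c))"
  have s: "0 < s" "2 * s\<^sup>2 = 1 / c" using c by (simp_all add: s_def)
  have "integrable lborel (\<lambda>x. sqrt (2 * pi * s\<^sup>2) * normal_density 0 s x)"
    using s by (intro integrable_mult_right integrable_normal_density)
  moreover have "sqrt (2 * pi * s\<^sup>2) * normal_density 0 s x = exp (- c * x\<^sup>2)" for x
    using s c by (simp add: normal_density_def)
  ultimately show ?thesis by simp
qed

lemma gaussian_L2: "0 < (c :: real) \<Longrightarrow> (\<lambda>x. exp (- c * x\<^sup>2)) \<in> L2 half"
  using integrable_half[OF integrable_gaussian[of "2 * c"]]
  by (auto simp: L2_def power2_eq_square exp_add[symmetric] algebra_simps intro!: borel_measurable_half)

text \<open>An auxiliary strictly positive element of the space, distinct from the weight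
  \<open>gauss\<close> that belongs to the equation. Multiplication by it makes square integrable
  functions integrable without losing null sets.\<close>

definition gauss_weight :: "real \<Rightarrow> real" where "gauss_weight x = exp (- 1 * x\<^sup>2)"

lemma gauss_weight_L2: "gauss_weight \<in> L2 half" and gauss_weight_pos: "0 < gauss_weight x"
  using gaussian_L2[of 1] by (simp_all add: gauss_weight_def[abs_def])

lemma exists_nonzero_l2: "\<exists>v::l2. v \<noteq> 0"
proof
  show "abs_l2 gauss_weight \<noteq> 0"
  proof
    assume "abs_l2 gauss_weight = 0"
    then have "AE x in half. gauss_weight x = 0"
      using abs_l2_eq_iff[OF gauss_weight_L2 L2_zero] abs_l2_zero by simp
    then have "AE x in half. False" using gauss_weight_pos by (auto simp: less_imp_neq[symmetric])
    then have "emeasure half {..<0} = 0"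
      using AE_iff_measurable[of "{..<0}" half "\<lambda>_. False"] by auto
    moreover have "emeasure lebesgue {-1..<0::real} \<le> emeasure lebesgue {..<0::real}"
      by (rule emeasure_mono) auto
    ultimately show False by (simp add: emeasure_restrict_space)
  qed
qed

instance l2 :: perfect_space
proof
  fix x :: l2
  obtain v :: l2 where v: "v \<noteq> 0" using exists_nonzero_l2 by blast
  show "\<not> open {x}"
  proof
    assume "open {x}"
    then obtain e where e: "e > 0" "\<And>y. dist y x < e \<Longrightarrow> y = x" by (auto simp: open_dist)
    have "dist (x + (e / 2 / norm v) *\<^sub>R v) x < e" using v e(1) by (simp add: dist_norm)
    from e(2)[OF this] show False using v e(1) by simp
  qed
qed

text \<open>Riesz--Fischer. The weight turns a series summable in \<open>L\<^sup>2\<close> into one summable in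
  \<open>L\<^sup>1\<close>, which gives convergence almost everywhere.\<close>

lemma Cauchy_l2_AE_convergent_subseq:
  fixes X :: "nat \<Rightarrow> l2"
  assumes "Cauchy X"
  shows "\<exists>r. strict_mono r \<and> (AE x in half. convergent (\<lambda>n. l2_rep (X (r n)) x))"
proof -
  have "\<exists>r. strict_mono r \<and> (\<forall>n. dist (X (r (Suc n))) (X (r n)) < (1/2)^n)"
  proof -
    have "\<forall>n. \<exists>N. \<forall>m\<ge>N. \<forall>k\<ge>N. dist (X m) (X k) < (1/2)^n"
      using assms unfolding Cauchy_def by simp
    \<comment> \<open>Summing the thresholds makes the subsequence strictly increasing, while r n
      and r (Suc n) both exceed N n; this controls consecutive terms.\<close>
    then obtain N where N: "\<And>n m k. m \<ge> N n \<Longrightarrow> k \<ge> N n \<Longrightarrow> dist (X m) (X k) < (1/2)^n" by metis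
    define r where "r n = (\<Sum>i\<le>n. N i) + n" for n
    have "N n \<le> r n" for n unfolding r_def by (simp add: trans_le_add1 member_le_sum)
    moreover have "N n \<le> r (Suc n)" for n
      unfolding r_def using member_le_sum[of n "{..Suc n}" N] by (simp add: trans_le_add1)
    moreover have "strict_mono r" by (rule strict_mono_Suc_iff[THEN iffD2]) (simp add: r_def)
    ultimately show ?thesis using N by blast
  qed
  then obtain r where r: "strict_mono r" "\<And>n. dist (X (r (Suc n))) (X (r n)) < (1/2)^n" by blast
  define d where "d n x = l2_rep (X (r (Suc n))) x - l2_rep (X (r n)) x" for n x
  have dL: "d n \<in> L2 half" for n unfolding d_def[abs_def] by (intro L2_diff l2_rep_L2)
  have dn: "L2_norm half (d n) \<le> (1/2)^n" for n
    using r(2)[of n] norm_abs_l2[OF dL, of n] abs_l2_diff[OF l2_rep_L2 l2_rep_L2, of "X (r (Suc n))" "X (r n)"]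
    by (simp add: d_def[abs_def] abs_fn dist_norm)
  have dabs: "(\<lambda>x. \<bar>d n x\<bar>) \<in> L2 half" for n
    by (rule L2_bound[OF dL[of n], of _ 1]) (use dL[of n] in \<open>auto simp: L2_def\<close>)
  have dm [measurable]: "d n \<in> borel_measurable half" for n using dL by (rule L2_measurable)
  have "(\<integral>\<^sup>+x. ennreal (gauss_weight x * \<bar>d n x\<bar>) \<partial>half) \<le> ennreal (L2_norm half gauss_weight * (1/2)^n)" for n
  proof -
    have "(\<integral>\<^sup>+x. ennreal (gauss_weight x * \<bar>d n x\<bar>) \<partial>half) = ennreal (\<integral>x. gauss_weight x * \<bar>d n x\<bar> \<partial>half)"
      by (rule nn_integral_eq_integral) (use L2_mult_integrable[OF gauss_weight_L2 dabs] gauss_weight_pos in \<open>auto simp: less_imp_le\<close>)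
    then have 1: "(\<integral>\<^sup>+x. ennreal (gauss_weight x * \<bar>d n x\<bar>) \<partial>half) = ennreal (\<integral>x. gauss_weight x * \<bar>d n x\<bar> \<partial>half)" .
    have "(\<integral>x. gauss_weight x * \<bar>d n x\<bar> \<partial>half) \<le> L2_norm half gauss_weight * L2_norm half (\<lambda>x. \<bar>d n x\<bar>)"
      using Cauchy_Schwarz_half[OF gauss_weight_L2 dabs[of n]] by linarith
    also have "L2_norm half (\<lambda>x. \<bar>d n x\<bar>) = L2_norm half (d n)" by (simp add: L2_norm_def)
    also have "L2_norm half gauss_weight * L2_norm half (d n) \<le> L2_norm half gauss_weight * (1/2)^n"
      by (intro mult_left_mono dn L2_norm_nonneg)
    finally show ?thesis unfolding 1 by (rule ennreal_leI)
  qed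
  then have "(\<Sum>n. \<integral>\<^sup>+x. ennreal (gauss_weight x * \<bar>d n x\<bar>) \<partial>half) \<le> (\<Sum>n. ennreal (L2_norm half gauss_weight * (1/2)^n))"
    by (intro suminf_le) auto
  also have "\<dots> = ennreal (\<Sum>n. L2_norm half gauss_weight * (1/2)^n)"
    by (intro suminf_ennreal2 mult_nonneg_nonneg L2_norm_nonneg) (auto intro: summable_mult)
  finally have "(\<integral>\<^sup>+x. (\<Sum>n. ennreal (gauss_weight x * \<bar>d n x\<bar>)) \<partial>half) < \<infinity>"
    by (subst nn_integral_suminf) (use L2_measurable[OF gauss_weight_L2] in \<open>auto intro: order_le_less_trans\<close>)
  then have "AE x in half. (\<Sum>n. ennreal (gauss_weight x * \<bar>d n x\<bar>)) \<noteq> \<infinity>"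
    using L2_measurable[OF gauss_weight_L2] by (intro nn_integral_PInf_AE) auto
  then have "AE x in half. convergent (\<lambda>n. l2_rep (X (r n)) x)"
  proof eventually_elim
    case (elim x)
    have "summable (\<lambda>n. gauss_weight x * \<bar>d n x\<bar>)"
      by (rule summable_suminf_not_top) (use elim gauss_weight_pos[of x] in \<open>auto simp: less_imp_le\<close>)
    then have "summable (\<lambda>n. \<bar>d n x\<bar>)" using gauss_weight_pos[of x] by (simp add: summable_cmult_iff)
    then have "summable (\<lambda>n. d n x)" by (rule summable_rabs_cancel)
    then have "convergent (\<lambda>n. \<Sum>i<n. d i x)" by (simp add: summable_iff_convergent)
    moreover have "(\<Sum>i<n. d i x) = l2_rep (X (r n)) x - l2_rep (X (r 0)) x" for n
      unfolding d_def by (rule sum_lessThan_telescope)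
    ultimately have "convergent (\<lambda>n. (l2_rep (X (r n)) x - l2_rep (X (r 0)) x) + l2_rep (X (r 0)) x)"
      by (intro convergent_add convergent_const) simp
    then show ?case by simp
  qed
  then show ?thesis using r(1) by blast
qed

text \<open>The almost everywhere limit f of a subsequence is the limit of the whole sequence:
  Fatou's lemma bounds the norm of f - X n by the Cauchy estimate, and adding X n back shows that f
  itself is square integrable.\<close>

instance l2 :: banach
proof
  fix X :: "nat \<Rightarrow> l2" assume C: "Cauchy X"
  then obtain r where r: "strict_mono r" "AE x in half. convergent (\<lambda>n. l2_rep (X (r n)) x)"
    using Cauchy_l2_AE_convergent_subseq by blast
  define f where "f x = lim (\<lambda>n. l2_rep (X (r n)) x)" for x
  have fm [measurable]: "f \<in> borel_measurable half"
    unfolding f_def[abs_def] by (rule borel_measurable_lim_metric) auto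
  have *: "\<exists>N. \<forall>n\<ge>N. (\<lambda>x. f x - l2_rep (X n) x) \<in> L2 half \<and> L2_norm half (\<lambda>x. f x - l2_rep (X n) x) \<le> e"
    if e: "0 < e" for e
  proof -
    obtain N where N: "\<And>m n. m \<ge> N \<Longrightarrow> n \<ge> N \<Longrightarrow> dist (X m) (X n) < e"
      using C e unfolding Cauchy_def by meson
    have "(\<lambda>x. f x - l2_rep (X n) x) \<in> L2 half \<and> L2_norm half (\<lambda>x. f x - l2_rep (X n) x) \<le> e" if n: "n \<ge> N" for n
    proof -
      have b: "(\<integral>\<^sup>+x. ennreal ((l2_rep (X (r m)) x - l2_rep (X n) x)\<^sup>2) \<partial>half) \<le> ennreal (e\<^sup>2)" if "m \<ge> N" for m
      proof -
        have L: "(\<lambda>x. l2_rep (X (r m)) x - l2_rep (X n) x) \<in> L2 half" by (intro L2_diff l2_rep_L2)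
        have "r m \<ge> N" using seq_suble[OF r(1), of m] that by simp
        then have "norm (X (r m) - X n) < e" using N n by (simp add: dist_norm)
        also have "norm (X (r m) - X n) = L2_norm half (\<lambda>x. l2_rep (X (r m)) x - l2_rep (X n) x)"
          using norm_abs_l2[OF L] abs_l2_diff[OF l2_rep_L2 l2_rep_L2, of "X (r m)" "X n"] by (simp add: abs_fn)
        finally have "(L2_norm half (\<lambda>x. l2_rep (X (r m)) x - l2_rep (X n) x))\<^sup>2 \<le> e\<^sup>2"
          by (intro power_mono L2_norm_nonneg) auto
        then have "(\<integral>x. (l2_rep (X (r m)) x - l2_rep (X n) x)\<^sup>2 \<partial>half) \<le> e\<^sup>2" by (simp add: L2_norm_def)
        then show ?thesis using L by (subst nn_integral_eq_integral) (auto simp: L2_def intro: ennreal_leI)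
      qed
      have "(\<integral>\<^sup>+x. ennreal ((f x - l2_rep (X n) x)\<^sup>2) \<partial>half)
          = (\<integral>\<^sup>+x. liminf (\<lambda>m. ennreal ((l2_rep (X (r m)) x - l2_rep (X n) x)\<^sup>2)) \<partial>half)"
      proof (rule nn_integral_cong_AE, use r(2) in eventually_elim)
        fix x assume "convergent (\<lambda>n. l2_rep (X (r n)) x)"
        then have "(\<lambda>m. l2_rep (X (r m)) x) \<longlonglongrightarrow> f x" by (simp add: f_def convergent_LIMSEQ_iff)
        then have "(\<lambda>m. ennreal ((l2_rep (X (r m)) x - l2_rep (X n) x)\<^sup>2)) \<longlonglongrightarrow> ennreal ((f x - l2_rep (X n) x)\<^sup>2)"
          by (intro tendsto_intros)
        then show "ennreal ((f x - l2_rep (X n) x)\<^sup>2) = liminf (\<lambda>m. ennreal ((l2_rep (X (r m)) x - l2_rep (X n) x)\<^sup>2))"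
          by (intro lim_imp_Liminf[symmetric]) simp_all
      qed
      also have "\<dots> \<le> liminf (\<lambda>m. \<integral>\<^sup>+x. ennreal ((l2_rep (X (r m)) x - l2_rep (X n) x)\<^sup>2) \<partial>half)"
        by (rule nn_integral_liminf) measurable
      also have "\<dots> \<le> liminf (\<lambda>m. ennreal (e\<^sup>2))"
        by (intro Liminf_mono) (use b in \<open>auto simp: eventually_sequentially\<close>)
      also have "\<dots> = ennreal (e\<^sup>2)" by (simp add: Liminf_const)
      finally have fin: "(\<integral>\<^sup>+x. ennreal ((f x - l2_rep (X n) x)\<^sup>2) \<partial>half) \<le> ennreal (e\<^sup>2)" .
      then have int: "integrable half (\<lambda>x. (f x - l2_rep (X n) x)\<^sup>2)"
        by (intro integrableI_bounded) (auto intro: order_le_less_trans)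
      then have "ennreal (\<integral>x. (f x - l2_rep (X n) x)\<^sup>2 \<partial>half) \<le> ennreal (e\<^sup>2)"
        using fin by (subst nn_integral_eq_integral[symmetric]) auto
      then have "(\<integral>x. (f x - l2_rep (X n) x)\<^sup>2 \<partial>half) \<le> e\<^sup>2" by simp
      then have "L2_norm half (\<lambda>x. f x - l2_rep (X n) x) \<le> e"
        unfolding L2_norm_def using e by (simp add: real_le_lsqrt)
      then show ?thesis using int by (auto simp: L2_def)
    qed
    then show ?thesis by blast
  qed
  have fL: "f \<in> L2 half"
  proof -
    obtain n where "(\<lambda>x. f x - l2_rep (X n) x) \<in> L2 half" using *[of 1] by auto
    from L2_add[OF this l2_rep_L2[of "X n"]] show ?thesis by simp
  qed
  have nrm: "norm (abs_l2 f - X n) = L2_norm half (\<lambda>x. f x - l2_rep (X n) x)" for n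
    using abs_l2_diff[OF fL l2_rep_L2, of "X n"] norm_abs_l2[OF L2_diff[OF fL l2_rep_L2], of "X n"] by (simp add: abs_fn)
  have "X \<longlonglongrightarrow> abs_l2 f"
  proof (rule LIMSEQ_I)
    fix e :: real assume "0 < e"
    then obtain N where "\<And>n. n \<ge> N \<Longrightarrow> L2_norm half (\<lambda>x. f x - l2_rep (X n) x) \<le> e / 2" using *[of "e/2"] by auto
    then show "\<exists>N. \<forall>n\<ge>N. norm (X n - abs_l2 f) < e"
      using nrm \<open>0 < e\<close> by (intro exI[of _ N]) (force simp: norm_minus_commute[of "X _"])
  qed
  then show "convergent X" by (auto simp: convergent_def)
qed

section \<open>Smooth functions and test functions\<close>

definition smooth :: "(real \<Rightarrow> real) \<Rightarrow> bool" where
  "smooth f \<longleftrightarrow> (\<forall>n x. (deriv ^^ n) f differentiable at x)"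

text \<open>It suffices to exhibit a class of functions closed under differentiation; no formula for
  the n-th derivative is required. Each use below only has to choose the class.\<close>

lemma smooth_coinduct:
  assumes "P f" and "\<And>f. P f \<Longrightarrow> \<exists>f'. (\<forall>x. (f has_real_derivative f' x) (at x)) \<and> P f'"
  shows "smooth f"
proof -
  have step: "(\<forall>x. f differentiable at x) \<and> P (deriv f)" if gauss_tail: "P f" for f
  proof -
    obtain f' where f': "\<And>x. (f has_real_derivative f' x) (at x)" "P f'" using assms(2)[OF gauss_tail] by blast
    then have "deriv f = f'" by (auto simp: fun_eq_iff intro: DERIV_imp_deriv)
    then show ?thesis using f' real_differentiable_def by metis
  qed
  have "P ((deriv ^^ n) f)" for n by (induction n) (use assms(1) step in auto)
  then show ?thesis using step by (simp add: smooth_def)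
qed

lemma smooth_differentiable: "smooth f \<Longrightarrow> f differentiable at x"
  unfolding smooth_def by (metis funpow_0)

lemma smooth_deriv: "smooth f \<Longrightarrow> smooth (deriv f)"
  unfolding smooth_def by (metis funpow_Suc_right o_apply)

lemma smooth_DERIV: "smooth f \<Longrightarrow> (f has_real_derivative deriv f x) (at x)"
  using smooth_differentiable[of f x] by (simp add: DERIV_deriv_iff_real_differentiable)

lemma smooth_continuous: "smooth f \<Longrightarrow> continuous_on A f"
  by (meson DERIV_isCont continuous_at_imp_continuous_on smooth_DERIV)

lemma smooth_measurable: "smooth f \<Longrightarrow> f \<in> borel_measurable borel"
  by (rule borel_measurable_continuous_onI[OF smooth_continuous])

lemma smooth_antideriv:
  assumes "\<And>x. (F has_real_derivative f x) (at x)" "smooth f"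
  shows "smooth F"
proof (rule smooth_coinduct[where P = "\<lambda>g. smooth g \<or> g = F"])
  fix g assume "smooth g \<or> g = F"
  then show "\<exists>f'. (\<forall>x. (g has_real_derivative f' x) (at x)) \<and> (smooth f' \<or> f' = F)"
    using assms smooth_DERIV smooth_deriv by blast
qed simp

text \<open>The coinduction for products runs over finite sums of products, because the derivative of a
  product is such a sum.\<close>

lemma smooth_sum_prod:
  assumes "\<And>i. i \<in> I \<Longrightarrow> smooth (f i)" "\<And>i. i \<in> I \<Longrightarrow> smooth (g i)" "finite I"
  shows "smooth (\<lambda>x. \<Sum>i\<in>I. f i x * g i x)"
proof (rule smooth_coinduct[where P = "\<lambda>h. \<exists>xs. (\<forall>(f, g)\<in>set xs. smooth f \<and> smooth g) \<and> h = (\<lambda>x. \<Sum>(f, g)\<leftarrow>xs. f x * g x)"])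
  obtain ys where ys: "set ys = I" "distinct ys" using finite_distinct_list[OF assms(3)] by blast
  have "(\<lambda>x. \<Sum>i\<in>I. f i x * g i x) = (\<lambda>x. \<Sum>(f, g)\<leftarrow>map (\<lambda>i. (f i, g i)) ys. f x * g x)"
    using ys by (auto simp: o_def sum_list_distinct_conv_sum_set)
  then show "\<exists>xs. (\<forall>(f, g)\<in>set xs. smooth f \<and> smooth g) \<and>
      (\<lambda>x. \<Sum>i\<in>I. f i x * g i x) = (\<lambda>x. \<Sum>(f, g)\<leftarrow>xs. f x * g x)"
    using assms ys(1) by (intro exI[of _ "map (\<lambda>i. (f i, g i)) ys"]) auto
next
  fix h :: "real \<Rightarrow> real"
  assume "\<exists>xs. (\<forall>(f, g)\<in>set xs. smooth f \<and> smooth g) \<and> h = (\<lambda>x. \<Sum>(f, g)\<leftarrow>xs. f x * g x)"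
  then obtain xs where xs: "\<forall>(f, g)\<in>set xs. smooth f \<and> smooth g" "h = (\<lambda>x. \<Sum>(f, g)\<leftarrow>xs. f x * g x)" by blast
  define ys where "ys = map (\<lambda>(f, g). (deriv f, g)) xs @ map (\<lambda>(f, g). (f, deriv g)) xs"
  have "((\<lambda>x. \<Sum>(f, g)\<leftarrow>xs. f x * g x) has_real_derivative
      (\<Sum>(f, g)\<leftarrow>map (\<lambda>(f, g). (deriv f, g)) xs. f x * g x) + (\<Sum>(f, g)\<leftarrow>map (\<lambda>(f, g). (f, deriv g)) xs. f x * g x)) (at x)" for x
    using xs(1)
  proof (induction xs)
    case (Cons a xs)
    obtain f g where a: "a = (f, g)" by force
    show ?case using Cons smooth_DERIV[of f x] smooth_DERIV[of g x]
      by (auto simp: a intro!: derivative_eq_intros)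
  qed simp
  moreover have "\<forall>(f, g)\<in>set ys. smooth f \<and> smooth g"
    using xs(1) by (auto simp: ys_def intro: smooth_deriv)
  ultimately show "\<exists>h'. (\<forall>x. (h has_real_derivative h' x) (at x)) \<and>
      (\<exists>xs. (\<forall>(f, g)\<in>set xs. smooth f \<and> smooth g) \<and> h' = (\<lambda>x. \<Sum>(f, g)\<leftarrow>xs. f x * g x))"
    unfolding xs(2)
    by (intro exI[of _ "\<lambda>x. \<Sum>(f, g)\<leftarrow>ys. f x * g x"] conjI allI exI[of _ ys]) (simp_all add: ys_def)
qed

lemma smooth_mult: "smooth f \<Longrightarrow> smooth g \<Longrightarrow> smooth (\<lambda>x. f x * g x)"
  using smooth_sum_prod[of "{()}" "\<lambda>_. f" "\<lambda>_. g"] by simp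

lemma smooth_const: "smooth (\<lambda>x. c)"
  by (rule smooth_coinduct[where P = "\<lambda>f. \<exists>c. f = (\<lambda>x. c)"]) (auto intro!: exI[of _ "\<lambda>_. 0"])

lemma smooth_id: "smooth (\<lambda>x. x)"
  by (rule smooth_antideriv[OF _ smooth_const[of 1]]) simp

lemma smooth_add: "smooth f \<Longrightarrow> smooth g \<Longrightarrow> smooth (\<lambda>x. f x + g x)"
  using smooth_sum_prod[of UNIV "\<lambda>b. if b then f else g" "\<lambda>_ _. 1"] smooth_const[of 1]
  by (simp add: UNIV_bool add.commute)

lemma smooth_cmult: "smooth f \<Longrightarrow> smooth (\<lambda>x. c * f x)"
  by (rule smooth_mult[OF smooth_const])

lemma smooth_diff: "smooth f \<Longrightarrow> smooth g \<Longrightarrow> smooth (\<lambda>x. f x - g x)"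
  using smooth_add[of f "\<lambda>x. -1 * g x"] smooth_cmult[of g "-1"] by simp

lemma smooth_affine:
  assumes "smooth f" shows "smooth (\<lambda>x. f (a * x + b))"
proof (rule smooth_coinduct[where P = "\<lambda>h. \<exists>c f. smooth f \<and> h = (\<lambda>x. c * f (a * x + b))"])
  show "\<exists>c fa. smooth fa \<and> (\<lambda>x. f (a * x + b)) = (\<lambda>x. c * fa (a * x + b))"
    using assms by (intro exI[of _ 1] exI[of _ f]) simp
next
  fix h assume "\<exists>c f. smooth f \<and> h = (\<lambda>x. c * f (a * x + b))"
  then obtain c f where f: "smooth f" "h = (\<lambda>x. c * f (a * x + b))" by blast
  have "(h has_real_derivative (c * a) * deriv f (a * x + b)) (at x)" for x
  proof -
    have "((\<lambda>x. f (a * x + b)) has_real_derivative deriv f (a * x + b) * a) (at x)"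
      by (rule DERIV_chain2[OF smooth_DERIV[OF f(1)]]) (auto intro!: derivative_eq_intros)
    then show ?thesis unfolding f(2) by (auto intro!: derivative_eq_intros)
  qed
  then show "\<exists>h'. (\<forall>x. (h has_real_derivative h' x) (at x)) \<and> (\<exists>c f. smooth f \<and> h' = (\<lambda>x. c * f (a * x + b)))"
    using smooth_deriv[OF f(1)] by (intro exI[of _ "\<lambda>x. (c * a) * deriv f (a * x + b)"]) blast
qed

lemma smooth_gaussian: "smooth (\<lambda>x. exp (c * x\<^sup>2))"
proof (rule smooth_coinduct[where P = "\<lambda>h. \<exists>p. h = (\<lambda>x. poly p x * exp (c * x\<^sup>2))"])
  show "\<exists>p. (\<lambda>x. exp (c * x\<^sup>2)) = (\<lambda>x. poly p x * exp (c * x\<^sup>2))" by (intro exI[of _ 1]) simp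
next
  fix h :: "real \<Rightarrow> real" assume "\<exists>p. h = (\<lambda>x. poly p x * exp (c * x\<^sup>2))"
  then obtain p where h: "h = (\<lambda>x. poly p x * exp (c * x\<^sup>2))" by blast
  have "(h has_real_derivative poly (pderiv p + [:0, 2 * c:] * p) x * exp (c * x\<^sup>2)) (at x)" for x
    unfolding h by (auto intro!: derivative_eq_intros simp: algebra_simps)
  then show "\<exists>f'. (\<forall>x. (h has_real_derivative f' x) (at x)) \<and> (\<exists>p. f' = (\<lambda>x. poly p x * exp (c * x\<^sup>2)))"
    by (intro exI[of _ "\<lambda>x. poly (pderiv p + [:0, 2 * c:] * p) x * exp (c * x\<^sup>2)"] conjI allI) blast+
qed

subsection \<open>Bump functions\<close>

definition flat :: "real \<Rightarrow> real" where "flat x = (if 0 < x then exp (- inverse x) else 0)"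

lemma poly_over_exp: "((\<lambda>x. poly p x / exp x) \<longlongrightarrow> 0) (at_top :: real filter)"
proof -
  have "((\<lambda>x. \<Sum>i\<le>degree p. coeff p i * (x ^ i / exp x)) \<longlongrightarrow> (\<Sum>i\<le>degree p. coeff p i * 0)) at_top"
    by (intro tendsto_intros tendsto_power_div_exp_0)
  then show ?thesis by (simp add: poly_altdef sum_divide_distrib)
qed

text \<open>The class consists of p(1/x) times \<open>flat\<close>. For x > 0 the derivative is of
  the same form with q(y) = y^2 (p(y) - p'(y)). At 0 the right difference quotient is y p(y)/exp y
  with y = 1/x, which tends to 0.\<close>

lemma smooth_flat: "smooth flat"
proof (rule smooth_coinduct[where P = "\<lambda>h. \<exists>p. h = (\<lambda>x. poly p (inverse x) * flat x)"])
  show "\<exists>p. flat = (\<lambda>x. poly p (inverse x) * flat x)" by (intro exI[of _ 1]) simp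
next
  fix h :: "real \<Rightarrow> real" assume "\<exists>p. h = (\<lambda>x. poly p (inverse x) * flat x)"
  then obtain p where h: "h = (\<lambda>x. poly p (inverse x) * flat x)" by blast
  define q where "q = [:0, 0, 1:] * (p - pderiv p)"
  have "(h has_real_derivative poly q (inverse x) * flat x) (at x)" for x
  proof (cases "x = 0")
    case False
    show ?thesis
    proof (cases "0 < x")
      case True
      have "((\<lambda>x. poly p (inverse x) * exp (- inverse x)) has_real_derivative poly q (inverse x) * flat x) (at x)"
        using True by (auto intro!: derivative_eq_intros simp: flat_def q_def power2_eq_square algebra_simps inverse_eq_divide)
      then show ?thesis
        by (rule has_field_derivative_transform_within_open[where S = "{0<..}"]) (use True in \<open>auto simp: h flat_def\<close>)
    next
      case False
      have "((\<lambda>x. 0) has_real_derivative poly q (inverse x) * flat x) (at x)"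
        using False by (simp add: flat_def)
      then show ?thesis
        by (rule has_field_derivative_transform_within_open[where S = "{..<0}"])
          (use False \<open>x \<noteq> 0\<close> in \<open>auto simp: h flat_def\<close>)
    qed
  next
    case True
    have "((\<lambda>x. h x / x) \<longlongrightarrow> 0) (at 0)"
    proof (rule filterlim_split_at)
      have "((\<lambda>x. poly ([:0, 1:] * p) x / exp x) \<longlongrightarrow> 0) at_top" by (rule poly_over_exp)
      then have "((\<lambda>x. poly ([:0, 1:] * p) (inverse x) / exp (inverse x)) \<longlongrightarrow> 0) (at_right 0)"
        by (rule filterlim_compose[OF _ filterlim_inverse_at_top_right])
      then show "((\<lambda>x. h x / x) \<longlongrightarrow> 0) (at_right 0)"
        by (rule Lim_transform_eventually)
          (auto simp: eventually_at_right_field h flat_def exp_minus field_simps intro!: exI[of _ 1])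
      show "((\<lambda>x. h x / x) \<longlongrightarrow> 0) (at_left 0)"
        by (rule tendsto_eventually) (auto simp: eventually_at_left_field h flat_def intro!: exI[of _ "-1"])
    qed
    moreover have "h 0 = 0" by (simp add: h flat_def)
    ultimately have "(h has_real_derivative 0) (at 0)" by (simp add: DERIV_def)
    then show ?thesis using True by (simp add: flat_def)
  qed
  then show "\<exists>f'. (\<forall>x. (h has_real_derivative f' x) (at x)) \<and> (\<exists>p. f' = (\<lambda>x. poly p (inverse x) * flat x))"
    by (intro exI[of _ "\<lambda>x. poly q (inverse x) * flat x"] conjI allI) blast+
qed

lemma flat_bounds: "0 \<le> flat x" "flat x \<le> 1"
  by (simp_all add: flat_def)

text \<open>\<open>flat (k x)\<close> tends to 1 for x > 0 as k grows, so these bumps approximate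
  the indicator of the open interval from a to b. The arguments are written as affine maps to suit
  \<open>smooth_affine\<close>.\<close>

definition bump :: "real \<Rightarrow> real \<Rightarrow> nat \<Rightarrow> real \<Rightarrow> real" where
  "bump a b n x = flat (real (Suc n) * x + - (real (Suc n) * a)) * flat (- real (Suc n) * x + real (Suc n) * b)"

lemma smooth_bump: "smooth (bump a b n)"
  unfolding bump_def by (intro smooth_mult smooth_affine smooth_flat)

lemma bump_eq: "bump a b n x = (if a < x \<and> x < b then exp (- inverse (real (Suc n)) * (inverse (x - a) + inverse (b - x))) else 0)"
proof -
  have p: "0 < real (Suc n)" by simp
  have 1: "real (Suc n) * x + - (real (Suc n) * a) = real (Suc n) * (x - a)"
    "- real (Suc n) * x + real (Suc n) * b = real (Suc n) * (b - x)" by (simp_all add: algebra_simps)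
  show ?thesis unfolding bump_def 1 flat_def using p
    by (auto simp: zero_less_mult_iff exp_add[symmetric] distrib_left simp del: of_nat_Suc)
qed

lemma bump_bounds: "0 \<le> bump a b n x" "bump a b n x \<le> 1"
  using flat_bounds by (simp_all add: bump_def mult_le_one)

lemma bump_lim: "(\<lambda>n. bump a b n x) \<longlonglongrightarrow> indicator {a<..<b} x"
proof (cases "a < x \<and> x < b")
  case True
  have "(\<lambda>n. exp (- inverse (real (Suc n)) * (inverse (x - a) + inverse (b - x)))) \<longlonglongrightarrow> exp (- 0 * (inverse (x - a) + inverse (b - x)))"
    by (intro tendsto_intros LIMSEQ_inverse_real_of_nat)
  then show ?thesis using True by (simp add: bump_eq)
next
  case False
  then have "bump a b n x = 0" for n by (simp add: bump_eq)
  then show ?thesis using False by simp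
qed

subsection \<open>Test functions on the half-line\<close>

abbreviation \<D> :: "(real \<Rightarrow> real) set" where "\<D> \<equiv> test_functions {..<0}"

lemma test_iff: "\<phi> \<in> \<D> \<longleftrightarrow> smooth \<phi> \<and> (\<exists>a b. a < b \<and> b < 0 \<and> (\<forall>x. x \<notin> {a..b} \<longrightarrow> \<phi> x = 0))"
proof
  assume "\<phi> \<in> \<D>"
  then obtain K where K: "smooth \<phi>" "compact K" "K \<subseteq> {..<0}" "\<And>x. x \<notin> K \<Longrightarrow> \<phi> x = 0"
    by (auto simp: test_functions_def smooth_def)
  show "smooth \<phi> \<and> (\<exists>a b. a < b \<and> b < 0 \<and> (\<forall>x. x \<notin> {a..b} \<longrightarrow> \<phi> x = 0))"
  proof (cases "K = {}")
    case True
    then show ?thesis using K by (intro conjI exI[of _ "-2"] exI[of _ "-1"]) auto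
  next
    case False
    then obtain s t where "s \<in> K" "t \<in> K" "\<And>x. x \<in> K \<Longrightarrow> x \<le> s" "\<And>x. x \<in> K \<Longrightarrow> t \<le> x"
      using compact_attains_sup[OF K(2)] compact_attains_inf[OF K(2)] by blast
    note st = this
    have "t \<le> s" "s < 0" using st K(3) by auto
    moreover have "\<phi> x = 0" if "x \<notin> {t - 1..s}" for x
      using that st(3,4)[of x] by (intro K(4)) auto
    \<comment> \<open>Moving the left end by 1 keeps the interval nondegenerate when K is a single
      point.\<close>
    ultimately show ?thesis using K(1)
      by (intro conjI exI[of _ "t - 1"] exI[of _ s] allI impI) auto
  qed
next
  assume "smooth \<phi> \<and> (\<exists>a b. a < b \<and> b < 0 \<and> (\<forall>x. x \<notin> {a..b} \<longrightarrow> \<phi> x = 0))"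
  then obtain a b where "smooth \<phi>" "b < 0" "\<forall>x. x \<notin> {a..b} \<longrightarrow> \<phi> x = 0" by blast
  then show "\<phi> \<in> \<D>"
    by (auto simp: test_functions_def smooth_def intro!: exI[of _ "{a..b}"])
qed

lemma testE:
  assumes "\<phi> \<in> \<D>"
  obtains a b where "smooth \<phi>" "a < b" "b < 0" "\<And>x. x \<notin> {a..b} \<Longrightarrow> \<phi> x = 0"
  using assms unfolding test_iff by blast

lemma test_mult: "\<phi> \<in> \<D> \<Longrightarrow> smooth g \<Longrightarrow> (\<lambda>x. g x * \<phi> x) \<in> \<D>"
  unfolding test_iff using smooth_mult[of g \<phi>] by (metis mult_zero_right)

lemma test_deriv: assumes "\<phi> \<in> \<D>" shows "deriv \<phi> \<in> \<D>"
proof (rule testE[OF assms])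
  fix a b assume ab: "smooth \<phi>" "a < b" "b < 0" "\<And>x. x \<notin> {a..b} \<Longrightarrow> \<phi> x = 0"
  have "deriv \<phi> x = 0" if "x \<notin> {a..b}" for x
  proof (rule DERIV_imp_deriv)
    have "((\<lambda>x. 0) has_real_derivative 0) (at x)" by simp
    then show "(\<phi> has_real_derivative 0) (at x)"
      by (rule has_field_derivative_transform_within_open[where S = "- {a..b}"])
        (use that ab(4) in \<open>auto simp: open_Compl\<close>)
  qed
  then show ?thesis unfolding test_iff using smooth_deriv ab by blast
qed

lemma test_diff: assumes "\<phi> \<in> \<D>" "\<psi> \<in> \<D>" shows "(\<lambda>x. \<phi> x - \<psi> x) \<in> \<D>"
proof (rule testE[OF assms(1)], rule testE[OF assms(2)])
  fix a b c d assume "smooth \<phi>" "a < b" "b < 0" "\<And>x. x \<notin> {a..b} \<Longrightarrow> \<phi> x = 0"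
    "smooth \<psi>" "c < d" "d < 0" "\<And>x. x \<notin> {c..d} \<Longrightarrow> \<psi> x = 0"
  note h = this
  have z: "\<phi> x - \<psi> x = 0" if "x \<notin> {min a c..max b d}" for x
  proof -
    have "x \<notin> {a..b}" "x \<notin> {c..d}" using that by auto
    then show ?thesis using h(4) h(8) by simp
  qed
  have "min a c < max b d" "max b d < 0" using h by auto
  then show ?thesis unfolding test_iff using smooth_diff[OF h(1,5)] z by blast
qed

lemma test_cmult: "\<phi> \<in> \<D> \<Longrightarrow> (\<lambda>x. c * \<phi> x) \<in> \<D>"
  by (rule test_mult[OF _ smooth_const])

lemma test_bump: assumes "a < b" "b < 0" shows "bump a b n \<in> \<D>"
  unfolding test_iff using assms by (intro conjI smooth_bump exI[of _ a] exI[of _ b]) (auto simp: bump_eq)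

lemma test_integrable: assumes "\<phi> \<in> \<D>" shows "integrable lborel \<phi>" "integrable half \<phi>"
proof -
  obtain a b where ab: "smooth \<phi>" "\<And>x. x \<notin> {a..b} \<Longrightarrow> \<phi> x = 0" using testE[OF assms] by metis
  have "set_integrable lborel {a..b} \<phi>"
    unfolding set_integrable_def by (intro borel_integrable_compact smooth_continuous ab) simp
  moreover have "(\<lambda>x. indicator {a..b} x *\<^sub>R \<phi> x) = \<phi>" using ab(2) by (auto simp: indicator_def fun_eq_iff)
  ultimately show "integrable lborel \<phi>" by (simp add: set_integrable_def)
  then show "integrable half \<phi>" by (rule integrable_half)
qed

lemma test_L2: assumes "\<phi> \<in> \<D>" shows "\<phi> \<in> L2 half"
proof -
  have s: "smooth \<phi>" using assms by (simp add: test_iff)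
  have "integrable half (\<lambda>x. \<phi> x * \<phi> x)"
    by (intro test_integrable test_mult assms s)
  then show ?thesis using s
    by (auto simp: L2_def power2_eq_square intro!: borel_measurable_half smooth_measurable)
qed

lemma integral_half_eq:
  fixes f :: "real \<Rightarrow> real"
  assumes "f \<in> borel_measurable borel"
  shows "integral\<^sup>L half f = (\<integral>x. indicator {..<0} x * f x \<partial>lborel)"
  using assms by (simp add: integral_restrict_space integral_completion)

lemma test_integral_eq:
  assumes "\<phi> \<in> \<D>" shows "integral\<^sup>L half \<phi> = integral\<^sup>L lborel \<phi>"
proof -
  obtain a b where ab: "smooth \<phi>" "b < 0" "\<And>x. x \<notin> {a..b} \<Longrightarrow> \<phi> x = 0" using testE[OF assms] by metis
  have "(\<lambda>x. indicator {..<0} x * \<phi> x) = \<phi>"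
  proof
    fix x show "indicator {..<0} x * \<phi> x = \<phi> x"
      using ab(2) ab(3)[of x] by (auto simp: indicator_def)
  qed
  then show ?thesis using integral_half_eq[OF smooth_measurable[OF ab(1)]] by simp
qed

text \<open>The antiderivative that vanishes left of the support is constant right of it, and the
  constant is the integral of \<xi>. Zero mean is therefore what makes it compactly
  supported.\<close>

lemma test_antideriv:
  assumes "\<xi> \<in> \<D>" "integral\<^sup>L half \<xi> = 0"
  shows "\<exists>\<phi>\<in>\<D>. deriv \<phi> = \<xi>"
proof -
  obtain a b where ab: "smooth \<xi>" "a < b" "b < 0" "\<And>x. x \<notin> {a..b} \<Longrightarrow> \<xi> x = 0" using testE[OF assms(1)] by metis
  obtain F where F: "\<And>x. (F has_real_derivative \<xi> x) (at x)"
  proof -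
    have "isCont \<xi> x" for x using smooth_DERIV[OF ab(1)] by (rule DERIV_isCont)
    then show ?thesis
      using einterval_antiderivative[of "-\<infinity>" "\<infinity>" \<xi>] that
      by (auto simp: has_real_derivative_iff_has_vector_derivative)
  qed
  define \<phi> where "\<phi> x = F x - F a" for x
  have d: "(\<phi> has_real_derivative \<xi> x) (at x)" for x
    unfolding \<phi>_def using F[of x] by (auto intro!: derivative_eq_intros)
  have const: "\<phi> x = \<phi> y" if "x \<le> y" "\<And>z. x < z \<Longrightarrow> z < y \<Longrightarrow> \<xi> z = 0" for x y
  proof (cases "x = y")
    case False
    then have "x < y" using that(1) by simp
    from MVT2[OF this d] obtain z where "x < z" "z < y" "\<phi> y - \<phi> x = (y - x) * \<xi> z"
      by blast
    then show ?thesis using that(2) by simp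
  qed simp
  have "\<phi> b - \<phi> a = integral\<^sup>L lborel \<xi>"
  proof -
    have "has_bochner_integral lborel (\<lambda>x. \<xi> x * indicator {a..b} x) (\<phi> b - \<phi> a)"
      by (rule has_bochner_integral_FTC_Icc_real) (use ab d DERIV_isCont[OF smooth_DERIV[OF ab(1)]] in auto)
    moreover have "\<xi> x * indicator {a..b} x = \<xi> x" for x using ab(4)[of x] by (auto simp: indicator_def)
    ultimately show ?thesis by (simp add: has_bochner_integral_iff)
  qed
  then have b0: "\<phi> b = 0" using assms test_integral_eq[OF assms(1)] by (simp add: \<phi>_def)
  have "\<phi> x = 0" if "x \<notin> {a..b}" for x
  proof (cases "x < a")
    case True
    then have "\<phi> x = \<phi> a" by (intro const ab(4)) auto
    then show ?thesis by (simp add: \<phi>_def)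
  next
    case False
    then have "b < x" using that by simp
    then have "\<phi> b = \<phi> x" by (intro const ab(4)) auto
    then show ?thesis using b0 by simp
  qed
  moreover have "smooth \<phi>" by (rule smooth_antideriv[OF d ab(1)])
  ultimately have "\<phi> \<in> \<D>" unfolding test_iff using ab by blast
  moreover have "deriv \<phi> = \<xi>" using d by (auto intro: DERIV_imp_deriv)
  ultimately show ?thesis by blast
qed

lemma test_integral_deriv:
  assumes "\<phi> \<in> \<D>" shows "integral\<^sup>L half (deriv \<phi>) = 0"
proof -
  obtain a b where ab: "smooth \<phi>" "a < b" "b < 0" "\<And>x. x \<notin> {a..b} \<Longrightarrow> \<phi> x = 0" using testE[OF assms] by metis
  \<comment> \<open>Widening puts the endpoints outside the support, where \<phi> vanishes. The
    integral is over the whole line, so \<open>b + 1\<close> may be positive.\<close>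
  let ?a = "a - 1" let ?b = "b + 1"
  have "has_bochner_integral lborel (\<lambda>x. deriv \<phi> x * indicator {?a..?b} x) (\<phi> ?b - \<phi> ?a)"
    by (rule has_bochner_integral_FTC_Icc_real)
      (use ab smooth_DERIV[OF ab(1)] smooth_continuous[OF smooth_deriv[OF ab(1)], of UNIV] in
        \<open>auto simp: continuous_on_eq_continuous_at\<close>)
  moreover have "deriv \<phi> x * indicator {?a..?b} x = deriv \<phi> x" for x
  proof (cases "x \<in> {?a..?b}")
    case False
    then have "x \<notin> {a..b}" by auto
    have "deriv \<phi> x = 0"
    proof (rule DERIV_imp_deriv)
      have "((\<lambda>x. 0) has_real_derivative 0) (at x)" by simp
      then show "(\<phi> has_real_derivative 0) (at x)"
        by (rule has_field_derivative_transform_within_open[where S = "- {a..b}"])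
          (use \<open>x \<notin> {a..b}\<close> ab(4) in \<open>auto simp: open_Compl\<close>)
    qed
    then show ?thesis by simp
  qed simp
  ultimately have "integral\<^sup>L lborel (deriv \<phi>) = 0"
    using ab(4)[of ?a] ab(4)[of ?b] by (simp add: has_bochner_integral_iff)
  then show ?thesis using test_integral_eq[OF test_deriv[OF assms]] by simp
qed

text \<open>Subtracting a multiple of this function gives any test function zero mean, which is how
  the constants of integration arise in the du Bois-Reymond argument.\<close>

lemma test_normalized: "\<exists>\<xi>\<in>\<D>. integral\<^sup>L half \<xi> = 1"
proof -
  let ?b = "bump (-2) (-1) 0"
  have t: "?b \<in> \<D>" by (rule test_bump) auto
  have "integral\<^sup>L half ?b \<noteq> 0"
  proof
    assume "integral\<^sup>L half ?b = 0"
    then have "AE x in half. ?b x = 0"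
      using test_integrable(2)[OF t] bump_bounds by (subst (asm) integral_nonneg_eq_0_iff_AE) auto
    then have "AE x in half. x \<notin> {-2<..<-1}" by (auto simp: bump_eq split: if_splits elim!: eventually_mono)
    then have "AE x in lebesgue. x \<in> {..<0} \<longrightarrow> x \<notin> {-2<..<-1::real}"
      by (subst (asm) AE_restrict_space_iff) auto
    then have "AE x in lebesgue. x \<notin> {-2<..<-1::real}" by eventually_elim auto
    then have "{-2<..<-1::real} \<in> null_sets lebesgue"
      by (subst AE_iff_null_sets) auto
    then have "emeasure lebesgue {-2<..<-1::real} = 0" by (rule null_setsD1)
    then show False by simp
  qed
  then show ?thesis using test_cmult[OF t, of "1 / integral\<^sup>L half ?b"]
    by (intro bexI[of _ "\<lambda>x. (1 / integral\<^sup>L half ?b) * ?b x"]) auto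
qed

section \<open>The fundamental lemma and distributional solutions of \<open>H d = 0\<close>\<close>

lemma gauss_weight_test: "\<psi> \<in> \<D> \<Longrightarrow> (\<lambda>x. gauss_weight x * \<psi> x) \<in> \<D>"
  unfolding gauss_weight_def by (intro test_mult smooth_gaussian)

text \<open>The open lower rays are stable under intersection and generate the Borel sets, so k
  integrates to 0 over every Borel set. The claim follows by integrating over the set where k > 0;
  applied to k and - k it gives k = 0.\<close>

lemma nonpos_of_lessThan_integrals:
  fixes k :: "real \<Rightarrow> real"
  assumes k: "integrable lebesgue k" and total: "integral\<^sup>L lebesgue k = 0"
    and i: "\<And>b. (LINT x:{..<b}|lebesgue. k x) = 0"
  shows "AE x in lebesgue. k x \<le> 0"
proof -
  have km [measurable]: "k \<in> borel_measurable lebesgue" using k by auto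
  have si: "set_integrable lebesgue A k" if "A \<in> sets lebesgue" for A
    unfolding set_integrable_def by (rule integrable_mult_indicator[OF that k])
  have borel: "(LINT x:A|lebesgue. k x) = 0" if "A \<in> sets borel" for A
  proof -
    have sb: "sets borel = sigma_sets UNIV (range (lessThan :: real \<Rightarrow> _))"
      by (subst borel_Iio) (simp add: sets_measure_of)
    have leb: "B \<in> sets lebesgue" if "B \<in> sigma_sets UNIV (range (lessThan :: real \<Rightarrow> _))" for B
      using that sb by auto
    have "Int_stable (range (lessThan :: real \<Rightarrow> _))"
    proof -
      have "{..<a} \<inter> {..<b} = {..<min a b}" for a b :: real by auto
      then show ?thesis by (auto simp: Int_stable_def)
    qed
    moreover have "range lessThan \<subseteq> Pow (UNIV :: real set)" by simp
    moreover have "A \<in> sigma_sets UNIV (range (lessThan :: real \<Rightarrow> _))" using that sb by simp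
    ultimately show ?thesis
    proof (induction rule: sigma_sets_induct_disjoint)
      case (basic A) then show ?case using i by auto
    next
      case empty show ?case by (simp add: set_lebesgue_integral_def)
    next
      case (compl A)
      have "(LINT x:(UNIV - A) \<union> A|lebesgue. k x) = (LINT x:UNIV - A|lebesgue. k x) + (LINT x:A|lebesgue. k x)"
        using leb[OF compl(1)] by (intro set_integral_Un si) auto
      moreover have "(LINT x:(UNIV - A) \<union> A|lebesgue. k x) = integral\<^sup>L lebesgue k"
        by (simp add: set_lebesgue_integral_def)
      ultimately show ?case using compl(2) total by simp
    next
      case (union A)
      have m: "A n \<in> sets lebesgue" for n using union(2) leb by blast
      have "(LINT x:(\<Union>n. A n)|lebesgue. k x) = (\<Sum>n. LINT x:A n|lebesgue. k x)"
      proof (rule lebesgue_integral_countable_add)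
        show "A m \<inter> A n = {}" if "m \<noteq> n" for m n
          using union(1) that by (auto simp: disjoint_family_on_def)
      qed (use m in \<open>auto intro!: si\<close>)
      then show ?case using union(3) by simp
    qed
  qed
  define S where "S = {x. 0 < k x}"
  have S: "S \<in> sets lebesgue"
    unfolding S_def using borel_measurable_less[OF borel_measurable_const km, of 0] by simp
  \<comment> \<open>The set is only Lebesgue measurable. It is replaced by a Borel set that differs
    from it by a null set.\<close>
  then obtain B N N' where B: "S = B \<union> N" "N \<subseteq> N'" "N' \<in> null_sets lborel" "B \<in> sets lborel"
    by (rule sets_completionE)
  have "AE x in lebesgue. x \<notin> N'"
    using B(3) by (intro AE_not_in null_sets_completionI)
  then have ae: "AE x in lebesgue. indicator S x * k x = indicator B x * k x"
    by eventually_elim (use B(1,2) in \<open>auto simp: indicator_def\<close>)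
  have sm: "(\<lambda>x. indicator A x * k x) \<in> borel_measurable lebesgue" if "A \<in> sets lebesgue" for A
    using si[OF that] unfolding set_integrable_def by auto
  have "(\<integral>x. indicator S x * k x \<partial>lebesgue) = (\<integral>x. indicator B x * k x \<partial>lebesgue)"
    by (rule integral_cong_AE[OF sm[OF S] sm ae]) (use B(4) in auto)
  also have "\<dots> = 0" using borel[of B] B(4) by (simp add: set_lebesgue_integral_def)
  finally have "AE x in lebesgue. indicator S x * k x = 0"
    using si[OF S] by (subst (asm) integral_nonneg_eq_0_iff_AE) (auto simp: set_integrable_def S_def indicator_def)
  then show ?thesis by eventually_elim (auto simp: S_def indicator_def split: if_splits)
qed

lemma half_indicator_integrable:
  fixes h :: "real \<Rightarrow> real"
  assumes h: "integrable half h" and A: "A \<in> sets lebesgue"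
  shows "integrable half (\<lambda>x. indicator A x * h x)"
proof -
  have "{..<0} \<inter> A \<in> sets half"
    using A by (auto simp: sets_restrict_space_iff)
  then have "integrable half (\<lambda>x. indicator ({..<0} \<inter> A) x *\<^sub>R h x)"
    by (rule integrable_mult_indicator[OF _ h])
  then show ?thesis
    by (rule Bochner_Integration.integrable_cong[THEN iffD1, rotated -1]) (auto simp: indicator_def)
qed

text \<open>Dominated convergence passes from bounded intervals to rays ending below 0, and then to
  the whole half-line. Extension by zero reduces the rest to integrals over rays in the real
  line.\<close>

lemma null_of_set_integrals:
  fixes h :: "real \<Rightarrow> real"
  assumes h: "integrable half h"
    and i: "\<And>a b. a < b \<Longrightarrow> b < 0 \<Longrightarrow> (\<integral>x. h x * indicator {a<..<b} x \<partial>half) = 0"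
  shows "AE x in half. h x = 0"
proof -
  have hm [measurable]: "h \<in> borel_measurable half" using h by auto
  have int: "integrable half (\<lambda>x. h x * indicator A x)" if "A \<in> sets lebesgue" for A
    using half_indicator_integrable[OF h that] by (simp add: mult.commute)
  have tail: "(\<integral>x. h x * indicator {..<b} x \<partial>half) = 0" if "b < 0" for b
  proof -
    have "(\<lambda>n. \<integral>x. h x * indicator {b - real (Suc n)<..<b} x \<partial>half) \<longlonglongrightarrow> (\<integral>x. h x * indicator {..<b} x \<partial>half)"
    proof (rule integral_dominated_convergence[where w = "\<lambda>x. \<bar>h x\<bar>"])
      show "AE x in half. (\<lambda>n. h x * indicator {b - real (Suc n)<..<b} x) \<longlonglongrightarrow> h x * indicator {..<b} x"
      proof (rule AE_I2)
        fix x
        obtain N where "b - x < real N" using reals_Archimedean2 by blast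
        then have "\<forall>n\<ge>N. h x * indicator {b - real (Suc n)<..<b} x = h x * indicator {..<b} x"
          by (auto simp: indicator_def)
        then show "(\<lambda>n. h x * indicator {b - real (Suc n)<..<b} x) \<longlonglongrightarrow> h x * indicator {..<b} x"
          by (intro tendsto_eventually) (auto simp: eventually_sequentially)
      qed
    qed (use h int in \<open>auto simp: indicator_def dest: borel_measurable_integrable\<close>)
    moreover have "(\<integral>x. h x * indicator {b - real (Suc n)<..<b} x \<partial>half) = 0" for n
      by (rule i) (use that in auto)
    ultimately show ?thesis by (simp add: LIMSEQ_const_iff)
  qed
  have "(\<integral>x. h x * indicator {..<0} x \<partial>half) = 0"
  proof -
    have "(\<lambda>n. \<integral>x. h x * indicator {..<- inverse (real (Suc n))} x \<partial>half) \<longlonglongrightarrow> (\<integral>x. h x * indicator {..<0} x \<partial>half)"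
    proof (rule integral_dominated_convergence[where w = "\<lambda>x. \<bar>h x\<bar>"])
      show "AE x in half. (\<lambda>n. h x * indicator {..<- inverse (real (Suc n))} x) \<longlonglongrightarrow> h x * indicator {..<0} x"
      proof (rule AE_I2)
        fix x assume "x \<in> space half"
        then have x: "x < 0" by simp
        obtain N where N: "inverse (real (Suc N)) < - x" using reals_Archimedean[of "- x"] x by auto
        have "x < - inverse (real (Suc n))" if "n \<ge> N" for n
        proof -
          have "inverse (real (Suc n)) \<le> inverse (real (Suc N))"
            using that by (intro le_imp_inverse_le) auto
          then show ?thesis using N by linarith
        qed
        then have "\<forall>n\<ge>N. h x * indicator {..<- inverse (real (Suc n))} x = h x * indicator {..<0} x"
          using x by (auto simp: indicator_def simp del: of_nat_Suc)
        then show "(\<lambda>n. h x * indicator {..<- inverse (real (Suc n))} x) \<longlonglongrightarrow> h x * indicator {..<0} x"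
          by (intro tendsto_eventually) (auto simp: eventually_sequentially simp del: of_nat_Suc)
      qed
    qed (use h int in \<open>auto simp: indicator_def dest: borel_measurable_integrable\<close>)
    moreover have "(\<integral>x. h x * indicator {..<- inverse (real (Suc n))} x \<partial>half) = 0" for n
      by (rule tail) (simp del: of_nat_Suc)
    ultimately show ?thesis by (simp add: LIMSEQ_const_iff)
  qed
  moreover have trunc: "(\<integral>x. h x * indicator {..<b} x \<partial>half) = (\<integral>x. h x * indicator {..<0} x \<partial>half)" if "0 \<le> b" for b
  proof (rule Bochner_Integration.integral_cong)
    fix x assume "x \<in> space half"
    then have "x \<in> {..<b}" "x \<in> {..<0}" using that by auto
    then show "h x * indicator {..<b} x = h x * indicator {..<0} x" by simp
  qed simp
  ultimately have all: "(\<integral>x. h x * indicator {..<b} x \<partial>half) = 0" for b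
    using tail[of b] not_less[of b 0] by metis
  define k where "k x = indicator {..<0} x * h x" for x
  have k: "integrable lebesgue k"
    using h unfolding k_def[abs_def] by (subst (asm) integrable_restrict_space) auto
  have eq: "(LINT x:{..<b}|lebesgue. k x) = 0" for b
  proof -
    have "(LINT x:{..<b}|lebesgue. k x) = (\<integral>x. h x * indicator {..<b} x \<partial>half)"
      unfolding set_lebesgue_integral_def k_def
      by (subst integral_restrict_space) (auto simp: mult_ac)
    then show ?thesis using all by simp
  qed
  have total: "integral\<^sup>L lebesgue k = 0"
  proof -
    have "integral\<^sup>L lebesgue k = (LINT x:{..<0}|lebesgue. k x)"
      unfolding set_lebesgue_integral_def k_def
      by (rule Bochner_Integration.integral_cong) (auto simp: indicator_def)
    then show ?thesis using eq by simp
  qed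
  have "AE x in lebesgue. k x \<le> 0" by (rule nonpos_of_lessThan_integrals[OF k total eq])
  moreover have "AE x in lebesgue. - k x \<le> 0"
    using k total eq by (intro nonpos_of_lessThan_integrals) (auto simp: set_lebesgue_integral_def)
  ultimately have "AE x in lebesgue. k x = 0" by eventually_elim simp
  then show ?thesis
    by (subst AE_restrict_space_iff) (auto simp: k_def elim!: eventually_mono)
qed

text \<open>The Gaussian weight only makes the integrand integrable; the test functions absorb it.\<close>

lemma fundamental_lemma:
  assumes g: "integrable half (\<lambda>x. gauss_weight x * g x)" and gm: "g \<in> borel_measurable half"
    and i: "\<And>\<psi>. \<psi> \<in> \<D> \<Longrightarrow> (\<integral>x. g x * \<psi> x \<partial>half) = 0"
  shows "AE x in half. g x = 0"
proof -
  have [measurable]: "gauss_weight \<in> borel_measurable half" by (rule L2_measurable[OF gauss_weight_L2])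
  note [measurable] = gm
  have bm [measurable]: "bump a b n \<in> borel_measurable half" for a b n
    by (intro borel_measurable_half smooth_measurable smooth_bump)
  have "AE x in half. gauss_weight x * g x = 0"
  proof (rule null_of_set_integrals[OF g])
    fix a b :: real assume ab: "a < b" "b < 0"
    have "(\<lambda>n. \<integral>x. gauss_weight x * g x * bump a b n x \<partial>half) \<longlonglongrightarrow> (\<integral>x. gauss_weight x * g x * indicator {a<..<b} x \<partial>half)"
    proof (rule integral_dominated_convergence[where w = "\<lambda>x. \<bar>gauss_weight x * g x\<bar>"])
      show "AE x in half. (\<lambda>n. gauss_weight x * g x * bump a b n x) \<longlonglongrightarrow> gauss_weight x * g x * indicator {a<..<b} x"
        by (intro AE_I2 tendsto_intros bump_lim)
      show "AE x in half. norm (gauss_weight x * g x * bump a b n x) \<le> \<bar>gauss_weight x * g x\<bar>" for n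
        using bump_bounds by (intro AE_I2) (simp add: abs_mult mult_left_le)
    qed (use g in \<open>auto simp: lessThan_def[symmetric]\<close>)
    moreover have "(\<integral>x. gauss_weight x * g x * bump a b n x \<partial>half) = 0" for n
      using i[OF gauss_weight_test[OF test_bump[OF ab]], of n] by (simp add: mult_ac)
    ultimately show "(\<integral>x. gauss_weight x * g x * indicator {a<..<b} x \<partial>half) = 0" by (simp add: LIMSEQ_const_iff)
  qed
  then show ?thesis using gauss_weight_pos by (auto simp: less_imp_neq[symmetric])
qed

subsection \<open>The formal adjoint of \<open>H\<close>\<close>

text \<open>The transpose - (z \<phi>)'' + 3 \<phi>' - z^2 \<phi>'/4, multiplied out. Only
  derivatives of \<phi> remain, which reflects that H is a total derivative and makes the first
  integration possible.\<close>

definition H_adj :: "(real \<Rightarrow> real) \<Rightarrow> real \<Rightarrow> real" where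
  "H_adj \<phi> z = - z * deriv (deriv \<phi>) z + deriv \<phi> z - z\<^sup>2 / 4 * deriv \<phi> z"

lemma smooth_power2: "smooth (\<lambda>z. z\<^sup>2)"
  using smooth_mult[OF smooth_id smooth_id] by (simp add: power2_eq_square)

lemma test_add: "\<phi> \<in> \<D> \<Longrightarrow> \<psi> \<in> \<D> \<Longrightarrow> (\<lambda>x. \<phi> x + \<psi> x) \<in> \<D>"
  using test_diff[of \<phi> "\<lambda>x. -1 * \<psi> x"] test_cmult[of \<psi> "-1"] by simp

lemma H_adj_test: assumes "\<phi> \<in> \<D>" shows "H_adj \<phi> \<in> \<D>"
proof -
  note d = test_deriv[OF assms]
  have "(\<lambda>z. (-1 * z) * deriv (deriv \<phi>) z + (1 * deriv \<phi> z - (1/4 * z\<^sup>2) * deriv \<phi> z)) \<in> \<D>"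
    by (intro test_add test_diff test_mult test_deriv d smooth_cmult smooth_id smooth_power2 smooth_const)
  then show ?thesis by (simp add: H_adj_def[abs_def] algebra_simps)
qed

lemma is_H_iff:
  assumes w: "w \<in> L2 half"
  shows "is_H w f \<longleftrightarrow> (\<forall>\<phi>\<in>\<D>. (\<integral>z. w z * H_adj \<phi> z \<partial>half) = (\<integral>z. f z * \<phi> z \<partial>half))"
proof -
  have "distr_deriv {..<0} 2 w (\<lambda>z. - z * \<phi> z) + distr_deriv {..<0} 1 w (\<lambda>z. - 3 * \<phi> z)
     + 1/4 * distr_deriv {..<0} 1 (\<lambda>z. z\<^sup>2 * w z) \<phi> = (\<integral>z. w z * H_adj \<phi> z \<partial>half)" if "\<phi> \<in> \<D>" for \<phi>
  proof -
    have s: "smooth \<phi>" "smooth (deriv \<phi>)" using that smooth_deriv by (auto simp: test_iff)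
    note d = test_deriv[OF that]
    have "deriv (\<lambda>z. - z * \<phi> z) = (\<lambda>z. - \<phi> z - z * deriv \<phi> z)"
      by (rule ext, rule DERIV_imp_deriv) (auto intro!: derivative_eq_intros smooth_DERIV s)
    moreover have "deriv (\<lambda>z. - \<phi> z - z * deriv \<phi> z) = (\<lambda>z. - 2 * deriv \<phi> z - z * deriv (deriv \<phi>) z)"
      by (rule ext, rule DERIV_imp_deriv) (auto intro!: derivative_eq_intros smooth_DERIV s)
    ultimately have 1: "(deriv ^^ 2) (\<lambda>z. - z * \<phi> z) = (\<lambda>z. - 2 * deriv \<phi> z - z * deriv (deriv \<phi>) z)"
      by (simp add: numeral_2_eq_2)
    have 2: "deriv (\<lambda>z. - 3 * \<phi> z) = (\<lambda>z. - 3 * deriv \<phi> z)"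
      by (rule ext, rule DERIV_imp_deriv) (auto intro!: derivative_eq_intros smooth_DERIV s)
    have t1: "(\<lambda>z. (-2) * deriv \<phi> z - z * deriv (deriv \<phi>) z) \<in> \<D>"
      by (intro test_diff test_mult test_deriv d smooth_const smooth_id)
    have t2: "(\<lambda>z. -3 * deriv \<phi> z) \<in> \<D>" and t3: "(\<lambda>z. z\<^sup>2 * deriv \<phi> z) \<in> \<D>"
      by (intro test_mult d smooth_const smooth_power2)+
    note i = L2_mult_integrable[OF w test_L2[OF t1]] L2_mult_integrable[OF w test_L2[OF t2]] L2_mult_integrable[OF w test_L2[OF t3]]
    have "(\<integral>z. w z * H_adj \<phi> z \<partial>half) = (\<integral>z. w z * ((-2) * deriv \<phi> z - z * deriv (deriv \<phi>) z)
        - w z * (-3 * deriv \<phi> z) - 1/4 * (w z * (z\<^sup>2 * deriv \<phi> z)) \<partial>half)"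
      by (rule Bochner_Integration.integral_cong) (auto simp: H_adj_def algebra_simps)
    also have "\<dots> = (\<integral>z. w z * ((-2) * deriv \<phi> z - z * deriv (deriv \<phi>) z) \<partial>half)
        - (\<integral>z. w z * (-3 * deriv \<phi> z) \<partial>half) - 1/4 * (\<integral>z. w z * (z\<^sup>2 * deriv \<phi> z) \<partial>half)"
      using i by simp
    also have "(\<integral>z. w z * ((-2) * deriv \<phi> z - z * deriv (deriv \<phi>) z) \<partial>half) = distr_deriv {..<0} 2 w (\<lambda>z. - z * \<phi> z)"
      unfolding distr_deriv_def 1 by simp
    also have "(\<integral>z. w z * (-3 * deriv \<phi> z) \<partial>half) = - distr_deriv {..<0} 1 w (\<lambda>z. - 3 * \<phi> z)"
      using 2 by (simp add: distr_deriv_def)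
    also have "(\<integral>z. w z * (z\<^sup>2 * deriv \<phi> z) \<partial>half) = - distr_deriv {..<0} 1 (\<lambda>z. z\<^sup>2 * w z) \<phi>"
      by (simp add: distr_deriv_def mult_ac)
    finally show ?thesis by simp
  qed
  then show ?thesis unfolding is_H_def by auto
qed

lemma is_H_unique:
  assumes "w \<in> L2 half" "f \<in> L2 half" "g \<in> L2 half" "is_H w f" "is_H w g"
  shows "AE z in half. f z = g z"
proof -
  have fg: "(\<lambda>x. f x - g x) \<in> L2 half" by (rule L2_diff[OF assms(2,3)])
  have "AE z in half. f z - g z = 0"
  proof (rule fundamental_lemma)
    show "integrable half (\<lambda>x. gauss_weight x * (f x - g x))" by (rule L2_mult_integrable[OF gauss_weight_L2 fg])
    show "(\<lambda>x. f x - g x) \<in> borel_measurable half" by (rule L2_measurable[OF fg])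
    fix \<psi> assume t: "\<psi> \<in> \<D>"
    have "(\<integral>x. (f x - g x) * \<psi> x \<partial>half) = (\<integral>x. f x * \<psi> x \<partial>half) - (\<integral>x. g x * \<psi> x \<partial>half)"
      using L2_mult_integrable[OF assms(2) test_L2[OF t]] L2_mult_integrable[OF assms(3) test_L2[OF t]]
      by (simp add: left_diff_distrib)
    then show "(\<integral>x. (f x - g x) * \<psi> x \<partial>half) = 0"
      using assms(4,5) t unfolding is_H_iff[OF assms(1)] by simp
  qed
  then show ?thesis by simp
qed

text \<open>Integrating the equation twice (du Bois-Reymond) leaves the two classical solutions
  \<open>z\<^sup>-\<^sup>2\<close> and \<open>z\<^sup>-\<^sup>2 exp (z\<^sup>2/8)\<close>: the trial function \<open>z exp (-z\<^sup>2/8) \<theta>\<close> in place of \<open>\<phi>'\<close>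
  is the integrating factor.\<close>

lemma is_H_zero_form:
  assumes d: "d \<in> L2 half" and H: "is_H d (\<lambda>_. 0)"
  shows "\<exists>A B. AE z in half. d z = (A + B * exp (z\<^sup>2 / 8)) / z\<^sup>2"
proof -
  obtain \<xi>0 where \<xi>0: "\<xi>0 \<in> \<D>" "integral\<^sup>L half \<xi>0 = 1" using test_normalized by blast
  define P where "P \<xi> z = - z * deriv \<xi> z + \<xi> z - z\<^sup>2 / 4 * \<xi> z" for \<xi> :: "real \<Rightarrow> real" and z
  define T where "T \<xi> = (\<integral>z. d z * P \<xi> z \<partial>half)" for \<xi>
  have Pt: "P \<xi> \<in> \<D>" if "\<xi> \<in> \<D>" for \<xi>
  proof -
    have "(\<lambda>z. (-1 * z) * deriv \<xi> z + (1 * \<xi> z - (1/4 * z\<^sup>2) * \<xi> z)) \<in> \<D>"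
      by (intro test_add test_diff test_mult test_deriv that smooth_cmult smooth_id smooth_power2 smooth_const)
    then show ?thesis by (simp add: P_def[abs_def] algebra_simps)
  qed
  note int = L2_mult_integrable[OF d test_L2]
  \<comment> \<open>A test function of zero mean is some \<phi>', and then P \<xi> is
    \<open>H_adj \<phi>\<close>.\<close>
  have T0: "T \<xi> = 0" if t: "\<xi> \<in> \<D>" "integral\<^sup>L half \<xi> = 0" for \<xi>
  proof -
    obtain \<phi> where "\<phi> \<in> \<D>" "deriv \<phi> = \<xi>" using test_antideriv[OF t] by blast
    then have "(\<integral>z. d z * H_adj \<phi> z \<partial>half) = 0" using H unfolding is_H_iff[OF d] by simp
    then show ?thesis using \<open>deriv \<phi> = \<xi>\<close> by (simp add: T_def P_def H_adj_def)
  qed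
  \<comment> \<open>The first constant of integration: in the sense of distributions z d' + 2 d -
    z^2 d/4 = c.\<close>
  define c where "c = T \<xi>0"
  have T: "T \<xi> = c * integral\<^sup>L half \<xi>" if t: "\<xi> \<in> \<D>" for \<xi>
  proof -
    let ?m = "integral\<^sup>L half \<xi>"
    let ?e = "\<lambda>z. \<xi> z - ?m * \<xi>0 z"
    have te: "?e \<in> \<D>" by (intro test_diff test_cmult t \<xi>0)
    have "T ?e = 0"
      using test_integrable(2)[OF t] test_integrable(2)[OF \<xi>0(1)] \<xi>0(2) by (intro T0 te) simp
    moreover have D: "deriv ?e z = deriv \<xi> z - ?m * deriv \<xi>0 z" for z
      using t \<xi>0(1) by (intro DERIV_imp_deriv) (auto intro!: derivative_eq_intros smooth_DERIV simp: test_iff)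
    have "P ?e = (\<lambda>z. P \<xi> z - ?m * P \<xi>0 z)"
      unfolding P_def D by (simp add: algebra_simps)
    then have "T ?e = T \<xi> - ?m * T \<xi>0"
    proof -
      assume P: "P ?e = (\<lambda>z. P \<xi> z - ?m * P \<xi>0 z)"
      have "T ?e = (\<integral>z. d z * P \<xi> z - ?m * (d z * P \<xi>0 z) \<partial>half)"
        unfolding T_def P by (simp add: algebra_simps)
      then show ?thesis using int[OF Pt[OF t]] int[OF Pt[OF \<xi>0(1)]] by (simp add: T_def)
    qed
    ultimately show ?thesis by (simp add: c_def)
  qed
  define E where "E z = exp (- z\<^sup>2 / 8)" for z :: real
  have Es: "smooth E" using smooth_gaussian[of "- 1 / 8"] by (simp add: E_def[abs_def])
  \<comment> \<open>For y = z^2 d the once integrated equation is y' = (z/4) (y + 4 c). Hence (y + 4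
    c) exp(-z^2/8) has derivative 0, and the next step verifies this weakly.\<close>
  define g where "g z = (d z * z\<^sup>2 + 4 * c) * E z" for z
  have gi: "(\<integral>z. g z * deriv \<theta> z \<partial>half) = 0" if t: "\<theta> \<in> \<D>" for \<theta>
  proof -
    let ?x = "\<lambda>z. (z * E z) * \<theta> z"
    have tx: "?x \<in> \<D>" by (intro test_mult smooth_mult smooth_id Es t)
    have st: "smooth \<theta>" using t by (simp add: test_iff)
    have D: "deriv ?x z = (E z - z\<^sup>2 / 4 * E z) * \<theta> z + z * E z * deriv \<theta> z" for z
      unfolding E_def by (rule DERIV_imp_deriv)
        (auto intro!: derivative_eq_intros smooth_DERIV st simp: power2_eq_square algebra_simps)
    have "P ?x = (\<lambda>z. - (z\<^sup>2 * E z * deriv \<theta> z))"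
      unfolding P_def D by (simp add: power2_eq_square algebra_simps)
    then have 1: "T ?x = - (\<integral>z. d z * (z\<^sup>2 * E z * deriv \<theta> z) \<partial>half)" by (simp add: T_def)
    \<comment> \<open>Because 4 E' = - z E and a derivative of a test function has integral 0, this
      converts the integral of z E \<theta> into four times that of E \<theta>'.\<close>
    let ?y = "\<lambda>z. (4 * E z) * \<theta> z"
    have ty: "?y \<in> \<D>" by (intro test_mult smooth_cmult Es t)
    have "deriv ?y = (\<lambda>z. 4 * (E z * deriv \<theta> z) - ?x z)"
      unfolding E_def by (intro ext DERIV_imp_deriv)
        (auto intro!: derivative_eq_intros smooth_DERIV st simp: power2_eq_square algebra_simps)
    moreover have tE: "(\<lambda>z. E z * deriv \<theta> z) \<in> \<D>" by (intro test_mult test_deriv Es t)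
    ultimately have 2: "integral\<^sup>L half ?x = 4 * (\<integral>z. E z * deriv \<theta> z \<partial>half)"
      using test_integral_deriv[OF ty] test_integrable(2)[OF tx] test_integrable(2)[OF tE] by simp
    have tz: "(\<lambda>z. z\<^sup>2 * E z * deriv \<theta> z) \<in> \<D>"
      by (intro test_mult test_deriv smooth_mult smooth_power2 Es t)
    have "(\<integral>z. g z * deriv \<theta> z \<partial>half) = (\<integral>z. d z * (z\<^sup>2 * E z * deriv \<theta> z) + 4 * c * (E z * deriv \<theta> z) \<partial>half)"
      by (rule Bochner_Integration.integral_cong) (auto simp: g_def algebra_simps)
    also have "\<dots> = - T ?x + c * integral\<^sup>L half ?x"
      using int[OF tz] test_integrable(2)[OF tE] by (simp add: 1 2)
    finally show ?thesis using T[OF tx] by simp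
  qed
  have Em [measurable]: "E \<in> borel_measurable half" by (intro borel_measurable_half smooth_measurable Es)
  have gloc: "integrable half (\<lambda>x. g x * \<psi> x)" if "\<psi> \<in> \<D>" for \<psi>
  proof -
    have "integrable half (\<lambda>z. d z * ((z\<^sup>2 * E z) * \<psi> z) + 4 * c * (E z * \<psi> z))"
      by (intro Bochner_Integration.integrable_add int integrable_mult_right test_integrable(2) test_mult that smooth_mult smooth_power2 Es)
    then show ?thesis by (simp add: g_def algebra_simps)
  qed
  define k where "k = (\<integral>z. g z * \<xi>0 z \<partial>half)"
  have "AE z in half. g z - k = 0"
  proof (rule fundamental_lemma)
    have wE: "(\<lambda>z. gauss_weight z * (z\<^sup>2 * E z)) \<in> L2 half"
    proof (rule L2_bound[OF gauss_weight_L2, where C = 8])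
      show "AE z in half. \<bar>gauss_weight z * (z\<^sup>2 * E z)\<bar> \<le> 8 * \<bar>gauss_weight z\<bar>"
      proof (rule AE_I2)
        fix z :: real
        have "z\<^sup>2 / 8 \<le> exp (z\<^sup>2 / 8)" using exp_ge_add_one_self[of "z\<^sup>2 / 8"] by linarith
        then have "z\<^sup>2 * E z \<le> 8" by (simp add: E_def exp_minus field_simps)
        moreover have "0 \<le> z\<^sup>2 * E z" by (simp add: E_def)
        ultimately show "\<bar>gauss_weight z * (z\<^sup>2 * E z)\<bar> \<le> 8 * \<bar>gauss_weight z\<bar>"
          using gauss_weight_pos[of z] by (simp add: abs_mult)
      qed
    qed (use L2_measurable[OF gauss_weight_L2] in simp)
    have "integrable half gauss_weight"
      using integrable_half[OF integrable_gaussian[of 1]] by (simp add: gauss_weight_def[abs_def])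
    then have "integrable half (\<lambda>z. E z * gauss_weight z)"
      by (rule Bochner_Integration.integrable_bound)
        (use L2_measurable[OF gauss_weight_L2] gauss_weight_pos in \<open>auto simp: E_def abs_mult mult_left_le_one_le\<close>)
    then have "integrable half (\<lambda>z. (gauss_weight z * (z\<^sup>2 * E z)) * d z + 4 * c * (E z * gauss_weight z) - k * gauss_weight z)"
      using \<open>integrable half gauss_weight\<close> L2_mult_integrable[OF wE d]
      by (intro Bochner_Integration.integrable_add Bochner_Integration.integrable_diff integrable_mult_right)
    then show "integrable half (\<lambda>z. gauss_weight z * (g z - k))" by (simp add: g_def algebra_simps)
    show "(\<lambda>z. g z - k) \<in> borel_measurable half"
      unfolding g_def using L2_measurable[OF d] by measurable
    fix \<psi> assume t: "\<psi> \<in> \<D>"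
    let ?m = "integral\<^sup>L half \<psi>"
    let ?e = "\<lambda>z. \<psi> z - ?m * \<xi>0 z"
    have te: "?e \<in> \<D>" by (intro test_diff test_cmult t \<xi>0)
    have "integral\<^sup>L half ?e = 0"
      using test_integrable(2)[OF t] test_integrable(2)[OF \<xi>0(1)] \<xi>0(2) by simp
    then obtain \<theta> where "\<theta> \<in> \<D>" "deriv \<theta> = ?e" using test_antideriv[OF te] by blast
    then have "(\<integral>z. g z * ?e z \<partial>half) = 0" using gi[of \<theta>] by simp
    then have "(\<integral>z. g z * \<psi> z \<partial>half) = ?m * k"
    proof -
      assume 0: "(\<integral>z. g z * ?e z \<partial>half) = 0"
      have "(\<integral>z. g z * ?e z \<partial>half) = (\<integral>z. g z * \<psi> z - ?m * (g z * \<xi>0 z) \<partial>half)"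
        by (simp add: algebra_simps)
      then show ?thesis using gloc[OF t] gloc[OF \<xi>0(1)] 0 by (simp add: k_def)
    qed
    then show "(\<integral>z. (g z - k) * \<psi> z \<partial>half) = 0"
      using gloc[OF t] test_integrable(2)[OF t] by (simp add: left_diff_distrib)
  qed
  then have "AE z in half. d z = (- 4 * c + k * exp (z\<^sup>2 / 8)) / z\<^sup>2"
    using AE_space
  proof eventually_elim
    case (elim z)
    then have "(d z * z\<^sup>2 + 4 * c) * E z * exp (z\<^sup>2 / 8) = k * exp (z\<^sup>2 / 8)" by (simp add: g_def)
    moreover have "E z * exp (z\<^sup>2 / 8) = 1" by (simp add: E_def exp_add[symmetric])
    ultimately have "d z * z\<^sup>2 + 4 * c = k * exp (z\<^sup>2 / 8)" by (simp add: mult.assoc)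
    then show ?case using elim(2) by (simp add: field_simps)
  qed
  then show ?thesis by blast
qed

text \<open>A Chebyshev estimate on (-e, 0). It is used with e tending to 0 against the singularity
  at the origin, and with e arbitrarily large against non-integrability at minus infinity.\<close>

lemma half_integral_lower_bound:
  assumes "integrable half (\<lambda>x. (d x)\<^sup>2)" "0 < e" "0 \<le> m"
    and "AE x in half. - e < x \<longrightarrow> m \<le> (d x)\<^sup>2"
  shows "m * e \<le> (\<integral>x. (d x)\<^sup>2 \<partial>half)"
proof -
  have "integral\<^sup>L half (\<lambda>x. m * indicator {- e<..<0} x) = m * e"
    using assms(2) by (subst integral_half_eq) (auto simp: indicator_inter_arith[symmetric] mult.left_commute[of _ m] Int_absorb1 subset_iff)
  moreover have "integral\<^sup>L half (\<lambda>x. m * indicator {- e<..<0} x) \<le> (\<integral>x. (d x)\<^sup>2 \<partial>half)"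
  proof (rule integral_mono_AE)
    show "integrable half (\<lambda>x. m * indicator {- e<..<0} x)"
      using assms(2) by (intro integrable_half integrable_mult_right integrable_real_indicator) simp_all
    show "AE x in half. m * indicator {- e<..<0} x \<le> (d x)\<^sup>2"
      using assms(4) by eventually_elim (auto simp: indicator_def)
  qed (fact assms(1))
  ultimately show ?thesis by linarith
qed

text \<open>If A + B \<noteq> 0, then d exceeds m/z^2 in absolute value near 0 with m = |A + B|/2,
  and the integral of d^2 is at least m^2/e^3 for all small e. If B = - A the singularity cancels,
  but exp s - 1 \<ge> s with s = z^2/8 bounds |d| below by |A|/8 on the whole half-line.\<close>

lemma is_H_zero:
  assumes d: "d \<in> L2 half" and H: "is_H d (\<lambda>_. 0)"
  shows "AE z in half. d z = 0"
proof -
  obtain A B where AB: "AE z in half. d z = (A + B * exp (z\<^sup>2 / 8)) / z\<^sup>2" using is_H_zero_form[OF assms] by blast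
  define I where "I = (\<integral>x. (d x)\<^sup>2 \<partial>half)"
  note lb = half_integral_lower_bound[OF L2_square_integrable[OF d], folded I_def]
  have "A + B = 0"
  proof (rule ccontr)
    assume ne: "A + B \<noteq> 0"
    define m where "m = \<bar>A + B\<bar> / 2"
    have m: "0 < m" using ne by (simp add: m_def)
    have "((\<lambda>z. \<bar>A + B * exp (z\<^sup>2 / 8)\<bar>) \<longlongrightarrow> \<bar>A + B * exp (0\<^sup>2 / 8)\<bar>) (at_left (0::real))"
      by (intro tendsto_intros) simp
    moreover have "m < \<bar>A + B * exp (0\<^sup>2 / 8)\<bar>" using m by (simp add: m_def)
    ultimately have "\<forall>\<^sub>F z in at_left 0. m < \<bar>A + B * exp (z\<^sup>2 / 8)\<bar>" by (rule order_tendstoD(1))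
    then obtain b where b: "b < 0" "\<And>z. b < z \<Longrightarrow> z < 0 \<Longrightarrow> m < \<bar>A + B * exp (z\<^sup>2 / 8)\<bar>"
      unfolding eventually_at_left_field by blast
    have "m\<^sup>2 / e ^ 3 \<le> I" if e: "0 < e" "e \<le> - b" for e
    proof -
      have "(m\<^sup>2 / e ^ 4) * e \<le> I"
      proof (rule lb[OF e(1)])
        show "AE z in half. - e < z \<longrightarrow> m\<^sup>2 / e ^ 4 \<le> (d z)\<^sup>2"
          using AB AE_space
        proof eventually_elim
          case (elim z)
          show ?case
          proof
            assume z: "- e < z"
            then have "m < \<bar>A + B * exp (z\<^sup>2 / 8)\<bar>" using elim(2) e by (intro b) auto
            then have 1: "m\<^sup>2 \<le> (A + B * exp (z\<^sup>2 / 8))\<^sup>2"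
              using m by (simp add: abs_le_square_iff[symmetric])
            have "(- z) ^ 4 \<le> e ^ 4" using z elim(2) by (intro power_mono) auto
            then have "m\<^sup>2 / e ^ 4 \<le> (A + B * exp (z\<^sup>2 / 8))\<^sup>2 / z ^ 4"
              using 1 elim(2) e(1) by (intro frac_le) auto
            then show "m\<^sup>2 / e ^ 4 \<le> (d z)\<^sup>2" unfolding elim(1) by (simp add: power_divide power_mult[symmetric])
          qed
        qed
      qed simp
      then show ?thesis using e by (simp add: field_simps power3_eq_cube power4_eq_xxxx)
    qed
    then have ev: "\<forall>\<^sub>F e in at_right 0. m\<^sup>2 / e ^ 3 \<le> I"
      using b(1) by (auto simp: eventually_at_right_field intro!: exI[of _ "- b"])
    have "filterlim (\<lambda>e. m\<^sup>2 / e ^ 3) at_top (at_right (0::real))"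
      using m by real_asymp
    then have "\<forall>\<^sub>F e in at_right 0. I < m\<^sup>2 / e ^ 3" by (simp add: filterlim_at_top_dense)
    from eventually_happens[OF eventually_conj[OF ev this]] show False by auto
  qed
  have "A = 0"
  proof (rule ccontr)
    assume ne: "A \<noteq> 0"
    have B: "B = - A" using \<open>A + B = 0\<close> by simp
    have "(A / 8)\<^sup>2 * e \<le> I" if "0 < e" for e
    proof (rule lb[OF that])
      show "AE z in half. - e < z \<longrightarrow> (A / 8)\<^sup>2 \<le> (d z)\<^sup>2"
        using AB AE_space
      proof eventually_elim
        case (elim z)
        have "z\<^sup>2 / 8 \<le> exp (z\<^sup>2 / 8) - 1" using exp_ge_add_one_self[of "z\<^sup>2 / 8"] by linarith
        then have "1 / 8 \<le> (exp (z\<^sup>2 / 8) - 1) / z\<^sup>2" using elim(2) by (simp add: field_simps)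
        then have "\<bar>A\<bar> * (1 / 8) \<le> \<bar>A\<bar> * ((exp (z\<^sup>2 / 8) - 1) / z\<^sup>2)" by (intro mult_left_mono) auto
        also have "\<dots> = \<bar>d z\<bar>"
        proof -
          have "d z = - (A * ((exp (z\<^sup>2 / 8) - 1) / z\<^sup>2))"
            unfolding elim(1) B using elim(2) by (simp add: field_simps)
          then show ?thesis by (simp add: abs_mult)
        qed
        finally have "\<bar>A / 8\<bar> \<le> \<bar>d z\<bar>" by simp
        then have "(A / 8)\<^sup>2 \<le> (d z)\<^sup>2" by (simp only: abs_le_square_iff)
        then show ?case by blast
      qed
    qed simp
    moreover have "0 < (\<bar>I\<bar> + 1) / (A / 8)\<^sup>2" using ne by (intro divide_pos_pos) auto
    ultimately have "(A / 8)\<^sup>2 * ((\<bar>I\<bar> + 1) / (A / 8)\<^sup>2) \<le> I" by blast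
    then show False using ne by simp
  qed
  then show ?thesis using AB \<open>A + B = 0\<close> by simp
qed

section \<open>The inverse of \<open>H\<close>\<close>

interpretation lborel_half: pair_sigma_finite lborel half ..

section \<open>Tails of integrable functions\<close>

lemma tail_continuous:
  fixes F :: "real \<Rightarrow> real"
  assumes F: "integrable half F"
  shows "isCont (\<lambda>z. \<integral>q. indicator {..<z} q * F q \<partial>half) z"
proof (rule continuous_at_sequentiallyI)
  fix u :: "nat \<Rightarrow> real" assume u: "u \<longlonglongrightarrow> z"
  show "(\<lambda>n. \<integral>q. indicator {..<u n} q * F q \<partial>half) \<longlonglongrightarrow> (\<integral>q. indicator {..<z} q * F q \<partial>half)"
  proof (rule integral_dominated_convergence[where w = "\<lambda>q. \<bar>F q\<bar>"])
    have "AE q in lborel. q \<noteq> z" by (rule AE_lborel_singleton)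
    then have "AE q in lebesgue. q \<noteq> z" by (rule AE_completion)
    then have "AE q in half. q \<noteq> z" by (subst AE_restrict_space_iff) auto
    then show "AE q in half. (\<lambda>n. indicator {..<u n} q * F q) \<longlonglongrightarrow> indicator {..<z} q * F q"
    proof eventually_elim
      case (elim q)
      have "\<forall>\<^sub>F n in sequentially. (q < u n) = (q < z)"
      proof (cases "q < z")
        case True
        then show ?thesis using order_tendstoD(1)[OF u True] by (auto elim: eventually_mono)
      next
        case False
        then have "z < q" using elim by simp
        then show ?thesis using order_tendstoD(2)[OF u, of q] by (auto elim: eventually_mono)
      qed
      then show ?case by (intro tendsto_eventually) (auto simp: indicator_def elim!: eventually_mono)
    qed
  qed (use F in \<open>auto simp: indicator_def\<close>)
qed

text \<open>F is merely integrable, so its tail need not be differentiable and the product rule is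
  not at hand. Fubini's theorem takes its place: for fixed q the variable z runs from
  \<open>max q a\<close> to b, which explains the maximum on the right.\<close>

lemma tail_integration_by_parts:
  fixes F \<phi> \<phi>' :: "real \<Rightarrow> real"
  assumes F: "integrable half F" and ab: "a \<le> b" "b \<le> 0"
    and d: "\<And>x. a \<le> x \<Longrightarrow> x \<le> b \<Longrightarrow> (\<phi> has_real_derivative \<phi>' x) (at x)"
    and c: "\<And>x. a \<le> x \<Longrightarrow> x \<le> b \<Longrightarrow> isCont \<phi>' x"
  shows "((\<lambda>z. \<phi>' z * (\<integral>q. indicator {..<z} q * F q \<partial>half)) has_integral
      (\<integral>q. indicator {..<b} q * (F q * (\<phi> b - \<phi> (max q a))) \<partial>half)) {a..b}"
proof -
  define k where "k z = indicator {a..b} z * \<phi>' z" for z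
  have co: "continuous_on {a..b} \<phi>'" using c by (auto intro: continuous_at_imp_continuous_on)
  have ki: "integrable lborel k"
    using borel_integrable_compact[OF _ co] by (simp add: k_def[abs_def])
  have [measurable]: "k \<in> borel_measurable borel" using ki by auto
  have [measurable]: "F \<in> borel_measurable half" using F by auto
  have prod: "integrable (lborel \<Otimes>\<^sub>M half) (\<lambda>(z, q). k z * F q)"
  proof (rule lborel_half.Fubini_integrable)
    show "integrable lborel (\<lambda>z. \<integral>q. norm (case (z, q) of (z, q) \<Rightarrow> k z * F q) \<partial>half)"
      using ki F by (simp add: abs_mult)
    show "AE z in lborel. integrable half (\<lambda>q. case (z, q) of (z, q) \<Rightarrow> k z * F q)"
      using F by simp
  qed simp
  have ind: "integrable (lborel \<Otimes>\<^sub>M half) (\<lambda>(z, q). k z * (indicator {..<z} q * F q))"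
  proof (rule Bochner_Integration.integrable_bound[OF prod])
    have "(\<lambda>(z, q). k z * ((if q < z then 1 else 0) * F q)) \<in> borel_measurable (lborel \<Otimes>\<^sub>M half)"
      by measurable
    then show "(\<lambda>(z, q). k z * (indicator {..<z} q * F q)) \<in> borel_measurable (lborel \<Otimes>\<^sub>M half)"
      by (simp add: indicator_def of_bool_def)
  qed (auto simp: indicator_def)
  let ?P = "\<lambda>z. \<integral>q. indicator {..<z} q * F q \<partial>half"
  have "(\<integral>z. k z * ?P z \<partial>lborel) = (\<integral>z. (\<integral>q. k z * (indicator {..<z} q * F q) \<partial>half) \<partial>lborel)"
    by simp
  also have "\<dots> = (\<integral>q. (\<integral>z. k z * (indicator {..<z} q * F q) \<partial>lborel) \<partial>half)"
    by (rule lborel_half.Fubini_integral[OF ind, symmetric])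
  also have "\<dots> = (\<integral>q. indicator {..<b} q * (F q * (\<phi> b - \<phi> (max q a))) \<partial>half)"
  proof (rule Bochner_Integration.integral_cong)
    fix q
    have "(\<integral>z. k z * indicator {..<z} q \<partial>lborel) = indicator {..<b} q * (\<phi> b - \<phi> (max q a))"
    proof (cases "q < b")
      case True
      let ?m = "max q a"
      have "(\<integral>z. \<phi>' z * indicator {?m..b} z \<partial>lborel) = \<phi> b - \<phi> ?m"
        using True ab c d by (intro integral_FTC_Icc_real) auto
      moreover have "(\<integral>z. k z * indicator {..<z} q \<partial>lborel) = (\<integral>z. \<phi>' z * indicator {?m..b} z \<partial>lborel)"
      proof (rule integral_cong_AE)
        show "AE z in lborel. k z * indicator {..<z} q = \<phi>' z * indicator {?m..b} z"
          using AE_lborel_singleton[of q] by eventually_elim (auto simp: k_def indicator_def)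
        have "(\<lambda>z. k z * indicator {q<..} z) \<in> borel_measurable lborel"
          by (intro borel_measurable_times) auto
        moreover have "(\<lambda>z. k z * indicator {..<z} q) = (\<lambda>z. k z * indicator {q<..} z)"
          by (auto simp: indicator_def)
        ultimately show "(\<lambda>z. k z * indicator {..<z} q) \<in> borel_measurable lborel" by simp
        have "(\<lambda>z. \<phi>' z * indicator {?m..b} z) = (\<lambda>z. k z * indicator {?m..b} z)"
          by (auto simp: k_def indicator_def)
        then show "(\<lambda>z. \<phi>' z * indicator {?m..b} z) \<in> borel_measurable lborel" by simp
      qed
      ultimately show ?thesis using True by simp
    next
      case False
      then have "(\<lambda>z. k z * indicator {..<z} q) = (\<lambda>z. 0)" by (auto simp: k_def indicator_def)
      then show ?thesis using False by simp
    qed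
    then have "(\<integral>z. (k z * indicator {..<z} q) * F q \<partial>lborel) = indicator {..<b} q * (\<phi> b - \<phi> (max q a)) * F q"
      by simp
    then show "(\<integral>z. k z * (indicator {..<z} q * F q) \<partial>lborel) = indicator {..<b} q * (F q * (\<phi> b - \<phi> (max q a)))"
      by (simp add: mult_ac)
  qed simp
  finally have *: "(\<integral>z. k z * ?P z \<partial>lborel) = (\<integral>q. indicator {..<b} q * (F q * (\<phi> b - \<phi> (max q a))) \<partial>half)" .
  have "continuous_on {a..b} (\<lambda>z. \<phi>' z * ?P z)"
    by (intro continuous_on_mult co continuous_at_imp_continuous_on ballI tail_continuous F)
  then have "set_integrable lborel {a..b} (\<lambda>z. \<phi>' z * ?P z)"
    unfolding set_integrable_def by (intro borel_integrable_compact) auto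
  from set_borel_integral_eq_integral[OF this] show ?thesis
    unfolding has_integral_iff set_lebesgue_integral_def *[symmetric] k_def by (simp add: mult.assoc)
qed

text \<open>Integrating \<open>H w = f\<close> once gives \<open>z w' + 2 w = - exp (z\<^sup>2/8) gauss_tail f z\<close>, and once more, with the order
  of integration interchanged, \<open>z\<^sup>2 w = - Hinv_num f z\<close>. The functional \<open>kap\<close> is the boundary value \<open>2 w(0)\<close>.\<close>

definition gauss :: "real \<Rightarrow> real" where "gauss z = exp (- 1 / 8 * z\<^sup>2)"

definition gauss_tail :: "(real \<Rightarrow> real) \<Rightarrow> real \<Rightarrow> real" where
  "gauss_tail f z = (\<integral>q. indicator {..<z} q * (gauss q * f q) \<partial>half)"

definition Hinv_num :: "(real \<Rightarrow> real) \<Rightarrow> real \<Rightarrow> real" where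
  "Hinv_num f z = (\<integral>q. gauss q * f q * (4 * (exp ((max q z)\<^sup>2 / 8) - 1)) \<partial>half)"

definition Hinv :: "(real \<Rightarrow> real) \<Rightarrow> real \<Rightarrow> real" where "Hinv f z = - Hinv_num f z / z\<^sup>2"

definition kap :: "(real \<Rightarrow> real) \<Rightarrow> real" where "kap f = - (\<integral>q. gauss q * f q \<partial>half)"

lemma gauss_L2: "gauss \<in> L2 half"
  using gaussian_L2[of "1/8"] by (simp add: gauss_def[abs_def])

lemma gauss_exp: "gauss z * exp (z\<^sup>2 / 8) = 1" "exp (z\<^sup>2 / 8) * gauss z = 1"
  by (simp_all add: gauss_def exp_add[symmetric])

lemma gauss_pos: "0 < gauss z" by (simp add: gauss_def)

lemma gauss_measurable [measurable]: "gauss \<in> borel_measurable borel"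
  unfolding gauss_def[abs_def] by measurable

lemma gauss_f_integrable: "f \<in> L2 half \<Longrightarrow> integrable half (\<lambda>q. gauss q * f q)"
  by (rule L2_mult_integrable[OF gauss_L2])

lemma gauss_tail_continuous: "f \<in> L2 half \<Longrightarrow> isCont (gauss_tail f) z"
  unfolding gauss_tail_def[abs_def] by (rule tail_continuous[OF gauss_f_integrable])

lemma gauss_tail_0: "gauss_tail f 0 = - kap f"
  unfolding gauss_tail_def kap_def by (auto intro!: Bochner_Integration.integral_cong simp: indicator_def)

section \<open>Kernel bounds for the inverse operator\<close>

lemma shifted_gaussian_L2: "z \<le> 0 \<Longrightarrow> (\<lambda>q. exp (- 1 / 8 * (q - z)\<^sup>2)) \<in> L2 half"
  and shifted_gaussian_integrable: "0 < c \<Longrightarrow> integrable lborel (\<lambda>q. exp (- c * (q - z)\<^sup>2))" for z c :: real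
proof -
  show *: "integrable lborel (\<lambda>q. exp (- c * (q - z)\<^sup>2))" if "0 < c" for c z :: real
    using lborel_integrable_real_affine[OF integrable_gaussian[OF that], of 1 "- z"] by simp
  show "(\<lambda>q. exp (- 1 / 8 * (q - z)\<^sup>2)) \<in> L2 half"
    using integrable_half[OF *[of "1/4" z]]
    by (auto simp: L2_def power2_eq_square[of "exp _"] exp_add[symmetric] intro!: borel_measurable_half)
qed

text \<open>On the tail the growing factor exp(z^2/8) is absorbed: the difference of the exponents
  is z (q - z)/4 \<ge> 0. The result is a translated Gaussian, whose norm is bounded uniformly in
  z.\<close>

lemma gaussian_shift_le:
  assumes "q < z" "z \<le> 0" shows "exp (z\<^sup>2 / 8) * gauss q \<le> exp (- 1 / 8 * (q - z)\<^sup>2)"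
proof -
  have "0 \<le> z * (q - z)" using assms by (simp add: mult_nonpos_nonpos)
  moreover have "- 1 / 8 * (q - z)\<^sup>2 - (z\<^sup>2 / 8 + - 1 / 8 * q\<^sup>2) = z * (q - z) / 4"
    by (simp add: power2_eq_square field_simps)
  ultimately have "z\<^sup>2 / 8 + - 1 / 8 * q\<^sup>2 \<le> - 1 / 8 * (q - z)\<^sup>2" by linarith
  then show ?thesis by (simp add: gauss_def exp_add[symmetric])
qed

definition gauss_mass :: real where "gauss_mass = (\<integral>q. exp (- 1 / 4 * q\<^sup>2) \<partial>lborel)"

lemma gauss_mass_nonneg: "0 \<le> gauss_mass" by (simp add: gauss_mass_def)

lemma half_integral_le_lborel:
  fixes f :: "real \<Rightarrow> real"
  assumes "integrable lborel f" "\<And>x. 0 \<le> f x"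
  shows "integral\<^sup>L half f \<le> integral\<^sup>L lborel f"
  using assms integrable_mult_indicator[of "{..<0}" lborel f]
  by (subst integral_half_eq) (auto intro!: integral_mono simp: indicator_def)

lemma shifted_gaussian_norm: "L2_norm half (\<lambda>q. exp (- 1 / 8 * (q - z)\<^sup>2)) \<le> sqrt gauss_mass"
proof -
  have "(\<integral>q. (exp (- 1 / 8 * (q - z)\<^sup>2))\<^sup>2 \<partial>half) = (\<integral>q. exp (- (1 / 4) * (q - z)\<^sup>2) \<partial>half)"
    by (simp add: power2_eq_square[of "exp _"] exp_add[symmetric])
  also have "\<dots> \<le> (\<integral>q. exp (- (1 / 4) * (q - z)\<^sup>2) \<partial>lborel)"
    by (intro half_integral_le_lborel shifted_gaussian_integrable) auto
  also have "\<dots> = gauss_mass"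
    unfolding gauss_mass_def using lborel_integral_real_affine[of 1 "\<lambda>q. exp (- 1 / 4 * q\<^sup>2)" "- z"] by simp
  finally show ?thesis unfolding L2_norm_def by simp
qed

lemma gauss_tail_bound:
  assumes f: "f \<in> L2 half" and z: "z \<le> 0"
  shows "\<bar>exp (z\<^sup>2 / 8) * gauss_tail f z\<bar> \<le> sqrt gauss_mass * L2_norm half f"
proof -
  let ?g = "\<lambda>q. exp (- 1 / 8 * (q - z)\<^sup>2)"
  let ?h = "\<lambda>q. indicator {..<z} q * (exp (z\<^sup>2 / 8) * gauss q)"
  have fm [measurable]: "f \<in> borel_measurable half" using f by (rule L2_measurable)
  have b: "\<bar>?h q\<bar> \<le> ?g q" if "q < 0" for q
    using gaussian_shift_le[of q z] z gauss_pos[of q] by (cases "q < z") (auto simp: abs_mult)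
  have hL: "?h \<in> L2 half"
    by (rule L2_bound[OF shifted_gaussian_L2[OF z], where C = 1]) (use b in \<open>auto simp: borel_measurable_half\<close>)
  have "exp (z\<^sup>2 / 8) * gauss_tail f z = (\<integral>q. ?h q * f q \<partial>half)"
    unfolding gauss_tail_def by (simp add: mult_ac flip: Bochner_Integration.integral_mult_right_zero)
  also have "\<bar>\<dots>\<bar> \<le> L2_norm half ?h * L2_norm half f" by (rule Cauchy_Schwarz_half[OF hL f])
  also have "L2_norm half ?h \<le> L2_norm half ?g"
    unfolding L2_norm_def
  proof (intro real_sqrt_le_mono integral_mono)
    show "(?h q)\<^sup>2 \<le> (?g q)\<^sup>2" if "q \<in> space half" for q
      using b[of q] that by (simp only: abs_le_square_iff[symmetric]) simp
  qed (use L2_square_integrable[OF hL] L2_square_integrable[OF shifted_gaussian_L2[OF z]] in auto)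
  also have "\<dots> \<le> sqrt gauss_mass" by (rule shifted_gaussian_norm)
  finally show ?thesis by (simp add: mult_right_mono L2_norm_nonneg)
qed

text \<open>A majorant of the norm of the kernel of \<open>Hinv\<close> at z. It is bounded near 0
  and decays like |z| to the power -3/2, which is enough for square integrability and for the
  boundary terms at minus infinity.\<close>

definition Hinv_envelope :: "real \<Rightarrow> real" where "Hinv_envelope z = 8 / (8 + z\<^sup>2) * sqrt (2 * (\<bar>z\<bar> + gauss_mass))"

text \<open>The factor 4 (1 - exp(-x/8))/z^2 with x \<le> z^2 is at most 1/2 and at most 4/z^2; the
  function 8/(8 + z^2) dominates the first when z^2 \<le> 8 and the second otherwise. For q \<ge> z
  one takes x = q^2; for q < z one takes x = z^2, with a translated Gaussian as the remaining
  factor.\<close>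

lemma kernel_bound:
  assumes z: "z < 0" and q: "q < 0"
  shows "\<bar>gauss q * (4 * (exp ((max q z)\<^sup>2 / 8) - 1)) / z\<^sup>2\<bar>
    \<le> 8 / (8 + z\<^sup>2) * (indicator {z..<0} q + exp (- 1 / 8 * (q - z)\<^sup>2))"
proof -
  have m: "4 * (1 - exp (- x / 8)) / z\<^sup>2 \<le> 8 / (8 + z\<^sup>2)" if x: "0 \<le> x" "x \<le> z\<^sup>2" for x
  proof (cases "z\<^sup>2 \<le> 8")
    case True
    have "1 - exp (- x / 8) \<le> x / 8" using exp_ge_add_one_self[of "- x / 8"] by linarith
    then have "4 * (1 - exp (- x / 8)) / z\<^sup>2 \<le> 1 / 2" using x z by (simp add: field_simps)
    also have "1 / 2 \<le> 8 / (8 + z\<^sup>2)" using True by (simp add: field_simps add_pos_nonneg)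
    finally show ?thesis .
  next
    case False
    have "1 - exp (- x / 8) \<le> 1" by simp
    then have "4 * (1 - exp (- x / 8)) / z\<^sup>2 \<le> 4 / z\<^sup>2" by (intro divide_right_mono) auto
    also have "4 / x \<le> 8 / (8 + x)" if "8 < x" for x :: real using that by (simp add: field_simps)
    then have "4 / z\<^sup>2 \<le> 8 / (8 + z\<^sup>2)" using False by simp
    finally show ?thesis .
  qed
  have p8: "0 < 8 / (8 + z\<^sup>2)" by (simp add: add_pos_nonneg)
  show ?thesis
  proof (cases "z \<le> q")
    case True
    have "gauss q * (4 * (exp ((max q z)\<^sup>2 / 8) - 1)) = 4 * (1 - exp (- q\<^sup>2 / 8))"
      using True gauss_exp[of q] by (simp add: right_diff_distrib gauss_def)
    moreover have "q\<^sup>2 \<le> z\<^sup>2" using True q by (simp add: abs_le_square_iff[symmetric])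
    ultimately have "gauss q * (4 * (exp ((max q z)\<^sup>2 / 8) - 1)) / z\<^sup>2 \<le> 8 / (8 + z\<^sup>2)"
      "0 \<le> gauss q * (4 * (exp ((max q z)\<^sup>2 / 8) - 1)) / z\<^sup>2"
      using m[of "q\<^sup>2"] by auto
    moreover have "8 / (8 + z\<^sup>2) \<le> 8 / (8 + z\<^sup>2) * (indicator {z..<0} q + exp (- 1 / 8 * (q - z)\<^sup>2))"
      using True q p8 by (subst mult_le_cancel_left1) auto
    ultimately show ?thesis by linarith
  next
    case False
    have X: "gauss q * (4 * (exp ((max q z)\<^sup>2 / 8) - 1)) / z\<^sup>2 = 4 * (1 - exp (- z\<^sup>2 / 8)) / z\<^sup>2 * (exp (z\<^sup>2 / 8) * gauss q)"
    proof -
      have e: "(1 - exp (- z\<^sup>2 / 8)) * exp (z\<^sup>2 / 8) = exp (z\<^sup>2 / 8) - 1"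
        by (simp add: left_diff_distrib exp_add[symmetric])
      have "max q z = z" using False by simp
      moreover have "gauss q * (4 * X) / z\<^sup>2 = 4 * Y / z\<^sup>2 * (W * gauss q)" if "Y * W = X" for X Y W
        unfolding that[symmetric] by simp
      note this[OF e]
      ultimately show ?thesis by (simp only:)
    qed
    have g1: "exp (z\<^sup>2 / 8) * gauss q \<le> exp (- 1 / 8 * (q - z)\<^sup>2)"
      using False z by (intro gaussian_shift_le) auto
    have g2: "0 \<le> 4 * (1 - exp (- z\<^sup>2 / 8)) / z\<^sup>2" by simp
    have g3: "0 \<le> exp (z\<^sup>2 / 8) * gauss q" using gauss_pos[of q] by simp
    have "4 * (1 - exp (- z\<^sup>2 / 8)) / z\<^sup>2 * (exp (z\<^sup>2 / 8) * gauss q) \<le> 8 / (8 + z\<^sup>2) * exp (- 1 / 8 * (q - z)\<^sup>2)"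
      by (rule mult_mono[OF m g1 less_imp_le[OF p8] g3]) auto
    then show ?thesis using False mult_nonneg_nonneg[OF g2 g3] unfolding X by simp
  qed
qed

lemma L2_norm_scale: "0 \<le> c \<Longrightarrow> L2_norm M (\<lambda>x. c * f x) = c * L2_norm M f"
  by (simp add: L2_norm_def power_mult_distrib real_sqrt_mult)

lemma Hinv_bound:
  assumes f: "f \<in> L2 half" and z: "z < 0"
  shows "\<bar>Hinv f z\<bar> \<le> Hinv_envelope z * L2_norm half f"
    and "integrable half (\<lambda>q. gauss q * f q * (4 * (exp ((max q z)\<^sup>2 / 8) - 1)))"
proof -
  let ?k = "\<lambda>q. indicator {z..<0} q + exp (- 1 / 8 * (q - z)\<^sup>2)"
  let ?h = "\<lambda>q. gauss q * (4 * (exp ((max q z)\<^sup>2 / 8) - 1)) / z\<^sup>2"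
  have i1: "integrable lborel (indicator {z..<0} :: real \<Rightarrow> real)"
    using z by (intro integrable_real_indicator) simp_all
  have iL: "indicator {z..<0} \<in> L2 half"
    using integrable_half[OF i1]
    by (auto simp: L2_def power2_eq_square indicator_inter_arith[symmetric] intro!: borel_measurable_half)
  have kL: "?k \<in> L2 half"
    using z by (intro L2_add iL shifted_gaussian_L2) auto
  have hL: "?h \<in> L2 half"
  proof (rule L2_bound[OF kL])
    show "AE q in half. \<bar>?h q\<bar> \<le> 8 / (8 + z\<^sup>2) * \<bar>?k q\<bar>"
      using kernel_bound[OF z] by (intro AE_I2) (simp add: abs_of_nonneg add_nonneg_nonneg)
  qed (auto intro!: borel_measurable_half)
  have nk: "L2_norm half ?k \<le> sqrt (2 * (\<bar>z\<bar> + gauss_mass))"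
    unfolding L2_norm_def
  proof (rule real_sqrt_le_mono)
    have gi: "integrable lborel (\<lambda>q. exp (- (1/4) * (q - z)\<^sup>2))" by (rule shifted_gaussian_integrable) simp
    have "(\<integral>q. (?k q)\<^sup>2 \<partial>half) \<le> (\<integral>q. 2 * (indicator {z..<0} q + exp (- (1/4) * (q - z)\<^sup>2)) \<partial>half)"
    proof (rule integral_mono)
      fix q
      have "(?k q)\<^sup>2 \<le> 2 * ((indicator {z..<0} q)\<^sup>2 + (exp (- 1 / 8 * (q - z)\<^sup>2))\<^sup>2)"
        using sum_squares_bound[of "indicator {z..<0} q" "exp (- 1 / 8 * (q - z)\<^sup>2)"]
        by (simp add: power2_sum)
      then show "(?k q)\<^sup>2 \<le> 2 * (indicator {z..<0} q + exp (- (1/4) * (q - z)\<^sup>2))"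
        by (simp add: power2_eq_square[of "exp _"] power2_eq_square[of "indicator _ _"] exp_add[symmetric]
            indicator_inter_arith[symmetric])
    qed (use L2_square_integrable[OF kL] integrable_half[OF gi] integrable_half[OF i1] in auto)
    also have "\<dots> \<le> (\<integral>q. 2 * (indicator {z..<0} q + exp (- (1/4) * (q - z)\<^sup>2)) \<partial>lborel)"
      using gi i1 by (intro half_integral_le_lborel) auto
    also have "\<dots> = 2 * (\<bar>z\<bar> + gauss_mass)"
      using gi i1 z lborel_integral_real_affine[of 1 "\<lambda>q. exp (- 1 / 4 * q\<^sup>2)" "- z"]
      by (simp add: gauss_mass_def)
    finally show "(\<integral>q. (?k q)\<^sup>2 \<partial>half) \<le> 2 * (\<bar>z\<bar> + gauss_mass)" .
  qed
  have p8: "0 < 8 / (8 + z\<^sup>2)" by (simp add: add_pos_nonneg)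
  have "L2_norm half ?h \<le> L2_norm half (\<lambda>q. 8 / (8 + z\<^sup>2) * ?k q)"
    unfolding L2_norm_def
  proof (intro real_sqrt_le_mono integral_mono)
    show "(?h q)\<^sup>2 \<le> (8 / (8 + z\<^sup>2) * ?k q)\<^sup>2" if "q \<in> space half" for q
    proof -
      have "0 \<le> 8 / (8 + z\<^sup>2) * ?k q" using p8 by (intro mult_nonneg_nonneg) auto
      then have "\<bar>?h q\<bar> \<le> \<bar>8 / (8 + z\<^sup>2) * ?k q\<bar>" using kernel_bound[OF z, of q] that by simp
      then show ?thesis by (simp only: abs_le_square_iff)
    qed
    show "integrable half (\<lambda>q. (8 / (8 + z\<^sup>2) * ?k q)\<^sup>2)"
      by (rule L2_square_integrable[OF L2_scale[OF kL]])
  qed (rule L2_square_integrable[OF hL])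
  also have "\<dots> = 8 / (8 + z\<^sup>2) * L2_norm half ?k"
    using p8 by (intro L2_norm_scale) simp
  also have "\<dots> \<le> Hinv_envelope z" unfolding Hinv_envelope_def using nk p8 by (intro mult_left_mono) auto
  finally have nh: "L2_norm half ?h \<le> Hinv_envelope z" .
  have "Hinv f z = - (\<integral>q. ?h q * f q \<partial>half)"
    unfolding Hinv_def Hinv_num_def by (simp add: mult_ac flip: Bochner_Integration.integral_divide_zero)
  then have "\<bar>Hinv f z\<bar> \<le> L2_norm half ?h * L2_norm half f"
    using Cauchy_Schwarz_half[OF hL f] by simp
  also have "\<dots> \<le> Hinv_envelope z * L2_norm half f" by (intro mult_right_mono nh L2_norm_nonneg)
  finally show "\<bar>Hinv f z\<bar> \<le> Hinv_envelope z * L2_norm half f" .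
  have "integrable half (\<lambda>q. z\<^sup>2 * (?h q * f q))"
    by (intro integrable_mult_right L2_mult_integrable hL f)
  then show "integrable half (\<lambda>q. gauss q * f q * (4 * (exp ((max q z)\<^sup>2 / 8) - 1)))"
    using z by (simp add: mult_ac)
qed

lemma Hinv_envelope_L2: "Hinv_envelope \<in> L2 half"
proof -
  have "integrable lborel (\<lambda>x::real. inverse (1 + x\<^sup>2))"
    using integrable_inverse_1_plus_square by (simp add: set_integrable_def einterval_def)
  then have i: "integrable half (\<lambda>x. 128 * (1 + gauss_mass) * inverse (1 + x\<^sup>2))"
    by (intro integrable_mult_right integrable_half)
  have "integrable half (\<lambda>z. (Hinv_envelope z)\<^sup>2)"
  proof (rule Bochner_Integration.integrable_bound[OF i])
    show "(\<lambda>z. (Hinv_envelope z)\<^sup>2) \<in> borel_measurable half"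
      unfolding Hinv_envelope_def by (intro borel_measurable_half) measurable
    show "AE z in half. norm ((Hinv_envelope z)\<^sup>2) \<le> norm (128 * (1 + gauss_mass) * inverse (1 + z\<^sup>2))"
    proof (rule AE_I2)
      fix z :: real
      have p: "0 < 8 + z\<^sup>2" "0 < 1 + z\<^sup>2" by (simp_all add: add_pos_nonneg)
      have "\<bar>z\<bar> \<le> 8 + z\<^sup>2"
        using sum_squares_bound[of "\<bar>z\<bar>" 1] by simp
      moreover have "gauss_mass \<le> gauss_mass * (8 + z\<^sup>2)" using gauss_mass_nonneg by (simp add: mult_le_cancel_left1)
      ultimately have le: "\<bar>z\<bar> + gauss_mass \<le> (1 + gauss_mass) * (8 + z\<^sup>2)" by (simp add: distrib_right)
      have "(Hinv_envelope z)\<^sup>2 = 128 * (\<bar>z\<bar> + gauss_mass) / (8 + z\<^sup>2)\<^sup>2"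
        unfolding Hinv_envelope_def using gauss_mass_nonneg by (simp add: power_mult_distrib power_divide)
      also have "\<dots> \<le> 128 * ((1 + gauss_mass) * (8 + z\<^sup>2)) / (8 + z\<^sup>2)\<^sup>2"
        using le by (intro divide_right_mono) auto
      also have "\<dots> = 128 * (1 + gauss_mass) / (8 + z\<^sup>2)" using p by (simp add: power2_eq_square)
      also have "\<dots> \<le> 128 * (1 + gauss_mass) / (1 + z\<^sup>2)" using p gauss_mass_nonneg by (intro divide_left_mono) auto
      finally show "norm ((Hinv_envelope z)\<^sup>2) \<le> norm (128 * (1 + gauss_mass) * inverse (1 + z\<^sup>2))"
        using p gauss_mass_nonneg by (simp add: divide_inverse)
    qed
  qed
  then show ?thesis
    unfolding L2_def by (auto simp: Hinv_envelope_def[abs_def] intro!: borel_measurable_half)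
qed

lemma Hinv_measurable: assumes f: "f \<in> L2 half" shows "Hinv f \<in> borel_measurable half"
proof -
  have [measurable]: "f \<in> borel_measurable half" using f by (rule L2_measurable)
  have [measurable]: "gauss \<in> borel_measurable half" by (intro borel_measurable_half) simp
  show ?thesis unfolding Hinv_def[abs_def] Hinv_num_def by measurable
qed

lemma Hinv_L2: assumes f: "f \<in> L2 half" shows "Hinv f \<in> L2 half"
proof (rule L2_bound[OF Hinv_envelope_L2 Hinv_measurable[OF f], where C = "L2_norm half f"])
  show "AE z in half. \<bar>Hinv f z\<bar> \<le> L2_norm half f * \<bar>Hinv_envelope z\<bar>"
    using Hinv_bound(1)[OF f] gauss_mass_nonneg
    by (intro AE_I2) (simp add: mult.commute Hinv_envelope_def add_nonneg_nonneg abs_mult)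
qed

lemma Hinv_norm: assumes f: "f \<in> L2 half" shows "L2_norm half (Hinv f) \<le> L2_norm half Hinv_envelope * L2_norm half f"
proof -
  have "(\<integral>z. (Hinv f z)\<^sup>2 \<partial>half) \<le> (\<integral>z. (Hinv_envelope z * L2_norm half f)\<^sup>2 \<partial>half)"
  proof (rule integral_mono)
    show "(Hinv f z)\<^sup>2 \<le> (Hinv_envelope z * L2_norm half f)\<^sup>2" if "z \<in> space half" for z
      using Hinv_bound(1)[OF f, of z] that by (simp only: abs_le_square_iff[symmetric]) simp
    show "integrable half (\<lambda>z. (Hinv_envelope z * L2_norm half f)\<^sup>2)"
      using L2_square_integrable[OF Hinv_envelope_L2] by (simp add: power_mult_distrib)
  qed (rule L2_square_integrable[OF Hinv_L2[OF f]])
  also have "\<dots> = (\<integral>z. (Hinv_envelope z)\<^sup>2 \<partial>half) * (L2_norm half f)\<^sup>2" by (simp add: power_mult_distrib)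
  finally show ?thesis
    unfolding L2_norm_def[of _ "Hinv f"] L2_norm_def[of _ Hinv_envelope]
    by (metis L2_norm_nonneg real_sqrt_abs real_sqrt_le_mono real_sqrt_mult abs_of_nonneg)
qed

lemma Hinv_linear:
  assumes "f \<in> L2 half" "g \<in> L2 half" "z < 0"
  shows "Hinv (\<lambda>x. f x + g x) z = Hinv f z + Hinv g z" "Hinv (\<lambda>x. c * f x) z = c * Hinv f z"
proof -
  let ?e = "\<lambda>q. 4 * (exp ((max q z)\<^sup>2 / 8) - 1)"
  note i = Hinv_bound(2)[OF assms(1,3)] Hinv_bound(2)[OF assms(2,3)]
  have "Hinv_num (\<lambda>x. f x + g x) z = (\<integral>q. gauss q * f q * ?e q + gauss q * g q * ?e q \<partial>half)"
    unfolding Hinv_num_def by (intro Bochner_Integration.integral_cong) (auto simp: algebra_simps)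
  also have "\<dots> = Hinv_num f z + Hinv_num g z" unfolding Hinv_num_def by (rule Bochner_Integration.integral_add[OF i])
  finally show "Hinv (\<lambda>x. f x + g x) z = Hinv f z + Hinv g z"
    by (simp add: Hinv_def diff_divide_distrib)
  have "Hinv_num (\<lambda>x. c * f x) z = (\<integral>q. c * (gauss q * f q * ?e q) \<partial>half)"
    unfolding Hinv_num_def by (intro Bochner_Integration.integral_cong) (auto simp: algebra_simps)
  then show "Hinv (\<lambda>x. c * f x) z = c * Hinv f z" by (simp add: Hinv_def Hinv_num_def)
qed

lemma Hinv_cong_AE:
  assumes "f \<in> L2 half" "g \<in> L2 half" "AE x in half. f x = g x"
  shows "Hinv f = Hinv g"
proof -
  have [measurable]: "f \<in> borel_measurable half" "g \<in> borel_measurable half" "gauss \<in> borel_measurable half"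
    using assms L2_measurable borel_measurable_half by auto
  have "Hinv_num f z = Hinv_num g z" for z
    unfolding Hinv_num_def by (rule integral_cong_AE) (use assms(3) in auto)
  then show ?thesis by (simp add: Hinv_def fun_eq_iff)
qed

section \<open>Energy and duality\<close>

lemma Hinv_num_has_integral:
  assumes f: "f \<in> L2 half" and a: "a \<le> 0"
  shows "((\<lambda>z. z * exp (z\<^sup>2 / 8) * gauss_tail f z) has_integral - Hinv_num f a) {a..0}"
proof -
  have "((\<lambda>z. z * exp (z\<^sup>2 / 8) * gauss_tail f z) has_integral
      (\<integral>q. indicator {..<0} q * (gauss q * f q * (4 * exp (0\<^sup>2 / 8) - 4 * exp ((max q a)\<^sup>2 / 8))) \<partial>half)) {a..0}"
    unfolding gauss_tail_def
    by (rule tail_integration_by_parts[OF gauss_f_integrable[OF f] a, where \<phi> = "\<lambda>x. 4 * exp (x\<^sup>2 / 8)"])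
      (auto intro!: derivative_eq_intros continuous_intros)
  moreover have "(\<integral>q. indicator {..<0} q * (gauss q * f q * (4 * exp (0\<^sup>2 / 8) - 4 * exp ((max q a)\<^sup>2 / 8))) \<partial>half)
      = (\<integral>q. - (gauss q * f q * (4 * (exp ((max q a)\<^sup>2 / 8) - 1))) \<partial>half)"
    by (rule Bochner_Integration.integral_cong) (auto simp: algebra_simps)
  ultimately show ?thesis by (simp add: Hinv_num_def)
qed

text \<open>Fubini gives the integral of the claimed derivative from y to 0 as -
  \<open>Hinv_num f y\<close>, so the fundamental theorem applies. The one-sided form includes the
  endpoint 0, which yields continuity there.\<close>

lemma Hinv_num_deriv:
  assumes f: "f \<in> L2 half" and x: "x \<le> 0"
  shows "(Hinv_num f has_real_derivative x * exp (x\<^sup>2 / 8) * gauss_tail f x) (at x within {..0})"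
proof -
  define a where "a = x - 1"
  let ?h = "\<lambda>z. z * exp (z\<^sup>2 / 8) * gauss_tail f z"
  have hc: "continuous_on {a..0} ?h"
    by (intro continuous_at_imp_continuous_on ballI continuous_intros gauss_tail_continuous f) simp
  have "Hinv_num f y = integral {a..y} ?h - integral {a..0} ?h" if "y \<in> {a..0}" for y
  proof -
    have "integral {a..y} ?h + integral {y..0} ?h = integral {a..0} ?h"
      using that by (intro Henstock_Kurzweil_Integration.integral_combine integrable_continuous_real hc) auto
    moreover have "integral {y..0} ?h = - Hinv_num f y"
      using Hinv_num_has_integral[OF f, of y] that by (auto simp: integral_unique)
    ultimately show ?thesis by simp
  qed
  moreover have "((\<lambda>y. integral {a..y} ?h - integral {a..0} ?h) has_real_derivative ?h x - 0) (at x within {a..0})"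
    by (intro DERIV_diff integral_has_real_derivative hc DERIV_const) (use x in \<open>auto simp: a_def\<close>)
  ultimately have "(Hinv_num f has_real_derivative ?h x) (at x within {a..0})"
    using x by (subst has_field_derivative_cong_eventually[where g = "\<lambda>y. integral {a..y} ?h - integral {a..0} ?h"])
      (auto simp: eventually_at_filter a_def)
  moreover have "at x within {a..0} = at x within {..0}"
    by (rule at_within_nhd[of _ "{a<..}"]) (auto simp: a_def)
  ultimately show ?thesis by simp
qed

lemma Hinv_num_0: "Hinv_num f 0 = 0"
proof -
  have "Hinv_num f 0 = (\<integral>q. 0 \<partial>half)"
    unfolding Hinv_num_def by (rule Bochner_Integration.integral_cong) auto
  then show ?thesis by simp
qed

lemma Hinv_num_deriv_at:
  assumes f: "f \<in> L2 half" and x: "x < 0"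
  shows "(Hinv_num f has_real_derivative x * exp (x\<^sup>2 / 8) * gauss_tail f x) (at x)"
proof -
  have "at x within {..0} = at x"
    by (rule at_within_interior) (use x interior_maximal[of "{..<0}" "{..0}"] in auto)
  then show ?thesis using Hinv_num_deriv[OF f, of x] x by simp
qed

text \<open>The once integrated equation z v' + 2 v = - exp(z^2/8) \<open>gauss_tail f z\<close>,
  solved for v'. In this form it needs no differentiability of the tail and is visibly continuous on
  the open half-line.\<close>

definition Hinv_deriv :: "(real \<Rightarrow> real) \<Rightarrow> real \<Rightarrow> real" where
  "Hinv_deriv f z = (- exp (z\<^sup>2 / 8) * gauss_tail f z - 2 * Hinv f z) / z"

lemma Hinv_deriv:
  assumes f: "f \<in> L2 half" and z: "z < 0"
  shows "(Hinv f has_real_derivative Hinv_deriv f z) (at z)"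
  unfolding Hinv_def[abs_def]
  by (rule derivative_eq_intros Hinv_num_deriv_at[OF f z] refl)+
    (use z in \<open>simp_all add: Hinv_deriv_def Hinv_def field_simps power2_eq_square power4_eq_xxxx\<close>)

lemma Hinv_deriv_eq: "z \<noteq> 0 \<Longrightarrow> z * Hinv_deriv f z + 2 * Hinv f z = - exp (z\<^sup>2 / 8) * gauss_tail f z"
  by (simp add: Hinv_deriv_def)

lemma Hinv_isCont: "f \<in> L2 half \<Longrightarrow> z < 0 \<Longrightarrow> isCont (Hinv f) z"
  by (rule DERIV_isCont[OF Hinv_deriv])

lemma Hinv_deriv_isCont: "f \<in> L2 half \<Longrightarrow> z < 0 \<Longrightarrow> isCont (Hinv_deriv f) z"
  unfolding Hinv_deriv_def[abs_def] by (intro continuous_intros gauss_tail_continuous Hinv_isCont) auto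

lemma gauss_tail_tendsto_0: "f \<in> L2 half \<Longrightarrow> ((\<lambda>z. exp (z\<^sup>2 / 8) * gauss_tail f z) \<longlongrightarrow> - kap f) (at_left 0)"
proof -
  assume f: "f \<in> L2 half"
  have "isCont (\<lambda>z. exp (z\<^sup>2 / 8) * gauss_tail f z) 0"
    by (intro continuous_intros gauss_tail_continuous f) simp
  then have "((\<lambda>z. exp (z\<^sup>2 / 8) * gauss_tail f z) \<longlongrightarrow> exp (0\<^sup>2 / 8) * gauss_tail f 0) (at_left 0)"
    unfolding isCont_def by (rule tendsto_within_subset[of _ _ _ UNIV]) simp
  then show ?thesis by (simp add: gauss_tail_0)
qed

lemma Hinv_num_tendsto_0: assumes f: "f \<in> L2 half" shows "(Hinv_num f \<longlongrightarrow> 0) (at_left 0)"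
proof -
  have "continuous (at 0 within {..0}) (Hinv_num f)"
    using Hinv_num_deriv[OF f, of 0] DERIV_continuous by fastforce
  then have "(Hinv_num f \<longlongrightarrow> Hinv_num f 0) (at 0 within {..0})" by (simp add: continuous_within)
  then have "(Hinv_num f \<longlongrightarrow> Hinv_num f 0) (at_left 0)" by (rule tendsto_within_subset) auto
  then show ?thesis by (simp add: Hinv_num_0)
qed

text \<open>L'Hopital's rule for \<open>Hinv_num\<close> over z^2. This shows that elements of the
  domain have a trace at 0, and that the trace is half of \<open>kap f\<close>.\<close>

lemma Hinv_tendsto_0: assumes f: "f \<in> L2 half" shows "(Hinv f \<longlongrightarrow> kap f / 2) (at_left 0)"
proof -
  have "((\<lambda>z. Hinv_num f z / z\<^sup>2) \<longlongrightarrow> - kap f / 2) (at_left 0)"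
  proof (rule lhopital_left[where f' = "\<lambda>z. z * exp (z\<^sup>2 / 8) * gauss_tail f z" and g' = "\<lambda>z. 2 * z"])
    have neg: "\<forall>\<^sub>F z in at_left (0::real). z < 0" by (simp add: eventually_at_filter)
    show "(Hinv_num f \<longlongrightarrow> 0) (at_left 0)" by (rule Hinv_num_tendsto_0[OF f])
    show "((\<lambda>z::real. z\<^sup>2) \<longlongrightarrow> 0) (at_left 0)" by (auto intro!: tendsto_eq_intros)
    show "\<forall>\<^sub>F z in at_left (0::real). z\<^sup>2 \<noteq> 0" "\<forall>\<^sub>F z in at_left (0::real). 2 * z \<noteq> 0"
      using neg by (eventually_elim; simp)+
    show "\<forall>\<^sub>F z in at_left 0. (Hinv_num f has_real_derivative z * exp (z\<^sup>2 / 8) * gauss_tail f z) (at z)"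
      using neg by eventually_elim (rule Hinv_num_deriv_at[OF f])
    show "\<forall>\<^sub>F z in at_left (0::real). ((\<lambda>z. z\<^sup>2) has_real_derivative 2 * z) (at z)"
      by (intro always_eventually allI) (auto intro!: derivative_eq_intros)
    have "((\<lambda>z. (exp (z\<^sup>2 / 8) * gauss_tail f z) / 2) \<longlongrightarrow> - kap f / 2) (at_left 0)"
      by (intro tendsto_intros gauss_tail_tendsto_0 f) simp
    then show "((\<lambda>z. z * exp (z\<^sup>2 / 8) * gauss_tail f z / (2 * z)) \<longlongrightarrow> - kap f / 2) (at_left 0)"
      by (rule Lim_transform_eventually) (use neg in \<open>eventually_elim, simp\<close>)
  qed
  from tendsto_minus[OF this] show ?thesis by (simp add: Hinv_def[abs_def])
qed

subsection \<open>Exhausting the half-line\<close>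

lemma AE_half_neq: "AE q in half. q \<noteq> c"
proof -
  have "AE q in lebesgue. q \<noteq> c" by (rule AE_completion[OF AE_lborel_singleton])
  then show ?thesis by (subst AE_restrict_space_iff) auto
qed

lemma integral_half_interval:
  fixes g :: "real \<Rightarrow> real"
  assumes "b < 0" "continuous_on {a..b} g"
  shows "integral {a..b} g = (\<integral>q. indicator {a..<b} q * g q \<partial>half)"
proof -
  have i: "set_integrable lborel {a..b} g"
    unfolding set_integrable_def by (intro borel_integrable_compact assms) simp
  then have m: "(\<lambda>q. indicator {a..b} q * g q) \<in> borel_measurable borel"
    by (auto simp: set_integrable_def)
  have "integral {a..b} g = (\<integral>q. indicator {a..b} q * g q \<partial>lborel)"
    using set_borel_integral_eq_integral[OF i] by (simp add: set_lebesgue_integral_def)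
  also have "\<dots> = (\<integral>q. indicator {..<0} q * (indicator {a..b} q * g q) \<partial>lborel)"
    by (rule Bochner_Integration.integral_cong) (use assms(1) in \<open>auto simp: indicator_def\<close>)
  also have "\<dots> = (\<integral>q. indicator {a..b} q * g q \<partial>half)" by (rule integral_half_eq[OF m, symmetric])
  also have "\<dots> = (\<integral>q. indicator {a..<b} q * g q \<partial>half)"
  proof (rule integral_cong_AE)
    show "(\<lambda>q. indicator {a..b} q * g q) \<in> borel_measurable half" by (rule borel_measurable_half[OF m])
    have "(\<lambda>q. indicator {a..<b} q * (indicator {a..b} q * g q)) \<in> borel_measurable borel"
      by (intro borel_measurable_times m) auto
    moreover have "(\<lambda>q. indicator {a..<b} q * (indicator {a..b} q * g q)) = (\<lambda>q. indicator {a..<b} q * g q)"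
      by (auto simp: indicator_def)
    ultimately show "(\<lambda>q. indicator {a..<b} q * g q) \<in> borel_measurable half"
      by (simp add: borel_measurable_half)
    show "AE q in half. indicator {a..b} q * g q = indicator {a..<b} q * g q"
      using AE_half_neq[of b] by eventually_elim (auto simp: indicator_def)
  qed
  finally show ?thesis .
qed

text \<open>Endpoints of intervals exhausting the open half-line. The shift by 2 gives an \<le> -2
  and bn \<ge> -1/2, hence proper intervals from the start.\<close>

definition an :: "nat \<Rightarrow> real" where "an n = - real (n + 2)"
definition bn :: "nat \<Rightarrow> real" where "bn n = - inverse (real (n + 2))"

lemma an_bn: "an n < bn n" "bn n < 0" "an n < 0"
proof -
  have "inverse (real (n + 2)) < 1" by (subst inverse_less_1_iff) auto
  then show "an n < bn n" by (simp add: an_def bn_def)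
qed (simp_all add: an_def bn_def)

lemma an_lim: "filterlim an at_bot sequentially"
  unfolding an_def[abs_def] by real_asymp

lemma bn_lim: "filterlim bn (at_left 0) sequentially"
  unfolding bn_def[abs_def] by real_asymp

lemma half_exhaust:
  fixes g :: "real \<Rightarrow> real"
  assumes g: "integrable half g"
  shows "(\<lambda>n. \<integral>q. indicator {an n..<bn n} q * g q \<partial>half) \<longlonglongrightarrow> integral\<^sup>L half g"
proof (rule integral_dominated_convergence[where w = "\<lambda>q. \<bar>g q\<bar>"])
  show "AE q in half. (\<lambda>n. indicator {an n..<bn n} q * g q) \<longlonglongrightarrow> g q"
  proof (rule AE_I2)
    fix q assume "q \<in> space half"
    then have q: "q < 0" by simp
    have "\<forall>\<^sub>F n in sequentially. an n \<le> q" using an_lim by (simp add: filterlim_at_bot)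
    moreover have "\<forall>\<^sub>F n in sequentially. q < bn n"
    proof -
      have "\<forall>\<^sub>F z in at_left 0. q < z" using q by (auto simp: eventually_at_left_field)
      then show ?thesis using bn_lim by (auto simp: filterlim_iff)
    qed
    ultimately have "\<forall>\<^sub>F n in sequentially. indicator {an n..<bn n} q * g q = g q"
      by eventually_elim simp
    then show "(\<lambda>n. indicator {an n..<bn n} q * g q) \<longlonglongrightarrow> g q" by (rule tendsto_eventually)
  qed
qed (use g borel_measurable_half in \<open>auto simp: indicator_def\<close>)

subsection \<open>Energy estimate\<close>

text \<open>The envelope makes z^2 times the square of \<open>Hinv f\<close> of order 1/|z|. The
  other two limits follow on dividing by z.\<close>

lemma Hinv_tendsto_bot:
  assumes f: "f \<in> L2 half"
  shows "((\<lambda>z. z * (Hinv f z)\<^sup>2) \<longlongrightarrow> 0) at_bot" "((\<lambda>z. z\<^sup>2 * (Hinv f z)\<^sup>2) \<longlongrightarrow> 0) at_bot"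
    "(Hinv f \<longlongrightarrow> 0) at_bot"
proof -
  let ?n = "L2_norm half f"
  have neg: "\<forall>\<^sub>F z in at_bot. z < (0::real)" by (rule eventually_gt_at_bot)
  have b: "(Hinv f z)\<^sup>2 \<le> (Hinv_envelope z)\<^sup>2 * ?n\<^sup>2" if "z < 0" for z
  proof -
    have "\<bar>Hinv f z\<bar>\<^sup>2 \<le> (Hinv_envelope z * ?n)\<^sup>2" using Hinv_bound(1)[OF f that] by (intro power_mono) auto
    then show ?thesis by (simp add: power_mult_distrib)
  qed
  have B2: "((\<lambda>z. z\<^sup>2 * (Hinv_envelope z)\<^sup>2) \<longlongrightarrow> 0) at_bot"
    unfolding Hinv_envelope_def using gauss_mass_nonneg by real_asymp
  show 2: "((\<lambda>z. z\<^sup>2 * (Hinv f z)\<^sup>2) \<longlongrightarrow> 0) at_bot"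
  proof (rule tendsto_sandwich[OF _ _ tendsto_const])
    show "((\<lambda>z. z\<^sup>2 * (Hinv_envelope z)\<^sup>2 * ?n\<^sup>2) \<longlongrightarrow> 0) at_bot" using tendsto_mult_left_zero[OF B2] .
    show "\<forall>\<^sub>F z in at_bot. z\<^sup>2 * (Hinv f z)\<^sup>2 \<le> z\<^sup>2 * (Hinv_envelope z)\<^sup>2 * ?n\<^sup>2"
      using neg by eventually_elim (simp add: b mult_left_mono mult.assoc)
  qed simp
  have i: "((\<lambda>z::real. inverse z) \<longlongrightarrow> 0) at_bot" by real_asymp
  show 1: "((\<lambda>z. z * (Hinv f z)\<^sup>2) \<longlongrightarrow> 0) at_bot"
    using tendsto_mult_zero[OF i 2]
    by (rule Lim_transform_eventually) (use neg in \<open>eventually_elim, simp add: power2_eq_square\<close>)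
  have "((\<lambda>z. (Hinv f z)\<^sup>2) \<longlongrightarrow> 0) at_bot"
    using tendsto_mult_zero[OF i 1]
    by (rule Lim_transform_eventually) (use neg in \<open>eventually_elim, simp\<close>)
  from tendsto_real_sqrt[OF this] have "((\<lambda>z. \<bar>Hinv f z\<bar>) \<longlongrightarrow> 0) at_bot" by simp
  then show "(Hinv f \<longlongrightarrow> 0) at_bot" by (rule tendsto_rabs_zero_cancel)
qed

text \<open>Integration by parts against the tail expresses the integral of v f through that of
  \<phi>' P. The equation for v' turns \<phi>' P into a quadratic form in v and v', which is an
  exact derivative plus - z (v' - v/2)^2 and v^2/2; the square term has a sign because z <
  0.\<close>

lemma Hinv_energy_interval:
  assumes f: "f \<in> L2 half" and ab: "a < b" "b < 0"
  defines "Q \<equiv> \<lambda>z. Hinv f z * (exp (z\<^sup>2 / 8) * gauss_tail f z) + (Hinv f z)\<^sup>2 + z\<^sup>2 * (Hinv f z)\<^sup>2 / 8 + z * (Hinv f z)\<^sup>2 / 2"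
  shows "(\<integral>q. indicator {a..<b} q * (Hinv f q * f q + (Hinv f q)\<^sup>2 / 2) \<partial>half) \<le> Q b - Q a"
proof -
  let ?v = "Hinv f" and ?w = "Hinv_deriv f" and ?P = "gauss_tail f"
  \<comment> \<open>The factor exp(z^2/8) cancels the weight in the tail, so that gauss q \<phi> q =
    v q and integration by parts produces the pairing of v with f.\<close>
  define \<phi> where "\<phi> z = ?v z * exp (z\<^sup>2 / 8)" for z
  define \<phi>' where "\<phi>' z = (?w z + z * ?v z / 4) * exp (z\<^sup>2 / 8)" for z
  have \<phi>d: "(\<phi> has_real_derivative \<phi>' x) (at x)" if "x < 0" for x
    unfolding \<phi>_def[abs_def] \<phi>'_def
    by (auto intro!: derivative_eq_intros Hinv_deriv[OF f that] simp: algebra_simps)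
  have \<phi>c: "isCont \<phi>' x" if "x < 0" for x
    unfolding \<phi>'_def[abs_def] by (intro continuous_intros Hinv_isCont Hinv_deriv_isCont f that) simp_all
  have fi: "integrable half (\<lambda>q. indicator {a..<b} q * (?v q * f q))"
    by (rule half_indicator_integrable[OF L2_mult_integrable[OF Hinv_L2[OF f] f]]) simp
  have vi: "integrable half (\<lambda>q. indicator {a..<b} q * (?v q)\<^sup>2)"
    by (rule half_indicator_integrable[OF L2_square_integrable[OF Hinv_L2[OF f]]]) simp
  have xi: "integrable half (\<lambda>q. indicator {..<c} q * (gauss q * f q))" if "c < 0" for c
    by (rule half_indicator_integrable[OF gauss_f_integrable[OF f]]) simp
  have "((\<lambda>z. \<phi>' z * ?P z) has_integral
      (\<integral>q. indicator {..<b} q * (gauss q * f q * (\<phi> b - \<phi> (max q a))) \<partial>half)) {a..b}"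
    unfolding gauss_tail_def
    by (rule tail_integration_by_parts[OF gauss_f_integrable[OF f]]) (use ab \<phi>d \<phi>c in auto)
  moreover have "(\<integral>q. indicator {..<b} q * (gauss q * f q * (\<phi> b - \<phi> (max q a))) \<partial>half)
      = \<phi> b * ?P b - \<phi> a * ?P a - (\<integral>q. indicator {a..<b} q * (?v q * f q) \<partial>half)"
  proof -
    have "(\<integral>q. indicator {..<b} q * (gauss q * f q * (\<phi> b - \<phi> (max q a))) \<partial>half)
        = (\<integral>q. \<phi> b * (indicator {..<b} q * (gauss q * f q)) - \<phi> a * (indicator {..<a} q * (gauss q * f q))
            - indicator {a..<b} q * (?v q * f q) \<partial>half)"
    proof (rule Bochner_Integration.integral_cong)
      fix q
      have "gauss q * f q * \<phi> q = ?v q * f q" using gauss_exp[of q] by (simp add: \<phi>_def)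
      then show "indicator {..<b} q * (gauss q * f q * (\<phi> b - \<phi> (max q a)))
        = \<phi> b * (indicator {..<b} q * (gauss q * f q)) - \<phi> a * (indicator {..<a} q * (gauss q * f q))
            - indicator {a..<b} q * (?v q * f q)"
        using ab by (auto simp: indicator_def max_def algebra_simps)
    qed simp
    then show ?thesis using xi[of a] xi[of b] fi ab by (simp add: gauss_tail_def)
  qed
  ultimately have I1: "((\<lambda>z. \<phi>' z * ?P z) has_integral
      \<phi> b * ?P b - \<phi> a * ?P a - (\<integral>q. indicator {a..<b} q * (?v q * f q) \<partial>half)) {a..b}" by simp
  \<comment> \<open>For a shift c in (v' - c v)^2 the leftover multiple of z v^2 is 1/4 - c^2 once c
    z v^2 is put into R. It vanishes for c = 1/2, and differentiating that term leaves the
    dissipation v^2/2.\<close>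
  define R where "R z = (?v z)\<^sup>2 + z\<^sup>2 * (?v z)\<^sup>2 / 8 + z * (?v z)\<^sup>2 / 2" for z
  have Rd: "(R has_real_derivative
      - (\<phi>' z * ?P z) - z * (?w z - ?v z / 2)\<^sup>2 + (?v z)\<^sup>2 / 2) (at z)" if "z < 0" for z
  proof -
    have D: "(R has_real_derivative 2 * ?v z * ?w z + (z * (?v z)\<^sup>2 / 4 + z\<^sup>2 * ?v z * ?w z / 4)
        + ((?v z)\<^sup>2 / 2 + z * ?v z * ?w z)) (at z)"
      unfolding R_def[abs_def]
      by (auto intro!: derivative_eq_intros Hinv_deriv[OF f that] simp: field_simps power2_eq_square)
    have P: "\<phi>' z * ?P z = - ((?w z + z * ?v z / 4) * (z * ?w z + 2 * ?v z))"
      using Hinv_deriv_eq[of z f] that by (simp add: \<phi>'_def)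
    show ?thesis unfolding P by (rule DERIV_cong[OF D]) (simp add: field_simps power2_eq_square)
  qed
  have "((\<lambda>z. - (\<phi>' z * ?P z) - z * (?w z - ?v z / 2)\<^sup>2 + (?v z)\<^sup>2 / 2) has_integral R b - R a) {a..b}"
    using ab Rd by (intro fundamental_theorem_of_calculus)
      (auto simp: has_real_derivative_iff_has_vector_derivative[symmetric] intro: has_field_derivative_at_within)
  from has_integral_add[OF this I1]
  have I2: "((\<lambda>z. (?v z)\<^sup>2 / 2 - z * (?w z - ?v z / 2)\<^sup>2) has_integral
     (R b - R a) + (\<phi> b * ?P b - \<phi> a * ?P a - (\<integral>q. indicator {a..<b} q * (?v q * f q) \<partial>half))) {a..b}"
    by (simp add: algebra_simps)
  have vc: "continuous_on {a..b} (\<lambda>z. (?v z)\<^sup>2 / 2)"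
    using ab by (intro continuous_at_imp_continuous_on ballI continuous_intros Hinv_isCont f) auto
  have "integral {a..b} (\<lambda>z. (?v z)\<^sup>2 / 2) \<le> integral {a..b} (\<lambda>z. (?v z)\<^sup>2 / 2 - z * (?w z - ?v z / 2)\<^sup>2)"
  proof (rule integral_le)
    show "(\<lambda>z. (?v z)\<^sup>2 / 2) integrable_on {a..b}" by (rule integrable_continuous_real[OF vc])
    show "(\<lambda>z. (?v z)\<^sup>2 / 2 - z * (?w z - ?v z / 2)\<^sup>2) integrable_on {a..b}" using I2 by (auto simp: integrable_on_def)
    show "(?v z)\<^sup>2 / 2 \<le> (?v z)\<^sup>2 / 2 - z * (?w z - ?v z / 2)\<^sup>2" if "z \<in> {a..b}" for z
      using that ab by (simp add: mult_nonpos_nonneg)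
  qed
  also have "\<dots> = (R b - R a) + (\<phi> b * ?P b - \<phi> a * ?P a - (\<integral>q. indicator {a..<b} q * (?v q * f q) \<partial>half))"
    using I2 by (rule integral_unique)
  finally have "integral {a..b} (\<lambda>z. (?v z)\<^sup>2 / 2) + (\<integral>q. indicator {a..<b} q * (?v q * f q) \<partial>half) \<le> Q b - Q a"
    by (simp add: Q_def R_def \<phi>_def algebra_simps)
  moreover have "integral {a..b} (\<lambda>z. (?v z)\<^sup>2 / 2) = (\<integral>q. indicator {a..<b} q * ((?v q)\<^sup>2 / 2) \<partial>half)"
    by (rule integral_half_interval[OF ab(2) vc])
  moreover have "(\<integral>q. indicator {a..<b} q * (?v q * f q + (?v q)\<^sup>2 / 2) \<partial>half)
      = (\<integral>q. indicator {a..<b} q * (?v q * f q) + indicator {a..<b} q * (?v q)\<^sup>2 / 2 \<partial>half)"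
    by (simp add: distrib_left)
  ultimately show ?thesis using fi vi by simp
qed

text \<open>The boundary terms vanish at minus infinity. At 0 they tend to - k^2/2 + k^2/4 = - k^2/4
  with k = \<open>kap f\<close>, which is minus the square of the trace and has the favourable
  sign.\<close>

lemma Hinv_energy:
  assumes f: "f \<in> L2 half"
  shows "(\<integral>q. Hinv f q * f q \<partial>half) \<le> - (1/2) * (\<integral>q. (Hinv f q)\<^sup>2 \<partial>half)"
proof -
  define Q where "Q z = Hinv f z * (exp (z\<^sup>2 / 8) * gauss_tail f z) + (Hinv f z)\<^sup>2 + z\<^sup>2 * (Hinv f z)\<^sup>2 / 8 + z * (Hinv f z)\<^sup>2 / 2" for z
  have 0: "(Q \<longlongrightarrow> kap f / 2 * (- kap f) + (kap f / 2)\<^sup>2 + 0\<^sup>2 * (kap f / 2)\<^sup>2 / 8 + 0 * (kap f / 2)\<^sup>2 / 2) (at_left 0)"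
    unfolding Q_def[abs_def] by (intro tendsto_intros Hinv_tendsto_0 gauss_tail_tendsto_0 f) simp_all
  have "((\<lambda>z. Hinv f z * (exp (z\<^sup>2 / 8) * gauss_tail f z)) \<longlongrightarrow> 0) at_bot"
  proof (rule Lim_null_comparison)
    show "((\<lambda>z. \<bar>Hinv f z\<bar> * (sqrt gauss_mass * L2_norm half f)) \<longlongrightarrow> 0) at_bot"
      by (intro tendsto_mult_left_zero tendsto_rabs_zero Hinv_tendsto_bot f)
    show "\<forall>\<^sub>F z in at_bot. norm (Hinv f z * (exp (z\<^sup>2 / 8) * gauss_tail f z)) \<le> \<bar>Hinv f z\<bar> * (sqrt gauss_mass * L2_norm half f)"
      using eventually_gt_at_bot[of 0]
      by eventually_elim (use gauss_tail_bound[OF f] in \<open>auto simp: abs_mult intro!: mult_left_mono\<close>)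
  qed
  then have "(Q \<longlongrightarrow> 0 + 0\<^sup>2 + 0 / 8 + 0 / 2) at_bot"
    unfolding Q_def[abs_def] by (intro tendsto_intros Hinv_tendsto_bot f) simp_all
  then have Qa: "(\<lambda>n. Q (an n)) \<longlonglongrightarrow> 0" using filterlim_compose[OF _ an_lim] by simp
  have Qb: "(\<lambda>n. Q (bn n)) \<longlonglongrightarrow> - (kap f)\<^sup>2 / 4"
    using filterlim_compose[OF 0 bn_lim] by (simp add: power2_eq_square field_simps)
  have int: "integrable half (\<lambda>q. Hinv f q * f q)" "integrable half (\<lambda>q. (Hinv f q)\<^sup>2)"
    using L2_mult_integrable[OF Hinv_L2[OF f] f] L2_square_integrable[OF Hinv_L2[OF f]] by auto
  have "(\<integral>q. Hinv f q * f q + (Hinv f q)\<^sup>2 / 2 \<partial>half) \<le> - (kap f)\<^sup>2 / 4 - 0"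
  proof (rule LIMSEQ_le)
    show "(\<lambda>n. \<integral>q. indicator {an n..<bn n} q * (Hinv f q * f q + (Hinv f q)\<^sup>2 / 2) \<partial>half)
        \<longlonglongrightarrow> (\<integral>q. Hinv f q * f q + (Hinv f q)\<^sup>2 / 2 \<partial>half)"
      using int by (intro half_exhaust) simp
    show "(\<lambda>n. Q (bn n) - Q (an n)) \<longlonglongrightarrow> - (kap f)\<^sup>2 / 4 - 0" by (intro tendsto_intros Qa Qb)
    show "\<exists>N. \<forall>n\<ge>N. (\<integral>q. indicator {an n..<bn n} q * (Hinv f q * f q + (Hinv f q)\<^sup>2 / 2) \<partial>half) \<le> Q (bn n) - Q (an n)"
      unfolding Q_def using Hinv_energy_interval[OF f an_bn(1,2)] by auto
  qed
  moreover have "(\<integral>q. Hinv f q * f q + (Hinv f q)\<^sup>2 / 2 \<partial>half) = (\<integral>q. Hinv f q * f q \<partial>half) + 1/2 * (\<integral>q. (Hinv f q)\<^sup>2 \<partial>half)"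
    using int by simp
  moreover have "0 \<le> (kap f)\<^sup>2" by simp
  ultimately show ?thesis by linarith
qed

subsection \<open>Duality\<close>

text \<open>The flux - z v' - 2 v + z^2 v/4 of v = \<open>Hinv f\<close>, whose derivative is
  formally f. \<open>Psi_eq\<close> is the integrated version, with value - \<open>kap f\<close> at
  0.\<close>

definition Psi :: "(real \<Rightarrow> real) \<Rightarrow> real \<Rightarrow> real" where
  "Psi f z = exp (z\<^sup>2 / 8) * gauss_tail f z - Hinv_num f z / 4"

lemma indicator_f_integrable:
  assumes f: "f \<in> L2 half" shows "integrable half (\<lambda>q. indicator {a..} q * f q)"
proof -
  have "integrable lborel (indicator {a..<0} :: real \<Rightarrow> real)"
    by (intro integrable_real_indicator) (cases "a \<le> 0"; simp)+
  then have "(indicator {a..<0} :: real \<Rightarrow> real) \<in> L2 half"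
    by (auto simp: L2_def power2_eq_square indicator_inter_arith[symmetric] intro!: borel_measurable_half integrable_half)
  from L2_mult_integrable[OF this f] show ?thesis
    by (rule Bochner_Integration.integrable_cong[THEN iffD1, rotated -1]) (auto simp: indicator_def)
qed

lemma Psi_eq:
  assumes f: "f \<in> L2 half" and z: "z < 0"
  shows "Psi f z = - kap f - (\<integral>q. indicator {z..} q * f q \<partial>half)"
proof -
  let ?e = "\<lambda>q. gauss q * f q * (4 * (exp ((max q z)\<^sup>2 / 8) - 1))"
  have 1: "integrable half (\<lambda>q. indicator {..<z} q * (gauss q * f q))"
    by (rule half_indicator_integrable[OF gauss_f_integrable[OF f]]) simp
  have "Psi f z = (\<integral>q. exp (z\<^sup>2 / 8) * (indicator {..<z} q * (gauss q * f q)) - ?e q / 4 \<partial>half)"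
    unfolding Psi_def gauss_tail_def Hinv_num_def using 1 Hinv_bound(2)[OF f z] by simp
  also have "\<dots> = (\<integral>q. gauss q * f q - indicator {z..} q * f q \<partial>half)"
  proof (rule Bochner_Integration.integral_cong)
    fix q
    show "exp (z\<^sup>2 / 8) * (indicator {..<z} q * (gauss q * f q)) - ?e q / 4 = gauss q * f q - indicator {z..} q * f q"
    proof -
      have 1: "?e q / 4 = gauss q * f q * exp ((max q z)\<^sup>2 / 8) - gauss q * f q" by (simp add: field_simps)
      have 2: "gauss q * f q * exp (q\<^sup>2 / 8) = f q" using gauss_exp[of q] by simp
      show ?thesis unfolding 1 using 2 by (auto simp: indicator_def max_def)
    qed
  qed simp
  also have "\<dots> = - kap f - (\<integral>q. indicator {z..} q * f q \<partial>half)"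
    using gauss_f_integrable[OF f] indicator_f_integrable[OF f] by (simp add: kap_def)
  finally show ?thesis .
qed

lemma Psi_diff:
  assumes f: "f \<in> L2 half" and ab: "a \<le> z" "z < 0"
  shows "(\<integral>q. indicator {..<z} q * (indicator {a..} q * f q) \<partial>half) = Psi f z - Psi f a"
proof -
  have "(\<integral>q. indicator {..<z} q * (indicator {a..} q * f q) \<partial>half)
      = (\<integral>q. indicator {a..} q * f q - indicator {z..} q * f q \<partial>half)"
    by (rule Bochner_Integration.integral_cong) (use ab in \<open>auto simp: indicator_def\<close>)
  then show ?thesis
    using indicator_f_integrable[OF f] Psi_eq[OF f, of z] Psi_eq[OF f, of a] ab by simp
qed

text \<open>A crude linear growth bound, with square roots replaced by 1 plus their argument. It
  matches the decay of z E z assumed in the duality formula.\<close>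

lemma Psi_bound:
  assumes f: "f \<in> L2 half" and z: "z \<le> -1"
  shows "\<bar>Psi f z\<bar> \<le> (sqrt gauss_mass + 2 * (1 + 2 * (1 + gauss_mass))) * L2_norm half f * \<bar>z\<bar>"
proof -
  let ?n = "L2_norm half f"
  have n: "0 \<le> ?n" by (rule L2_norm_nonneg)
  have s: "sqrt x \<le> 1 + x" if "0 \<le> x" for x
    using that by (intro real_le_lsqrt) (auto simp: power2_eq_square algebra_simps)
  have p: "0 < 8 + z\<^sup>2" by (simp add: add_pos_nonneg)
  have "\<bar>Hinv_num f z\<bar> = z\<^sup>2 * \<bar>Hinv f z\<bar>" using z by (simp add: Hinv_def)
  also have "\<dots> \<le> z\<^sup>2 * (Hinv_envelope z * ?n)" using Hinv_bound(1)[OF f, of z] z by (intro mult_left_mono) auto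
  also have "\<dots> = z\<^sup>2 * 8 / (8 + z\<^sup>2) * sqrt (2 * (\<bar>z\<bar> + gauss_mass)) * ?n" by (simp add: Hinv_envelope_def)
  also have "\<dots> \<le> 8 * sqrt (2 * (\<bar>z\<bar> + gauss_mass)) * ?n"
    using p n gauss_mass_nonneg by (intro mult_right_mono) (auto simp: divide_le_eq)
  also have "\<dots> \<le> 8 * (1 + 2 * (\<bar>z\<bar> + gauss_mass)) * ?n"
    using s[of "2 * (\<bar>z\<bar> + gauss_mass)"] n gauss_mass_nonneg by (intro mult_right_mono mult_left_mono) auto
  also have "\<dots> \<le> 8 * ((1 + 2 * (1 + gauss_mass)) * \<bar>z\<bar>) * ?n"
  proof (intro mult_right_mono mult_left_mono n)
    have "1 + 2 * gauss_mass \<le> (1 + 2 * gauss_mass) * \<bar>z\<bar>" using z gauss_mass_nonneg by (subst mult_le_cancel_left1) auto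
    then show "1 + 2 * (\<bar>z\<bar> + gauss_mass) \<le> (1 + 2 * (1 + gauss_mass)) * \<bar>z\<bar>" by (simp add: algebra_simps)
  qed simp
  also have "8 * (k * a) * m = 4 * (2 * k * m * a)" for k a m :: real by simp
  finally have N: "\<bar>Hinv_num f z\<bar> / 4 \<le> 2 * (1 + 2 * (1 + gauss_mass)) * ?n * \<bar>z\<bar>" by linarith
  have "\<bar>exp (z\<^sup>2 / 8) * gauss_tail f z\<bar> \<le> sqrt gauss_mass * ?n" using gauss_tail_bound[OF f, of z] z by simp
  also have "\<dots> \<le> sqrt gauss_mass * ?n * \<bar>z\<bar>"
    using mult_left_mono[of 1 "\<bar>z\<bar>" "sqrt gauss_mass * ?n"] z n gauss_mass_nonneg by simp
  finally have "\<bar>exp (z\<^sup>2 / 8) * gauss_tail f z\<bar> \<le> sqrt gauss_mass * ?n * \<bar>z\<bar>" .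
  then have "\<bar>Psi f z\<bar> \<le> sqrt gauss_mass * ?n * \<bar>z\<bar> + 2 * (1 + 2 * (1 + gauss_mass)) * ?n * \<bar>z\<bar>"
    using N unfolding Psi_def by linarith
  then show ?thesis by (simp add: algebra_simps)
qed

text \<open>Green's formula for the transpose. E may be nonzero at 0, and the flux contributes the
  boundary value \<open>kap f * E 0\<close>. Test functions make this term vanish, which proves that
  \<open>Hinv\<close> inverts H; the exponential kernel keeps it, and there it becomes the source
  term of a.\<close>

lemma Hinv_duality:
  assumes f: "f \<in> L2 half"
    and d1: "\<And>z. (E has_real_derivative E1 z) (at z)" and d2: "\<And>z. (E1 has_real_derivative E2 z) (at z)"
    and c2: "\<And>z. isCont E2 z"
    and EL: "E \<in> L2 half" and HL: "(\<lambda>z. - z * E2 z + E1 z - z\<^sup>2 / 4 * E1 z) \<in> L2 half"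
    and l: "((\<lambda>z. z * E z) \<longlongrightarrow> 0) at_bot" "((\<lambda>z. z * E1 z) \<longlongrightarrow> 0) at_bot"
  shows "(\<integral>z. Hinv f z * (- z * E2 z + E1 z - z\<^sup>2 / 4 * E1 z) \<partial>half) = (\<integral>z. f z * E z \<partial>half) + kap f * E 0"
proof -
  let ?v = "Hinv f" and ?w = "Hinv_deriv f" and ?P = "gauss_tail f"
  let ?H = "\<lambda>z. - z * E2 z + E1 z - z\<^sup>2 / 4 * E1 z"
  define B where "B z = z * ?v z * E1 z + Psi f z * E z" for z
  have E1c: "isCont E1 z" for z using d2 by (rule DERIV_isCont)
  have Ec: "isCont E z" for z using d1 by (rule DERIV_isCont)
  have fin: "(\<integral>q. indicator {a..<b} q * (?v q * ?H q) \<partial>half)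
      = (\<integral>q. indicator {a..<b} q * (f q * E q) \<partial>half) - (B b - B a)" if ab: "a < b" "b < 0" for a b
  proof -
    have "((\<lambda>z. E1 z * (\<integral>q. indicator {..<z} q * (indicator {a..} q * f q) \<partial>half)) has_integral
       (\<integral>q. indicator {..<b} q * (indicator {a..} q * f q * (E b - E (max q a))) \<partial>half)) {a..b}"
      by (rule tail_integration_by_parts[OF indicator_f_integrable[OF f]]) (use ab d1 E1c in auto)
    moreover have "(\<integral>q. indicator {..<b} q * (indicator {a..} q * f q * (E b - E (max q a))) \<partial>half)
        = E b * (Psi f b - Psi f a) - (\<integral>q. indicator {a..<b} q * (f q * E q) \<partial>half)"
    proof -
      have i1: "integrable half (\<lambda>q. indicator {..<b} q * (indicator {a..} q * f q))"
        by (rule half_indicator_integrable[OF indicator_f_integrable[OF f]]) simp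
      have i2: "integrable half (\<lambda>q. indicator {a..<b} q * (f q * E q))"
        by (rule half_indicator_integrable[OF L2_mult_integrable[OF f EL]]) simp
      have "(\<integral>q. indicator {..<b} q * (indicator {a..} q * f q * (E b - E (max q a))) \<partial>half)
          = (\<integral>q. E b * (indicator {..<b} q * (indicator {a..} q * f q)) - indicator {a..<b} q * (f q * E q) \<partial>half)"
        by (rule Bochner_Integration.integral_cong) (auto simp: indicator_def max_def algebra_simps)
      then show ?thesis using i1 i2 Psi_diff[OF f, of a b] ab by simp
    qed
    ultimately have I1: "((\<lambda>z. E1 z * (Psi f z - Psi f a)) has_integral
        E b * (Psi f b - Psi f a) - (\<integral>q. indicator {a..<b} q * (f q * E q) \<partial>half)) {a..b}"
      using Psi_diff[OF f, of a] ab by (subst has_integral_cong[symmetric]) (auto simp del: mult_cancel_left)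
    have I2: "((\<lambda>z. E1 z) has_integral E b - E a) {a..b}"
      using ab d1 by (intro fundamental_theorem_of_calculus)
        (auto simp: has_real_derivative_iff_has_vector_derivative[symmetric] intro: has_field_derivative_at_within)
    have "((\<lambda>z. z * ?v z * E1 z) has_real_derivative
        - (?v z * ?H z) - E1 z * Psi f z) (at z)" if "z < 0" for z
    proof -
      have D: "((\<lambda>z. z * ?v z * E1 z) has_real_derivative (?v z + z * ?w z) * E1 z + z * ?v z * E2 z) (at z)"
        by (rule derivative_eq_intros Hinv_deriv[OF f that] d2 refl)+ simp
      have P: "Psi f z = - (z * ?w z + 2 * ?v z) + z\<^sup>2 * ?v z / 4"
        using Hinv_deriv_eq[of z f] that by (simp add: Psi_def Hinv_def)
      show ?thesis unfolding P by (rule DERIV_cong[OF D]) (simp add: field_simps power2_eq_square)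
    qed
    then have I3: "((\<lambda>z. - (?v z * ?H z) - E1 z * Psi f z) has_integral b * ?v b * E1 b - a * ?v a * E1 a) {a..b}"
      using ab by (intro fundamental_theorem_of_calculus)
        (auto simp: has_real_derivative_iff_has_vector_derivative[symmetric] intro: has_field_derivative_at_within)
    have "((\<lambda>z. - ((- (?v z * ?H z) - E1 z * Psi f z) + E1 z * (Psi f z - Psi f a) + Psi f a * E1 z)) has_integral
       - ((b * ?v b * E1 b - a * ?v a * E1 a) + (E b * (Psi f b - Psi f a) - (\<integral>q. indicator {a..<b} q * (f q * E q) \<partial>half))
          + Psi f a * (E b - E a))) {a..b}"
      by (intro has_integral_neg has_integral_add I1 I3 has_integral_mult_right I2)
    then have "((\<lambda>z. ?v z * ?H z) has_integral (\<integral>q. indicator {a..<b} q * (f q * E q) \<partial>half) - (B b - B a)) {a..b}"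
      by (simp add: B_def algebra_simps)
    moreover have "continuous_on {a..b} (\<lambda>z. ?v z * ?H z)"
      using ab by (intro continuous_at_imp_continuous_on ballI continuous_intros Hinv_isCont f c2 E1c) auto
    ultimately show ?thesis
      using integral_half_interval[OF ab(2), of a "\<lambda>z. ?v z * ?H z"] by (simp add: integral_unique)
  qed
  \<comment> \<open>As v stays bounded near 0, only the flux survives, with limit -
    \<open>kap f\<close>.\<close>
  have B0: "(B \<longlongrightarrow> 0 * (kap f / 2) * E1 0 + (- kap f - 0 / 4) * E 0) (at_left 0)"
  proof -
    have "(E \<longlongrightarrow> E 0) (at_left 0)" "(E1 \<longlongrightarrow> E1 0) (at_left 0)"
      using Ec[of 0] E1c[of 0] by (auto simp: isCont_def intro: tendsto_within_subset[of _ _ 0 UNIV])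
    then show ?thesis
      unfolding B_def[abs_def] Psi_def by (intro tendsto_intros Hinv_tendsto_0 gauss_tail_tendsto_0 Hinv_num_tendsto_0 f) simp_all
  qed
  have Bbot: "(B \<longlongrightarrow> 0) at_bot"
  proof -
    have 1: "((\<lambda>z. ?v z * (z * E1 z)) \<longlongrightarrow> 0) at_bot"
      by (rule tendsto_mult_zero[OF Hinv_tendsto_bot(3)[OF f] l(2)])
    have 2: "((\<lambda>z. Psi f z * E z) \<longlongrightarrow> 0) at_bot"
    proof (rule Lim_null_comparison)
      let ?K = "(sqrt gauss_mass + 2 * (1 + 2 * (1 + gauss_mass))) * L2_norm half f"
      show "((\<lambda>z. ?K * \<bar>z * E z\<bar>) \<longlongrightarrow> 0) at_bot"
        by (intro tendsto_mult_right_zero tendsto_rabs_zero l)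
      show "\<forall>\<^sub>F z in at_bot. norm (Psi f z * E z) \<le> ?K * \<bar>z * E z\<bar>"
        using eventually_le_at_bot[of "-1"]
      proof eventually_elim
        case (elim z)
        show ?case using mult_right_mono[OF Psi_bound[OF f elim], of "\<bar>E z\<bar>"] by (simp add: abs_mult mult.assoc)
      qed
    qed
    show ?thesis using tendsto_add[OF 1 2] by (simp add: B_def[abs_def] mult_ac)
  qed
  have "(\<lambda>n. \<integral>q. indicator {an n..<bn n} q * (?v q * ?H q) \<partial>half) \<longlonglongrightarrow> (\<integral>q. ?v q * ?H q \<partial>half)"
    by (rule half_exhaust[OF L2_mult_integrable[OF Hinv_L2[OF f] HL]])
  moreover have "(\<lambda>n. (\<integral>q. indicator {an n..<bn n} q * (f q * E q) \<partial>half) - (B (bn n) - B (an n)))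
      \<longlonglongrightarrow> (\<integral>q. f q * E q \<partial>half) - ((- kap f) * E 0 - 0)"
  proof (intro tendsto_diff half_exhaust[OF L2_mult_integrable[OF f EL]])
    show "(\<lambda>n. B (bn n)) \<longlonglongrightarrow> - kap f * E 0" using filterlim_compose[OF B0 bn_lim] by simp
    show "(\<lambda>n. B (an n)) \<longlonglongrightarrow> 0" by (rule filterlim_compose[OF Bbot an_lim])
  qed
  ultimately show ?thesis
    unfolding fin[OF an_bn(1,2)] using LIMSEQ_unique by fastforce
qed

lemma is_H_Gf: assumes f: "f \<in> L2 half" shows "is_H (Hinv f) f"
  unfolding is_H_iff[OF Hinv_L2[OF f]]
proof
  fix \<phi> assume t: "\<phi> \<in> \<D>"
  obtain a b where ab: "smooth \<phi>" "a < b" "b < 0" "\<And>x. x \<notin> {a..b} \<Longrightarrow> \<phi> x = 0" using testE[OF t] by metis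
  obtain a' b' where ab': "\<And>x. x \<notin> {a'..b'} \<Longrightarrow> deriv \<phi> x = 0" using testE[OF test_deriv[OF t]] by metis
  have s: "smooth (deriv \<phi>)" "smooth (deriv (deriv \<phi>))" using ab(1) smooth_deriv by auto
  have "(\<integral>z. Hinv f z * (- z * deriv (deriv \<phi>) z + deriv \<phi> z - z\<^sup>2 / 4 * deriv \<phi> z) \<partial>half)
      = (\<integral>z. f z * \<phi> z \<partial>half) + kap f * \<phi> 0"
  proof (rule Hinv_duality[OF f smooth_DERIV[OF ab(1)] smooth_DERIV[OF s(1)]])
    show "isCont (deriv (deriv \<phi>)) z" for z by (rule DERIV_isCont[OF smooth_DERIV[OF s(2)]])
    show "\<phi> \<in> L2 half" by (rule test_L2[OF t])
    show "(\<lambda>z. - z * deriv (deriv \<phi>) z + deriv \<phi> z - z\<^sup>2 / 4 * deriv \<phi> z) \<in> L2 half"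
      using test_L2[OF H_adj_test[OF t]] by (simp add: H_adj_def[abs_def])
    show "((\<lambda>z. z * \<phi> z) \<longlongrightarrow> 0) at_bot"
      by (rule tendsto_eventually, rule eventually_mono[OF eventually_gt_at_bot[of a]]) (simp add: ab(4))
    show "((\<lambda>z. z * deriv \<phi> z) \<longlongrightarrow> 0) at_bot"
      by (rule tendsto_eventually, rule eventually_mono[OF eventually_gt_at_bot[of a']]) (simp add: ab')
  qed
  moreover have "\<phi> 0 = 0" using ab by simp
  ultimately show "(\<integral>z. Hinv f z * H_adj \<phi> z \<partial>half) = (\<integral>z. f z * \<phi> z \<partial>half)" by (simp add: H_adj_def)
qed

section \<open>Exponential moments and the convolution form\<close>

lemma norm_fn: "L2_norm half (l2_rep x) = norm x"
  using norm_abs_l2[OF l2_rep_L2, of x] by (simp add: abs_fn)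

lemma L2_norm_cong_AE:
  assumes "f \<in> borel_measurable M" "g \<in> borel_measurable M" "AE x in M. f x = g x"
  shows "L2_norm M f = L2_norm M g"
  unfolding L2_norm_def by (rule arg_cong[where f = sqrt], rule integral_cong_AE) (use assms in auto)

lemma AE_half_I: "(\<And>z. z < 0 \<Longrightarrow> P z) \<Longrightarrow> AE z in half. P z"
  by (rule AE_I2) simp

section \<open>The inverse as an operator on the Hilbert space\<close>

definition Hinv_l2 :: "l2 \<Rightarrow> l2" where "Hinv_l2 x = abs_l2 (Hinv (l2_rep x))"

lemma Hinv_l2_abs: "f \<in> L2 half \<Longrightarrow> Hinv_l2 (abs_l2 f) = abs_l2 (Hinv f)"
  using Hinv_cong_AE[OF l2_rep_L2 _ l2_rep_abs, of f] by (simp add: Hinv_l2_def)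

lemma bounded_linear_GT: "bounded_linear Hinv_l2"
proof
  fix x y :: l2 and r :: real
  show "Hinv_l2 (x + y) = Hinv_l2 x + Hinv_l2 y"
  proof -
    have "Hinv_l2 (x + y) = Hinv_l2 (abs_l2 (\<lambda>z. l2_rep x z + l2_rep y z))"
      using abs_l2_add[OF l2_rep_L2 l2_rep_L2, of x y] by (simp add: abs_fn)
    also have "\<dots> = abs_l2 (Hinv (\<lambda>z. l2_rep x z + l2_rep y z))" by (intro Hinv_l2_abs L2_add l2_rep_L2)
    also have "\<dots> = abs_l2 (\<lambda>z. Hinv (l2_rep x) z + Hinv (l2_rep y) z)"
      by (subst abs_l2_eq_iff) (auto intro!: Hinv_L2 L2_add l2_rep_L2 AE_half_I Hinv_linear)
    finally show ?thesis by (simp add: Hinv_l2_def abs_l2_add Hinv_L2 l2_rep_L2)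
  qed
  show "Hinv_l2 (r *\<^sub>R x) = r *\<^sub>R Hinv_l2 x"
  proof -
    have "Hinv_l2 (r *\<^sub>R x) = Hinv_l2 (abs_l2 (\<lambda>z. r * l2_rep x z))"
      using abs_l2_scaleR[OF l2_rep_L2, of r x] by (simp add: abs_fn)
    also have "\<dots> = abs_l2 (Hinv (\<lambda>z. r * l2_rep x z))" by (intro Hinv_l2_abs L2_scale l2_rep_L2)
    also have "\<dots> = abs_l2 (\<lambda>z. r * Hinv (l2_rep x) z)"
      by (subst abs_l2_eq_iff) (auto intro!: Hinv_L2 L2_scale l2_rep_L2 AE_half_I Hinv_linear(2))
    finally show ?thesis by (simp add: Hinv_l2_def abs_l2_scaleR Hinv_L2 l2_rep_L2)
  qed
  show "\<exists>K. \<forall>x. norm (Hinv_l2 x) \<le> norm x * K"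
    using Hinv_norm[OF l2_rep_L2] by (intro exI[of _ "L2_norm half Hinv_envelope"]) (auto simp: Hinv_l2_def norm_abs_l2 Hinv_L2 l2_rep_L2 norm_fn mult.commute)
qed

definition Hinv_op :: "l2 endo" where "Hinv_op = Endo (Blinfun Hinv_l2)"

lemma Hinv_op_app: "Hinv_op \<bullet>\<^sub>e x = Hinv_l2 x"
  by (simp add: app_def Hinv_op_def Endo_inverse bounded_linear_Blinfun_apply[OF bounded_linear_GT])

lemma Hinv_l2_energy: "inner (Hinv_l2 x) x \<le> - (1/2) * (norm (Hinv_l2 x))\<^sup>2"
proof -
  have "(norm (Hinv_l2 x))\<^sup>2 = (\<integral>z. (Hinv (l2_rep x) z)\<^sup>2 \<partial>half)"
    by (simp add: Hinv_l2_def norm_abs_l2 Hinv_L2 l2_rep_L2 L2_norm_def)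
  then show ?thesis
    using Hinv_energy[OF l2_rep_L2, of x] inner_fn_right[OF Hinv_L2[OF l2_rep_L2], of x x] by (simp add: Hinv_l2_def)
qed
text \<open>The pair (\<open>Hinv f\<close>, f) satisfies the distributional equation, so
  \<open>Hinv f = 0\<close> forces f to agree with 0 by uniqueness of the image under H.\<close>

lemma Hinv_l2_inj: assumes "Hinv_l2 x = 0" shows "x = 0"
proof -
  let ?f = "l2_rep x"
  have z: "AE z in half. Hinv ?f z = 0"
    using assms abs_l2_eq_iff[OF Hinv_L2[OF l2_rep_L2] L2_zero, of x] abs_l2_zero by (simp add: Hinv_l2_def)
  have "is_H (Hinv ?f) (\<lambda>_. 0)"
    unfolding is_H_iff[OF Hinv_L2[OF l2_rep_L2]]
  proof
    fix \<phi> assume t: "\<phi> \<in> \<D>"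
    have "(\<integral>z. Hinv ?f z * H_adj \<phi> z \<partial>half) = (\<integral>z. 0 \<partial>half)"
      by (rule integral_cong_AE)
        (use z L2_mult_integrable[OF Hinv_L2[OF l2_rep_L2] test_L2[OF H_adj_test[OF t]], of x] in auto)
    then show "(\<integral>z. Hinv ?f z * H_adj \<phi> z \<partial>half) = (\<integral>z. 0 * \<phi> z \<partial>half)" by simp
  qed
  then have "AE z in half. ?f z = 0"
    by (rule is_H_unique[OF Hinv_L2[OF l2_rep_L2] l2_rep_L2 L2_zero is_H_Gf[OF l2_rep_L2]])
  then have "abs_l2 ?f = abs_l2 (\<lambda>_. 0)" by (subst abs_l2_eq_iff) (auto simp: l2_rep_L2 L2_zero)
  then show ?thesis by (simp add: abs_fn abs_l2_zero)
qed

text \<open>Generation uses only the sign of the energy. The constant 1/2 re-enters in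
  \<open>energy_decay\<close>.\<close>

interpretation H: dissipative Hinv_op
proof
  fix x
  show "inner (Hinv_op \<bullet>\<^sub>e x) x \<le> 0"
    using Hinv_l2_energy[of x] zero_le_power2[of "norm (Hinv_l2 x)"] unfolding Hinv_op_app by linarith
  show "x = 0" if "Hinv_op \<bullet>\<^sub>e x = 0" using Hinv_l2_inj that by (simp add: Hinv_op_app)
qed

subsection \<open>The domain of \<open>H\<close>\<close>

text \<open>The difference w - \<open>Hinv f\<close> is square integrable and in the kernel of H,
  hence 0. Thus the maximal domain is the range of \<open>Hinv\<close> up to null sets.\<close>

lemma is_H_imp_Gf:
  assumes w: "w \<in> L2 half" and f: "f \<in> L2 half" and H: "is_H w f"
  shows "AE z in half. w z = Hinv f z"
proof -
  have "AE z in half. w z - Hinv f z = 0"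
  proof (rule is_H_zero)
    show d: "(\<lambda>z. w z - Hinv f z) \<in> L2 half" by (intro L2_diff w Hinv_L2 f)
    show "is_H (\<lambda>z. w z - Hinv f z) (\<lambda>_. 0)"
      unfolding is_H_iff[OF d]
    proof
      fix \<phi> assume t: "\<phi> \<in> \<D>"
      have "(\<integral>z. (w z - Hinv f z) * H_adj \<phi> z \<partial>half) = (\<integral>z. w z * H_adj \<phi> z \<partial>half) - (\<integral>z. Hinv f z * H_adj \<phi> z \<partial>half)"
        using L2_mult_integrable[OF w test_L2[OF H_adj_test[OF t]]]
          L2_mult_integrable[OF Hinv_L2[OF f] test_L2[OF H_adj_test[OF t]]]
        by (simp add: left_diff_distrib)
      then show "(\<integral>z. (w z - Hinv f z) * H_adj \<phi> z \<partial>half) = (\<integral>z. 0 * \<phi> z \<partial>half)"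
        using H is_H_Gf[OF f] t unfolding is_H_iff[OF w] is_H_iff[OF Hinv_L2[OF f]] by simp
    qed
  qed
  then show ?thesis by simp
qed

lemma H_op: assumes "w \<in> Dom_H" shows "H_op w \<in> L2 half" "is_H w (H_op w)"
proof -
  have "\<exists>f. f \<in> L2 half \<and> is_H w f" using assms by (auto simp: Dom_H_def)
  then have "H_op w \<in> L2 half \<and> is_H w (H_op w)" unfolding H_op_def by (rule someI_ex)
  then show "H_op w \<in> L2 half" "is_H w (H_op w)" by auto
qed

lemma Dom_H_L2: "w \<in> Dom_H \<Longrightarrow> w \<in> L2 half"
  by (simp add: Dom_H_def)

lemma Dom_H_Gf: "w \<in> Dom_H \<Longrightarrow> AE z in half. w z = Hinv (H_op w) z"
  by (intro is_H_imp_Gf H_op Dom_H_L2)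

lemma Dom_H_abs: "w \<in> Dom_H \<Longrightarrow> abs_l2 w = Hinv_l2 (abs_l2 (H_op w))"
  by (simp add: Hinv_l2_abs H_op(1)) (subst abs_l2_eq_iff, auto intro: Dom_H_L2 Dom_H_Gf Hinv_L2 H_op)

lemma Hinv_in_Dom_H: "f \<in> L2 half \<Longrightarrow> Hinv f \<in> Dom_H"
  unfolding Dom_H_def using Hinv_L2 is_H_Gf by blast

lemma graph_norm_H_eq:
  assumes "w \<in> L2 half" "f \<in> L2 half" "is_H w f"
  shows "graph_norm_H w = L2_norm half w + L2_norm half f"
proof -
  have D: "w \<in> Dom_H" using assms by (auto simp: Dom_H_def)
  have "AE z in half. H_op w z = f z" by (rule is_H_unique[OF assms(1) H_op(1)[OF D] assms(2) H_op(2)[OF D] assms(3)])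
  then have "L2_norm half (H_op w) = L2_norm half f"
    by (intro L2_norm_cong_AE L2_measurable H_op D assms)
  then show ?thesis by (simp add: graph_norm_H_def)
qed

subsection \<open>Exponential moments\<close>

text \<open>For k = 0 this is u0 (x - z)/u0 x. The index k counts derivatives in x, each of which
  brings down a factor z/2.\<close>

definition exp_kernel :: "nat \<Rightarrow> real \<Rightarrow> real \<Rightarrow> real" where "exp_kernel k x z = z ^ k * exp (x * z / 2 - z\<^sup>2 / 4)"

definition exp_moment :: "nat \<Rightarrow> (real \<Rightarrow> real) \<Rightarrow> real \<Rightarrow> real" where
  "exp_moment k w x = (\<integral>z. exp_kernel k x z * w z \<partial>half)"

lemma power_le_fact_exp: "0 \<le> x \<Longrightarrow> x ^ k \<le> fact k * exp (x::real)"
proof -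
  assume x: "0 \<le> x"
  have "sum (\<lambda>n. x ^ n /\<^sub>R fact n) {k} \<le> (\<Sum>n. x ^ n /\<^sub>R fact n)"
    using x by (intro sum_le_suminf summable_exp_generic) auto
  then have "x ^ k / fact k \<le> exp x" by (simp add: exp_def divide_inverse mult.commute)
  then show ?thesis by (simp add: field_simps)
qed

text \<open>The power is absorbed into fact k times exp |z|, and the linear exponent into half of
  the Gaussian, by the square 2 (c + 1 - |z|/4)^2 \<ge> 0. What is left is
  \<open>gauss\<close>.\<close>

lemma gaussian_poly_exp_bound:
  "\<bar>z\<bar> ^ k * exp (c * \<bar>z\<bar> - z\<^sup>2 / 4) \<le> (fact k * exp (2 * (c + 1)\<^sup>2)) * gauss z"
proof -
  have "\<bar>z\<bar> ^ k * exp (c * \<bar>z\<bar> - z\<^sup>2 / 4) \<le> (fact k * exp \<bar>z\<bar>) * exp (c * \<bar>z\<bar> - z\<^sup>2 / 4)"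
    by (intro mult_right_mono power_le_fact_exp) auto
  also have "\<dots> = fact k * exp ((c + 1) * \<bar>z\<bar> - z\<^sup>2 / 4)"
    by (simp add: exp_add[symmetric] algebra_simps)
  also have "\<dots> \<le> fact k * exp (2 * (c + 1)\<^sup>2 + - 1 / 8 * z\<^sup>2)"
  proof -
    have "0 \<le> 2 * ((c + 1) - \<bar>z\<bar> / 4)\<^sup>2" by simp
    also have "\<dots> = 2 * (c + 1)\<^sup>2 + z\<^sup>2 / 8 - (c + 1) * \<bar>z\<bar>"
      by (simp add: power2_diff power_divide algebra_simps)
    finally show ?thesis by simp
  qed
  also have "\<dots> = (fact k * exp (2 * (c + 1)\<^sup>2)) * gauss z" by (simp only: exp_add gauss_def mult.assoc)
  finally show ?thesis .
qed

lemma exp_kernel_bound: "\<bar>exp_kernel k x z\<bar> \<le> (fact k * exp (2 * (\<bar>x\<bar> / 2 + 1)\<^sup>2)) * gauss z"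
proof -
  have "x * z / 2 \<le> \<bar>x\<bar> / 2 * \<bar>z\<bar>" using abs_ge_self[of "x * z"] by (simp add: abs_mult)
  then have "\<bar>exp_kernel k x z\<bar> \<le> \<bar>z\<bar> ^ k * exp (\<bar>x\<bar> / 2 * \<bar>z\<bar> - z\<^sup>2 / 4)"
    by (simp add: exp_kernel_def abs_mult power_abs mult_left_mono)
  then show ?thesis using gaussian_poly_exp_bound order_trans by blast
qed

lemma exp_kernel_measurable [measurable]: "exp_kernel k x \<in> borel_measurable borel"
  unfolding exp_kernel_def[abs_def] by measurable

lemma exp_kernel_L2: "exp_kernel k x \<in> L2 half"
  by (rule L2_bound[OF gauss_L2, of _ "fact k * exp (2 * (\<bar>x\<bar> / 2 + 1)\<^sup>2)"])
    (use exp_kernel_bound gauss_pos in \<open>auto intro!: borel_measurable_half simp: less_imp_le\<close>)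

lemma exp_moment_integrable: "w \<in> L2 half \<Longrightarrow> integrable half (\<lambda>z. exp_kernel k x z * w z)"
  by (rule L2_mult_integrable[OF exp_kernel_L2])

lemma exp_moment_abs: "w \<in> L2 half \<Longrightarrow> exp_moment k w x = inner (abs_l2 (exp_kernel k x)) (abs_l2 w)"
  by (simp add: exp_moment_def inner_abs_l2 exp_kernel_L2)

lemma exp_moment_cong_AE:
  "w \<in> L2 half \<Longrightarrow> w' \<in> L2 half \<Longrightarrow> AE z in half. w z = w' z \<Longrightarrow> exp_moment k w x = exp_moment k w' x"
  using abs_l2_eq_iff[of w w'] by (simp add: exp_moment_abs)

lemma exp_minus_affine_bound: "\<bar>exp t - 1 - t\<bar> \<le> t\<^sup>2 / 2 * exp \<bar>t\<bar>" for t :: real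
proof -
  obtain s where s: "\<bar>s\<bar> \<le> \<bar>t\<bar>" "exp t = (\<Sum>m<2. t ^ m / fact m) + exp s / fact 2 * t ^ 2"
    using Maclaurin_exp_le[of t 2] by blast
  then have "\<bar>exp t - 1 - t\<bar> = t\<^sup>2 / 2 * exp s" by (simp add: numeral_2_eq_2 abs_mult)
  also have "\<dots> \<le> t\<^sup>2 / 2 * exp \<bar>t\<bar>" using s(1) by (intro mult_left_mono) auto
  finally show ?thesis .
qed

lemma DERIV_of_quadratic_bound:
  fixes f :: "real \<Rightarrow> real"
  assumes "\<And>h. \<bar>h\<bar> \<le> 1 \<Longrightarrow> \<bar>f (x + h) - f x - h * D\<bar> \<le> K * h\<^sup>2"
  shows "(f has_real_derivative D) (at x)"
proof -
  have "((\<lambda>h. (f (x + h) - f x) / h - D) \<longlongrightarrow> 0) (at 0)"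
  proof (rule Lim_null_comparison)
    show "((\<lambda>h. K * \<bar>h\<bar>) \<longlongrightarrow> 0) (at (0::real))"
      by (intro tendsto_mult_right_zero tendsto_rabs_zero tendsto_ident_at)
    show "\<forall>\<^sub>F h in at 0. norm ((f (x + h) - f x) / h - D) \<le> K * \<bar>h\<bar>"
    proof -
      have "norm ((f (x + h) - f x) / h - D) \<le> K * \<bar>h\<bar>" if h: "h \<noteq> 0" "\<bar>h\<bar> \<le> 1" for h
      proof -
        have "norm ((f (x + h) - f x) / h - D) = \<bar>f (x + h) - f x - h * D\<bar> / \<bar>h\<bar>"
          using h by (simp add: abs_divide[symmetric] diff_divide_distrib)
        also have "\<dots> \<le> K * h\<^sup>2 / \<bar>h\<bar>" using assms[OF h(2)] by (intro divide_right_mono) auto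
        also have "\<dots> = K * \<bar>h\<bar>" using h by (simp add: power2_eq_square abs_if)
        finally show ?thesis .
      qed
      then show ?thesis by (auto simp: eventually_at intro!: exI[of _ 1])
    qed
  qed
  then show ?thesis unfolding DERIV_def by (simp add: LIM_zero_iff)
qed

lemma exp_moment_deriv:
  assumes w: "w \<in> L2 half"
  shows "(exp_moment k w has_real_derivative exp_moment (Suc k) w x / 2) (at x)"
proof (rule DERIV_of_quadratic_bound)
  fix h :: real assume h: "\<bar>h\<bar> \<le> 1"
  \<comment> \<open>The quadratic Taylor remainder brings two further powers of z, hence
    \<open>k + 2\<close>; the rate (|x| + 1)/2 covers all |h| \<le> 1.\<close>
  define C where "C = fact (k + 2) * exp (2 * ((\<bar>x\<bar> + 1) / 2 + 1)\<^sup>2)"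
  have pt: "\<bar>exp_kernel k (x + h) z - exp_kernel k x z - h / 2 * exp_kernel (Suc k) x z\<bar> \<le> h\<^sup>2 / 8 * (C * gauss z)" for z
  proof -
    let ?t = "h * z / 2"
    have eq: "exp_kernel k (x + h) z - exp_kernel k x z - h / 2 * exp_kernel (Suc k) x z = exp_kernel k x z * (exp ?t - 1 - ?t)"
    proof -
      have "exp_kernel k (x + h) z = exp_kernel k x z * exp ?t"
        by (simp add: exp_kernel_def exp_add[symmetric] algebra_simps add_divide_distrib)
      then show ?thesis by (simp add: exp_kernel_def algebra_simps)
    qed
    have "\<bar>exp_kernel k (x + h) z - exp_kernel k x z - h / 2 * exp_kernel (Suc k) x z\<bar> \<le> \<bar>exp_kernel k x z\<bar> * (?t\<^sup>2 / 2 * exp \<bar>?t\<bar>)"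
      unfolding eq abs_mult by (intro mult_left_mono exp_minus_affine_bound) simp
    also have "\<dots> = h\<^sup>2 / 8 * (\<bar>z\<bar> ^ (k + 2) * exp (x * z / 2 - z\<^sup>2 / 4 + \<bar>?t\<bar>))"
      by (simp add: exp_kernel_def abs_mult power_abs exp_add power_add power_mult_distrib power_divide power2_eq_square)
    also have "\<dots> \<le> h\<^sup>2 / 8 * (\<bar>z\<bar> ^ (k + 2) * exp ((\<bar>x\<bar> + 1) / 2 * \<bar>z\<bar> - z\<^sup>2 / 4))"
    proof -
      have "x * z / 2 \<le> \<bar>x\<bar> / 2 * \<bar>z\<bar>" using abs_ge_self[of "x * z"] by (simp add: abs_mult)
      moreover have "\<bar>?t\<bar> \<le> 1 / 2 * \<bar>z\<bar>" using h by (simp add: abs_mult mult_right_mono mult_left_le_one_le)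
      ultimately show ?thesis by (intro mult_left_mono) (auto simp: algebra_simps add_divide_distrib)
    qed
    also have "\<dots> \<le> h\<^sup>2 / 8 * (C * gauss z)"
      unfolding C_def by (intro mult_left_mono gaussian_poly_exp_bound) simp
    finally show ?thesis .
  qed
  have exw: "integrable half (\<lambda>z. gauss z * \<bar>w z\<bar>)"
    using integrable_norm[OF gauss_f_integrable[OF w]] gauss_pos by (simp add: abs_mult less_imp_le)
  have eq: "exp_moment k w (x + h) - exp_moment k w x - h * (exp_moment (Suc k) w x / 2)
      = (\<integral>z. (exp_kernel k (x + h) z - exp_kernel k x z - h / 2 * exp_kernel (Suc k) x z) * w z \<partial>half)"
    using exp_moment_integrable[OF w] by (simp add: exp_moment_def left_diff_distrib mult.assoc)
  have "\<bar>exp_moment k w (x + h) - exp_moment k w x - h * (exp_moment (Suc k) w x / 2)\<bar> \<le> (\<integral>z. h\<^sup>2 / 8 * C * (gauss z * \<bar>w z\<bar>) \<partial>half)"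
    unfolding eq
  proof (rule integral_abs_bound[THEN order_trans], rule integral_mono)
    show "integrable half (\<lambda>z. \<bar>(exp_kernel k (x + h) z - exp_kernel k x z - h / 2 * exp_kernel (Suc k) x z) * w z\<bar>)"
      using exp_moment_integrable[OF w] by (intro integrable_abs) (simp add: left_diff_distrib mult.assoc)
    show "integrable half (\<lambda>z. h\<^sup>2 / 8 * C * (gauss z * \<bar>w z\<bar>))" by (intro integrable_mult_right exw)
    fix z
    show "\<bar>(exp_kernel k (x + h) z - exp_kernel k x z - h / 2 * exp_kernel (Suc k) x z) * w z\<bar> \<le> h\<^sup>2 / 8 * C * (gauss z * \<bar>w z\<bar>)"
      using mult_right_mono[OF pt[of z], of "\<bar>w z\<bar>"] by (simp add: abs_mult mult.assoc)
  qed
  also have "\<dots> = (C / 8 * (\<integral>z. gauss z * \<bar>w z\<bar> \<partial>half)) * h\<^sup>2" by simp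
  finally show "\<bar>exp_moment k w (x + h) - exp_moment k w x - h * (exp_moment (Suc k) w x / 2)\<bar>
    \<le> (fact (k + 2) * exp (2 * ((\<bar>x\<bar> + 1) / 2 + 1)\<^sup>2) / 8 * (\<integral>z. gauss z * \<bar>w z\<bar> \<partial>half)) * h\<^sup>2"
    unfolding C_def .
qed

subsection \<open>The convolution form\<close>

lemma u0_pos: "0 < u0 x" by (simp add: u0_def)

lemma u0_deriv: "(u0 has_real_derivative - (x / 2) * u0 x) (at x)"
  unfolding u0_def by (auto intro!: derivative_eq_intros simp: field_simps)

lemma u0_shift: "u0 (x - z) = u0 x * exp_kernel 0 x z"
  by (simp add: u0_def exp_kernel_def exp_add[symmetric] power2_eq_square algebra_simps add_divide_distrib diff_divide_distrib)

lemma conv_integral: "(\<integral>z. u0 (x - z) * w z \<partial>half) = u0 x * exp_moment 0 w x"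
  unfolding exp_moment_def u0_shift by (simp add: mult.assoc)

lemma conv_form_eq: "conv_form a b w x = u0 x * (a + b * x + exp_moment 0 w x)"
  unfolding conv_form_def conv_integral by (simp add: u1_eq algebra_simps)

lemma deriv_u0_times:
  assumes "\<And>x. (q has_real_derivative q' x) (at x)"
  shows "((\<lambda>x. u0 x * q x) has_real_derivative u0 x * (q' x - x / 2 * q x)) (at x)"
  by (rule derivative_eq_intros u0_deriv assms refl)+ (simp add: algebra_simps)

text \<open>The operator of the equation conjugated by \<open>u0\<close>. For q = 1 the right side
  is \<open>u1\<close>/2 and for q = x it is 0, so a feeds b at rate a/2 and b feeds
  nothing.\<close>

lemma L_op_u0_times:
  assumes d: "\<And>x. (q has_real_derivative q1 x) (at x)" "\<And>x. (q1 has_real_derivative q2 x) (at x)"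
    "\<And>x. (q2 has_real_derivative q3 x) (at x)"
  defines "v \<equiv> \<lambda>x. u0 x * q x"
  shows "\<forall>n<3. (deriv ^^ n) v differentiable at x"
    and "deriv (L_op v) x = u0 x * (- q3 x + 3 / 2 * x * q2 x - x\<^sup>2 / 2 * q1 x + x / 2 * q x)"
proof -
  have d0: "(v has_real_derivative u0 x * (q1 x - x / 2 * q x)) (at x)" for x
    unfolding v_def by (rule deriv_u0_times[OF d(1)])
  have d1: "((\<lambda>x. u0 x * (q1 x - x / 2 * q x)) has_real_derivative u0 x * (q2 x - x * q1 x - q x / 2 + x\<^sup>2 / 4 * q x)) (at x)" for x
    by (rule DERIV_cong[OF deriv_u0_times[of _ "\<lambda>x. q2 x - (q x / 2 + x / 2 * q1 x)"]])
      (auto intro!: derivative_eq_intros d simp: field_simps power2_eq_square)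
  have d2: "((\<lambda>x. u0 x * (q2 x - x * q1 x - q x / 2 + x\<^sup>2 / 4 * q x)) has_real_derivative
      u0 x * ((q3 x - (q1 x + x * q2 x) - q1 x / 2 + (x / 2 * q x + x\<^sup>2 / 4 * q1 x)) - x / 2 * (q2 x - x * q1 x - q x / 2 + x\<^sup>2 / 4 * q x))) (at x)" for x
    by (rule deriv_u0_times) (auto intro!: derivative_eq_intros d simp: field_simps power2_eq_square)
  have e1: "deriv v = (\<lambda>x. u0 x * (q1 x - x / 2 * q x))" using d0 by (auto intro: DERIV_imp_deriv)
  have e2: "deriv (deriv v) = (\<lambda>x. u0 x * (q2 x - x * q1 x - q x / 2 + x\<^sup>2 / 4 * q x))"
    unfolding e1 using d1 by (auto intro: DERIV_imp_deriv)
  show "\<forall>n<3. (deriv ^^ n) v differentiable at x"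
  proof (intro allI impI)
    fix n :: nat assume "n < 3"
    then consider "n = 0" | "n = 1" | "n = 2" by linarith
    then show "(deriv ^^ n) v differentiable at x"
    proof cases
      case 1 then show ?thesis using d0 real_differentiable_def by auto
    next
      case 2 then show ?thesis using d1[of x] e1 real_differentiable_def by auto
    next
      case 3 then show ?thesis using d2[of x] e2 real_differentiable_def by (auto simp: numeral_2_eq_2)
    qed
  qed
  have L: "L_op v = (\<lambda>x. u0 x * (- q2 x + x * q1 x - q x))"
  proof
    fix x
    have "(deriv ^^ 2) v = (\<lambda>x. u0 x * (q2 x - x * q1 x - q x / 2 + x\<^sup>2 / 4 * q x))"
      using e2 by (simp add: numeral_2_eq_2)
    then show "L_op v x = u0 x * (- q2 x + x * q1 x - q x)"
      unfolding L_op_def by (simp add: v_def field_simps power2_eq_square)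
  qed
  have "((\<lambda>x. u0 x * (- q2 x + x * q1 x - q x)) has_real_derivative
      u0 x * ((- q3 x + (q1 x + x * q2 x) - q1 x) - x / 2 * (- q2 x + x * q1 x - q x))) (at x)"
    by (rule deriv_u0_times) (auto intro!: derivative_eq_intros d simp: field_simps)
  then show "deriv (L_op v) x = u0 x * (- q3 x + 3 / 2 * x * q2 x - x\<^sup>2 / 2 * q1 x + x / 2 * q x)"
    unfolding L by (subst DERIV_imp_deriv) (auto simp: field_simps power2_eq_square)
qed

lemma exp_kernel_deriv: "(exp_kernel 0 x has_real_derivative (x - z) / 2 * exp_kernel 0 x z) (at z)"
  unfolding exp_kernel_def[abs_def] by (auto intro!: derivative_eq_intros simp: field_simps)

text \<open>The left side is the conjugated operator of \<open>L_op_u0_times\<close> applied in x to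
  the moment of \<open>Hinv f\<close>. The kernel carries it over to the variable z:
  \<open>H_adj\<close> of \<open>exp_kernel 0 x\<close> is the same combination of kernels of order
  0 to 3. The duality formula then moves the operator onto f, and the kernel has value 1 at z =
  0.\<close>

lemma Hinv_em_duality:
  assumes f: "f \<in> L2 half"
  shows "x / 2 * exp_moment 0 (Hinv f) x - x\<^sup>2 / 4 * exp_moment 1 (Hinv f) x + 3 / 8 * x * exp_moment 2 (Hinv f) x - 1 / 8 * exp_moment 3 (Hinv f) x
    = exp_moment 0 f x + kap f"
proof -
  let ?E1 = "\<lambda>z. (x - z) / 2 * exp_kernel 0 x z" and ?E2 = "\<lambda>z. ((x - z)\<^sup>2 / 4 - 1 / 2) * exp_kernel 0 x z"
  let ?H = "\<lambda>z. - z * ?E2 z + ?E1 z - z\<^sup>2 / 4 * ?E1 z"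
  have He: "?H = (\<lambda>z. x / 2 * exp_kernel 0 x z - x\<^sup>2 / 4 * exp_kernel 1 x z + 3 / 8 * x * exp_kernel 2 x z - 1 / 8 * exp_kernel 3 x z)"
    by (auto simp: exp_kernel_def field_simps power2_eq_square power3_eq_cube)
  have HL: "?H \<in> L2 half" unfolding He by (intro L2_add L2_diff L2_scale exp_kernel_L2)
  have ex0: "(gauss \<longlongrightarrow> 0) at_bot" unfolding gauss_def by real_asymp
  have l: "(exp_kernel k x \<longlongrightarrow> 0) at_bot" for k
    by (rule Lim_null_comparison[OF _ tendsto_mult_right_zero[OF ex0, of "fact k * exp (2 * (\<bar>x\<bar> / 2 + 1)\<^sup>2)"]])
      (use exp_kernel_bound in auto)
  have "(\<integral>z. Hinv f z * ?H z \<partial>half) = (\<integral>z. f z * exp_kernel 0 x z \<partial>half) + kap f * exp_kernel 0 x 0"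
  proof (rule Hinv_duality[OF f exp_kernel_deriv _ _ exp_kernel_L2 HL])
    show "(?E1 has_real_derivative ?E2 z) (at z)" for z
      by (auto intro!: derivative_eq_intros exp_kernel_deriv simp: field_simps power2_eq_square)
    show "isCont ?E2 z" for z unfolding exp_kernel_def by (intro continuous_intros) auto
    have "(\<lambda>z. z * exp_kernel 0 x z) = exp_kernel 1 x" by (auto simp: exp_kernel_def)
    then show "((\<lambda>z. z * exp_kernel 0 x z) \<longlongrightarrow> 0) at_bot" using l by simp
    have "(\<lambda>z. z * ?E1 z) = (\<lambda>z. x / 2 * exp_kernel 1 x z - 1 / 2 * exp_kernel 2 x z)"
      by (auto simp: exp_kernel_def field_simps power2_eq_square)
    then show "((\<lambda>z. z * ?E1 z) \<longlongrightarrow> 0) at_bot"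
      using tendsto_diff[OF tendsto_mult_right_zero[OF l[of 1], of "x / 2"] tendsto_mult_right_zero[OF l[of 2], of "1 / 2"]] by simp
  qed
  moreover have "(\<integral>z. Hinv f z * ?H z \<partial>half)
      = x / 2 * exp_moment 0 (Hinv f) x - x\<^sup>2 / 4 * exp_moment 1 (Hinv f) x + 3 / 8 * x * exp_moment 2 (Hinv f) x - 1 / 8 * exp_moment 3 (Hinv f) x"
  proof -
    have "(\<integral>z. Hinv f z * ?H z \<partial>half) = (\<integral>z. x / 2 * (exp_kernel 0 x z * Hinv f z) - x\<^sup>2 / 4 * (exp_kernel 1 x z * Hinv f z)
        + 3 / 8 * x * (exp_kernel 2 x z * Hinv f z) - 1 / 8 * (exp_kernel 3 x z * Hinv f z) \<partial>half)"
    proof (rule Bochner_Integration.integral_cong)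
      fix z
      note Hz = fun_cong[OF He, of z]
      show "Hinv f z * ?H z = x / 2 * (exp_kernel 0 x z * Hinv f z) - x\<^sup>2 / 4 * (exp_kernel 1 x z * Hinv f z)
        + 3 / 8 * x * (exp_kernel 2 x z * Hinv f z) - 1 / 8 * (exp_kernel 3 x z * Hinv f z)"
        unfolding Hz by (simp add: algebra_simps)
    qed simp
    then show ?thesis using exp_moment_integrable[OF Hinv_L2[OF f]] by (simp add: exp_moment_def)
  qed
  ultimately show ?thesis by (simp add: exp_moment_def exp_kernel_def mult.commute)
qed

lemma conv_form_regular:
  assumes w: "w \<in> L2 half"
  shows "\<forall>n<3. (deriv ^^ n) (conv_form a b w) differentiable at x"
    and "deriv (L_op (conv_form a b w)) x = u0 x * (a / 2 * x
      + (x / 2 * exp_moment 0 w x - x\<^sup>2 / 4 * exp_moment 1 w x + 3 / 8 * x * exp_moment 2 w x - 1 / 8 * exp_moment 3 w x))"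
proof -
  have cf: "conv_form a b w = (\<lambda>x. u0 x * (a + b * x + exp_moment 0 w x))" by (auto simp: conv_form_eq)
  have m: "(exp_moment k w has_real_derivative exp_moment (Suc k) w x / 2) (at x)" for k x by (rule exp_moment_deriv[OF w])
  note L = L_op_u0_times[of "\<lambda>x. a + b * x + exp_moment 0 w x" "\<lambda>x. b + exp_moment 1 w x / 2" "\<lambda>x. exp_moment 2 w x / 4" "\<lambda>x. exp_moment 3 w x / 8", of x]
  have h: "((\<lambda>x. a + b * x + exp_moment 0 w x) has_real_derivative b + exp_moment 1 w x / 2) (at x)"
    "((\<lambda>x. b + exp_moment 1 w x / 2) has_real_derivative exp_moment 2 w x / 4) (at x)"
    "((\<lambda>x. exp_moment 2 w x / 4) has_real_derivative exp_moment 3 w x / 8) (at x)" for x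
    using m[of 0 x] m[of 1 x] m[of 2 x]
    by (auto intro!: derivative_eq_intros simp: numeral_2_eq_2 numeral_3_eq_3)
  show "\<forall>n<3. (deriv ^^ n) (conv_form a b w) differentiable at x"
    unfolding cf by (rule L(1)[OF h])
  show "deriv (L_op (conv_form a b w)) x = u0 x * (a / 2 * x
      + (x / 2 * exp_moment 0 w x - x\<^sup>2 / 4 * exp_moment 1 w x + 3 / 8 * x * exp_moment 2 w x - 1 / 8 * exp_moment 3 w x))"
    unfolding cf by (subst L(2)[OF h]) (simp add: field_simps power2_eq_square)
qed

lemma conv_form_rhs:
  assumes w: "w \<in> L2 half" and f: "f \<in> L2 half" and wf: "AE z in half. w z = Hinv f z"
  shows "deriv (L_op (conv_form a b w)) x = conv_form (kap f) (a / 2) f x"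
  using Hinv_em_duality[OF f, of x]
  unfolding conv_form_regular(2)[OF w] exp_moment_cong_AE[OF w Hinv_L2[OF f] wf] conv_form_eq by simp

subsection \<open>Injectivity of the convolution form\<close>

text \<open>At x = 2 n the kernel is exp(-z^2/4) times the n-th power of y = exp z, so g is
  orthogonal to all polynomials in y with that weight. Since y stays in [0, 1], a test function of z
  is a uniform limit of such polynomials.\<close>

lemma exp_moment_zero_imp_zero:
  assumes g: "g \<in> L2 half" and z: "\<And>n :: nat. exp_moment 0 g (2 * real n) = 0"
  shows "AE z in half. g z = 0"
proof -
  let ?e = "exp_kernel 0 0"
  have eg: "integrable half (\<lambda>z. ?e z * g z)" by (rule exp_moment_integrable[OF g])
  have em2: "exp_kernel 0 (2 * real n) z = exp z ^ n * ?e z" for n z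
    by (simp add: exp_kernel_def exp_of_nat_mult[symmetric] exp_add[symmetric] mult.commute)
  have poly: "integrable half (\<lambda>z. p (exp z) * (?e z * g z)) \<and> (\<integral>z. p (exp z) * (?e z * g z) \<partial>half) = 0"
    if P: "real_polynomial_function p" for p :: "real \<Rightarrow> real"
  proof -
    obtain c n where p: "p = (\<lambda>x. \<Sum>i\<le>n. c i * x ^ i)" using P unfolding real_polynomial_function_iff_sum by blast
    have eq: "(\<lambda>z. p (exp z) * (?e z * g z)) = (\<lambda>z. \<Sum>i\<le>n. c i * (exp_kernel 0 (2 * real i) z * g z))"
      unfolding p em2 by (simp add: sum_distrib_right mult.assoc)
    show ?thesis unfolding eq using exp_moment_integrable[OF g] z by (simp add: exp_moment_def)
  qed
  have "AE z in half. ?e z * g z = 0"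
  proof (rule fundamental_lemma)
    have "\<bar>gauss_weight z * (?e z * g z)\<bar> \<le> \<bar>?e z * g z\<bar>" for z
      by (simp add: gauss_weight_def abs_mult mult_left_le_one_le)
    then show "integrable half (\<lambda>z. gauss_weight z * (?e z * g z))"
      using L2_measurable[OF gauss_weight_L2] L2_measurable[OF g]
      by (intro Bochner_Integration.integrable_bound[OF eg]) (auto intro!: borel_measurable_times borel_measurable_half)
    show "(\<lambda>z. ?e z * g z) \<in> borel_measurable half" using eg by auto
    fix \<psi> assume t: "\<psi> \<in> \<D>"
    obtain a b where ab: "smooth \<psi>" "a < b" "b < 0" "\<And>x. x \<notin> {a..b} \<Longrightarrow> \<psi> x = 0" using testE[OF t] by metis
    \<comment> \<open>The test function in the variable y = exp z. It vanishes for y < exp a, so the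
      value 0 extends it continuously to y = 0.\<close>
    define \<phi> where "\<phi> y = (if 0 < y then \<psi> (ln y) else 0)" for y
    have "isCont \<phi> y" if "y \<in> {0..1}" for y
    proof (cases "y = 0")
      case True
      have "\<forall>\<^sub>F y in nhds 0. \<phi> y = 0"
      proof -
        have "\<phi> y = 0" if "y < exp a" for y
          using that ab(4)[of "ln y"] ln_less_cancel_iff[of y "exp a"] by (auto simp: \<phi>_def)
        then show ?thesis
          by (intro eventually_nhds_in_open[of "{..<exp a}" 0, THEN eventually_mono]) auto
      qed
      then show ?thesis using isCont_cong[of \<phi> "\<lambda>_. 0" 0] True by simp
    next
      case False
      then have y: "0 < y" using that by simp
      have "isCont (\<lambda>y. \<psi> (ln y)) y"
        by (rule isCont_o2[OF _ DERIV_isCont[OF smooth_DERIV[OF ab(1)]]]) (use y in \<open>auto intro!: continuous_intros\<close>)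
      moreover have "\<forall>\<^sub>F y in nhds y. \<phi> y = \<psi> (ln y)"
        using eventually_nhds_in_open[of "{0<..}" y] y by (auto elim!: eventually_mono simp: \<phi>_def)
      ultimately show ?thesis by (simp add: isCont_cong)
    qed
    then have \<phi>c: "continuous_on {0..1} \<phi>" by (auto intro: continuous_at_imp_continuous_on)
    have \<phi>e: "\<phi> (exp z) = \<psi> z" for z by (simp add: \<phi>_def)
    let ?I = "\<integral>z. \<bar>?e z * g z\<bar> \<partial>half"
    have i\<psi>: "integrable half (\<lambda>z. ?e z * g z * \<psi> z)"
      using L2_mult_integrable[OF g test_L2[OF test_mult[OF t, of ?e]]]
        smooth_gaussian[of "- 1 / 4"] by (simp add: exp_kernel_def[abs_def] mult_ac)
    have "\<bar>\<integral>z. ?e z * g z * \<psi> z \<partial>half\<bar> \<le> e * ?I" if e: "0 < e" for e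
    proof -
      obtain p where p: "real_polynomial_function p" "\<And>y. y \<in> {0..1} \<Longrightarrow> \<bar>\<phi> y - p y\<bar> < e"
        using Stone_Weierstrass_real_polynomial_function[OF _ \<phi>c e] by auto
      have "(\<integral>z. ?e z * g z * \<psi> z \<partial>half) = (\<integral>z. (\<psi> z - p (exp z)) * (?e z * g z) \<partial>half)"
        using i\<psi> poly[OF p(1)] by (simp add: left_diff_distrib mult.commute)
      also have "\<bar>\<dots>\<bar> \<le> (\<integral>z. e * \<bar>?e z * g z\<bar> \<partial>half)"
      proof (rule integral_abs_bound[THEN order_trans], rule integral_mono)
        have "integrable half (\<lambda>z. (\<psi> z - p (exp z)) * (?e z * g z))"
          using i\<psi> poly[OF p(1)] by (simp add: left_diff_distrib mult.commute)
        then show "integrable half (\<lambda>z. \<bar>(\<psi> z - p (exp z)) * (?e z * g z)\<bar>)" by (rule integrable_abs)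
        show "integrable half (\<lambda>z. e * \<bar>?e z * g z\<bar>)" by (intro integrable_mult_right integrable_abs eg)
        show "\<bar>(\<psi> z - p (exp z)) * (?e z * g z)\<bar> \<le> e * \<bar>?e z * g z\<bar>" if "z \<in> space half" for z
        proof -
          have "\<bar>\<psi> z - p (exp z)\<bar> < e" using p(2)[of "exp z"] that unfolding \<phi>e by simp
          then show ?thesis unfolding abs_mult[of "\<psi> z - p (exp z)"] by (intro mult_right_mono) auto
        qed
      qed
      finally show ?thesis by simp
    qed
    then have le: "\<bar>\<integral>z. ?e z * g z * \<psi> z \<partial>half\<bar> \<le> e * ?I" if "0 < e" for e using that by blast
    have "0 \<le> ?I" by simp
    have "\<bar>\<integral>z. ?e z * g z * \<psi> z \<partial>half\<bar> \<le> 0 + e" if "0 < e" for e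
    proof -
      have "r / (s + 1) * s \<le> r" if "0 < r" "0 \<le> s" for r s :: real using that by (simp add: field_simps)
      then have "e / (?I + 1) * ?I \<le> e" using \<open>0 \<le> ?I\<close> that by blast
      moreover have "0 < e / (?I + 1)" by (intro divide_pos_pos that add_nonneg_pos \<open>0 \<le> ?I\<close>) simp
      ultimately show ?thesis using le[of "e / (?I + 1)"] by linarith
    qed
    then show "(\<integral>z. ?e z * g z * \<psi> z \<partial>half) = 0" using field_le_epsilon[of _ 0] by (metis abs_le_zero_iff)
  qed
  then show ?thesis by eventually_elim (simp add: exp_kernel_def)
qed

lemma conv_form_zero:
  assumes g: "g \<in> L2 half" and z: "\<And>x. conv_form \<alpha> \<beta> g x = 0"
  shows "\<alpha> = 0" "\<beta> = 0" "AE z in half. g z = 0"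
proof -
  have m: "exp_moment 0 g x = - \<alpha> - \<beta> * x" for x
    using z[of x] u0_pos[of x] by (simp add: conv_form_eq) 
  have "(\<lambda>n. exp_moment 0 g (real n)) \<longlonglongrightarrow> (\<integral>z. 0 \<partial>half)"
    unfolding exp_moment_def
  proof (rule integral_dominated_convergence[where w = "\<lambda>z. \<bar>exp_kernel 0 0 z * g z\<bar>"])
    show "AE z in half. (\<lambda>n. exp_kernel 0 (real n) z * g z) \<longlonglongrightarrow> 0"
    proof (rule AE_half_I)
      fix z :: real assume "z < 0"
      then have "(\<lambda>n. exp (z / 2) ^ n) \<longlonglongrightarrow> 0" by (intro LIMSEQ_power_zero) simp
      from tendsto_mult_left_zero[OF this, of "exp_kernel 0 0 z * g z"]
      show "(\<lambda>n. exp_kernel 0 (real n) z * g z) \<longlonglongrightarrow> 0"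
        by (simp add: exp_kernel_def exp_of_nat_mult[symmetric] exp_add[symmetric] mult.assoc[symmetric])
    qed
    show "AE z in half. norm (exp_kernel 0 (real n) z * g z) \<le> \<bar>exp_kernel 0 0 z * g z\<bar>" for n
      by (rule AE_half_I) (auto simp: exp_kernel_def abs_mult mult_nonneg_nonpos intro!: mult_right_mono)
  qed (use exp_moment_integrable[OF g] in auto)
  then have l: "(\<lambda>n. - \<alpha> - \<beta> * real n) \<longlonglongrightarrow> 0" by (simp add: m)
  \<comment> \<open>Consecutive terms of the affine sequence differ by \<beta>, which isolates
    it.\<close>
  from tendsto_diff[OF l LIMSEQ_Suc[OF l]] have "(\<lambda>n. \<beta>) \<longlonglongrightarrow> 0" by (simp add: algebra_simps)
  then show b: "\<beta> = 0" by (simp add: LIMSEQ_const_iff)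
  then show "\<alpha> = 0" using l by (simp add: LIMSEQ_const_iff)
  then show "AE z in half. g z = 0" using b by (intro exp_moment_zero_imp_zero[OF g]) (simp add: m)
qed

lemma conv_form_diff:
  assumes "f \<in> L2 half" "g \<in> L2 half"
  shows "conv_form a b f x - conv_form c d g x = conv_form (a - c) (b - d) (\<lambda>z. f z - g z) x"
proof -
  have m: "exp_moment 0 (\<lambda>z. f z - g z) x = exp_moment 0 f x - exp_moment 0 g x"
    using exp_moment_integrable[OF assms(1)] exp_moment_integrable[OF assms(2)] by (simp add: exp_moment_def right_diff_distrib)
  show ?thesis unfolding conv_form_eq m by (simp add: algebra_simps)
qed

lemma conv_form_inj:
  assumes fg: "f \<in> L2 half" "g \<in> L2 half" and e: "\<And>x. conv_form a b f x = conv_form c d g x"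
  shows "a = c" "b = d" "AE z in half. f z = g z"
  using conv_form_zero[OF L2_diff[OF fg], of "a - c" "b - d"] conv_form_diff[OF fg, of a b _ c d] e by auto

section \<open>Norms and the modulation equations\<close>

subsection \<open>Vector-valued functions of time\<close>

text \<open>This and the next two lemmas move the norm limits of the statement, which concern
  functions, into continuity and vector derivatives in the type \<open>l2\<close>.\<close>

lemma C0_halfline_L2_iff:
  "C0_halfline (L2 half) (L2_norm half) w \<longleftrightarrow>
    (\<forall>t\<ge>0. w t \<in> L2 half) \<and> continuous_on {0..} (\<lambda>t. abs_l2 (w t))"
proof (cases "\<forall>t\<ge>0. w t \<in> L2 half")
  case True
  have "((\<lambda>s. L2_norm half (\<lambda>z. w s z - w t z)) \<longlongrightarrow> 0) (at t within {0..}) \<longleftrightarrow>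
      ((\<lambda>t. abs_l2 (w t)) \<longlongrightarrow> abs_l2 (w t)) (at t within {0..})" if "t \<ge> 0" for t
  proof -
    have "L2_norm half (\<lambda>z. w s z - w t z) = norm (abs_l2 (w s) - abs_l2 (w t))" if "s \<ge> 0" for s
      using True that \<open>t \<ge> 0\<close> by (simp add: abs_l2_diff norm_abs_l2 L2_diff)
    then have "((\<lambda>s. L2_norm half (\<lambda>z. w s z - w t z)) \<longlongrightarrow> 0) (at t within {0..}) \<longleftrightarrow>
        ((\<lambda>s. norm (abs_l2 (w s) - abs_l2 (w t))) \<longlongrightarrow> 0) (at t within {0..})"
      by (intro tendsto_cong) (auto simp: eventually_at_filter)
    then show ?thesis by (simp add: tendsto_norm_zero_iff LIM_zero_iff)
  qed
  then show ?thesis using True by (auto simp: C0_halfline_def continuous_on_def)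
qed (auto simp: C0_halfline_def)

lemma L2_quotient_limit_iff:
  assumes w: "\<And>s. s \<ge> 0 \<Longrightarrow> w s \<in> L2 half" and v: "v \<in> L2 half" and t: "t \<ge> 0"
  shows "((\<lambda>s. L2_norm half (\<lambda>z. (w s z - w t z) / (s - t) - v z)) \<longlongrightarrow> 0) (at t within {0..}) \<longleftrightarrow>
    ((\<lambda>s. abs_l2 (w s)) has_vector_derivative abs_l2 v) (at t within {0..})"
proof -
  let ?W = "\<lambda>s. abs_l2 (w s)"
  have "L2_norm half (\<lambda>z. (w s z - w t z) / (s - t) - v z) = norm ((?W s - ?W t) - (s - t) *\<^sub>R abs_l2 v) / norm (s - t)"
    if s: "s \<ge> 0" "s \<noteq> t" for s
  proof -
    have d: "(\<lambda>z. w s z - w t z) \<in> L2 half" using w s t by (intro L2_diff) auto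
    have q: "(\<lambda>z. 1 / (s - t) * (w s z - w t z)) \<in> L2 half" by (rule L2_scale[OF d])
    have "abs_l2 (\<lambda>z. 1 / (s - t) * (w s z - w t z) - v z) = (1 / (s - t)) *\<^sub>R (?W s - ?W t) - abs_l2 v"
      using w[OF s(1)] w[OF t] d q v by (simp only: abs_l2_diff[symmetric] abs_l2_scaleR[symmetric])
    also have "\<dots> = (1 / (s - t)) *\<^sub>R ((?W s - ?W t) - (s - t) *\<^sub>R abs_l2 v)"
      using s by (simp add: scaleR_diff_right)
    finally have "norm (abs_l2 (\<lambda>z. 1 / (s - t) * (w s z - w t z) - v z))
        = norm ((?W s - ?W t) - (s - t) *\<^sub>R abs_l2 v) / norm (s - t)" by simp
    then show ?thesis using norm_abs_l2[OF L2_diff[OF q v]] by simp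
  qed
  then have "((\<lambda>s. L2_norm half (\<lambda>z. (w s z - w t z) / (s - t) - v z)) \<longlongrightarrow> 0) (at t within {0..}) \<longleftrightarrow>
      ((\<lambda>s. norm ((?W s - ?W t) - (s - t) *\<^sub>R abs_l2 v) / norm (s - t)) \<longlongrightarrow> 0) (at t within {0..})"
    by (intro tendsto_cong) (auto simp: eventually_at_filter)
  then show ?thesis
    unfolding has_vector_derivative_def has_derivative_iff_norm by (simp add: bounded_linear_scaleR_left)
qed

lemma C1_halfline_L2_iff:
  "C1_halfline (L2 half) (L2_norm half) w \<longleftrightarrow> (\<forall>t\<ge>0. w t \<in> L2 half) \<and>
    (\<exists>v. (\<forall>t\<ge>0. v t \<in> L2 half) \<and> continuous_on {0..} (\<lambda>t. abs_l2 (v t)) \<and>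
      (\<forall>t\<ge>0. ((\<lambda>s. abs_l2 (w s)) has_vector_derivative abs_l2 (v t)) (at t within {0..})))"
  (is "?L \<longleftrightarrow> ?R")
proof
  assume ?L
  then have w: "C0_halfline (L2 half) (L2_norm half) w" and
    "\<exists>v. C0_halfline (L2 half) (L2_norm half) v \<and>
     (\<forall>t\<ge>0. ((\<lambda>s. L2_norm half (\<lambda>z. (w s z - w t z) / (s - t) - v t z)) \<longlongrightarrow> 0) (at t within {0..}))"
    unfolding C1_halfline_def by blast+
  then obtain v where v: "C0_halfline (L2 half) (L2_norm half) v"
     "\<And>t. t \<ge> 0 \<Longrightarrow> ((\<lambda>s. L2_norm half (\<lambda>z. (w s z - w t z) / (s - t) - v t z)) \<longlongrightarrow> 0) (at t within {0..})" by blast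
  then show ?R using w unfolding C0_halfline_L2_iff
    by (intro conjI exI[of _ v]) (auto simp: L2_quotient_limit_iff[symmetric])
next
  assume R: ?R
  then obtain v where v: "\<And>t. t \<ge> 0 \<Longrightarrow> v t \<in> L2 half" "continuous_on {0..} (\<lambda>t. abs_l2 (v t))"
      "\<And>t. t \<ge> 0 \<Longrightarrow> ((\<lambda>s. abs_l2 (w s)) has_vector_derivative abs_l2 (v t)) (at t within {0..})" by blast
  have "continuous_on {0..} (\<lambda>t. abs_l2 (w t))"
    by (rule continuous_on_vector_derivative) (use v(3) in auto)
  then show ?L unfolding C1_halfline_def C0_halfline_L2_iff
    using R v by (intro conjI exI[of _ v]) (auto simp: L2_quotient_limit_iff)
qed

text \<open>Although \<open>kap f\<close> is a boundary value of the solution w of H w = f, as a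
  functional of f it is a pairing with an element of the space. It is therefore bounded and commutes
  with time derivatives and limits.\<close>

definition kap_l2 :: "l2 \<Rightarrow> real" where "kap_l2 x = - inner (abs_l2 gauss) x"

lemma kap_abs: "f \<in> L2 half \<Longrightarrow> kap f = kap_l2 (abs_l2 f)"
  by (simp add: kap_def kap_l2_def inner_abs_l2 gauss_L2)

lemma bounded_linear_kl: "bounded_linear kap_l2"
  unfolding kap_l2_def by (intro bounded_linear_minus bounded_linear_inner_right)

lemma conv_form_time_deriv:
  assumes a: "(a has_real_derivative a') (at t within S)" and b: "(b has_real_derivative b') (at t within S)"
    and w: "\<And>s. s \<in> S \<Longrightarrow> w s \<in> L2 half" "t \<in> S" and v: "v \<in> L2 half"
    and d: "((\<lambda>s. abs_l2 (w s)) has_vector_derivative abs_l2 v) (at t within S)"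
  shows "((\<lambda>s. conv_form (a s) (b s) (w s) x) has_real_derivative conv_form a' b' v x) (at t within S)"
proof -
  have "((\<lambda>s. inner (abs_l2 (exp_kernel 0 x)) (abs_l2 (w s))) has_real_derivative inner (abs_l2 (exp_kernel 0 x)) (abs_l2 v)) (at t within S)"
    using bounded_linear.has_vector_derivative[OF bounded_linear_inner_right d]
    by (simp add: has_real_derivative_iff_has_vector_derivative)
  then have D: "((\<lambda>s. u0 x * (a s + b s * x + inner (abs_l2 (exp_kernel 0 x)) (abs_l2 (w s)))) has_real_derivative
      u0 x * (a' + b' * x + inner (abs_l2 (exp_kernel 0 x)) (abs_l2 v))) (at t within S)"
    using a b by (auto intro!: derivative_eq_intros)
  show ?thesis unfolding conv_form_eq[of a'] exp_moment_abs[OF v]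
    by (rule has_field_derivative_transform_within[OF D zero_less_one w(2)])
      (use w(1) in \<open>simp add: conv_form_eq exp_moment_abs\<close>)
qed

subsection \<open>Estimates for the convolution form\<close>

lemma u0_measurable [measurable]: "u0 \<in> borel_measurable borel"
  by (rule borel_measurable_continuous_onI) (auto simp: u0_def[abs_def] intro!: continuous_intros)

text \<open>Completing the square in the product of two Gaussians. Integration over x leaves
  \<open>gauss z\<close>, the same weight that is the integrating factor of H; this is why
  \<open>kap\<close> also computes the projection onto \<open>u0\<close>.\<close>

lemma u0_sq: "u0 x * u0 (x - z) = gauss z * normal_density (z / 2) 1 x"
proof -
  have "(2 * pi) powr (- 1 / 4) * (2 * pi) powr (- 1 / 4) = (2 * pi) powr (- (1 / 2))"
    by (simp add: powr_add[symmetric])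
  also have "\<dots> = 1 / sqrt (2 * pi)" by (simp add: powr_minus_divide powr_half_sqrt)
  finally have c: "(2 * pi) powr (- 1 / 4) * (2 * pi) powr (- 1 / 4) = 1 / sqrt (2 * pi)" .
  have "exp (- x\<^sup>2 / 4) * exp (- (x - z)\<^sup>2 / 4) = exp (- 1 / 8 * z\<^sup>2) * exp (- (x - z / 2)\<^sup>2 / 2)"
    unfolding exp_add[symmetric] by (rule arg_cong[where f = exp]) (simp add: power2_eq_square field_simps)
  then have "u0 x * u0 (x - z) = ((2 * pi) powr (- 1 / 4) * (2 * pi) powr (- 1 / 4)) * (exp (- 1 / 8 * z\<^sup>2) * exp (- (x - z / 2)\<^sup>2 / 2))"
    by (simp add: u0_def)
  then show ?thesis unfolding c by (simp add: gauss_def normal_density_def)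
qed

section \<open>Young's inequality for convolution with the Gaussian\<close>

lemma u0_integrable: "integrable lborel u0"
proof -
  have "integrable lborel (\<lambda>x. (2 * pi) powr (-1/4) * exp (- (1 / 4) * x\<^sup>2))"
    by (intro integrable_mult_right integrable_gaussian) simp
  then show ?thesis by (simp add: u0_def[abs_def])
qed

definition u0_mass :: real where "u0_mass = integral\<^sup>L lborel u0"

lemma u0_mass_nonneg: "0 \<le> u0_mass"
  unfolding u0_mass_def using u0_pos by (intro integral_nonneg_AE) (auto simp: less_imp_le)

lemma u0_nn_integral: "(\<integral>\<^sup>+x. ennreal (u0 (x - z)) \<partial>lborel) = ennreal u0_mass"
proof -
  have "(\<integral>\<^sup>+x. ennreal (u0 (x - z)) \<partial>lborel) = (\<integral>\<^sup>+x. ennreal (u0 x) \<partial>lborel)"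
    using nn_integral_real_affine[of "\<lambda>x. ennreal (u0 x)" 1 "- z"] by simp
  also have "\<dots> = ennreal u0_mass"
    unfolding u0_mass_def by (rule nn_integral_eq_integral[OF u0_integrable]) (simp add: u0_pos less_imp_le)
  finally show ?thesis .
qed

lemma u0_shift_sq_L2: "(\<lambda>z. u0 (x - z)) \<in> L2 half"
  unfolding u0_shift by (rule L2_scale[OF exp_kernel_L2])

lemma u0_refl: "u0 (x - z) = u0 (z - x)"
  by (simp add: u0_def power2_commute)

lemma u0_shift_integrable: "integrable half (\<lambda>z. u0 (x - z))"
proof -
  have "integrable lborel (\<lambda>z. u0 (z - x))"
    using lborel_integrable_real_affine[OF u0_integrable, of 1 "- x"] by simp
  then show ?thesis unfolding u0_refl[of x] by (rule integrable_half)
qed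

lemma u0_shift_integral_le: "(\<integral>z. u0 (x - z) \<partial>half) \<le> u0_mass"
proof -
  have "(\<integral>z. u0 (z - x) \<partial>half) \<le> (\<integral>z. u0 (z - x) \<partial>lborel)"
    using lborel_integrable_real_affine[OF u0_integrable, of 1 "- x"] u0_pos
    by (intro half_integral_le_lborel) (auto simp: less_imp_le)
  also have "\<dots> = u0_mass" unfolding u0_mass_def using lborel_integral_real_affine[of 1 u0 "- x"] by simp
  finally show ?thesis by (simp add: u0_refl[of x])
qed

definition conv_u0 :: "(real \<Rightarrow> real) \<Rightarrow> real \<Rightarrow> real" where "conv_u0 w x = (\<integral>z. u0 (x - z) * w z \<partial>half)"

lemma conv_form_yc: "conv_form a b w x = a * u0 x + b * u1 x + conv_u0 w x"
  by (simp add: conv_form_def conv_u0_def)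

lemma conv_u0_measurable: assumes "w \<in> L2 half" shows "conv_u0 w \<in> borel_measurable borel"
proof -
  have [measurable]: "w \<in> borel_measurable half" using assms by (rule L2_measurable)
  have "(\<lambda>x. \<integral>z. u0 (x - z) * w z \<partial>half) \<in> borel_measurable borel" by measurable
  then show ?thesis by (simp add: conv_u0_def[abs_def])
qed

text \<open>Cauchy--Schwarz for the measure \<open>u0 (x - z) dz\<close>.\<close>

lemma conv_u0_sq_le:
  assumes w: "w \<in> L2 half"
  shows "(conv_u0 w x)\<^sup>2 \<le> u0_mass * (\<integral>z. u0 (x - z) * (w z)\<^sup>2 \<partial>half)" "integrable half (\<lambda>z. u0 (x - z) * (w z)\<^sup>2)"
proof -
  have wm [measurable]: "w \<in> borel_measurable half" using w by (rule L2_measurable)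
  have um: "(\<lambda>z. u0 (x - z)) \<in> borel_measurable half" by (intro borel_measurable_half) measurable
  have ub: "u0 y \<le> (2 * pi) powr (- 1 / 4)" for y by (simp add: u0_def mult_left_le)
  show i: "integrable half (\<lambda>z. u0 (x - z) * (w z)\<^sup>2)"
  proof (rule Bochner_Integration.integrable_bound)
    show "integrable half (\<lambda>z. (2 * pi) powr (- 1 / 4) * (w z)\<^sup>2)"
      by (intro integrable_mult_right L2_square_integrable w)
    show "AE z in half. norm (u0 (x - z) * (w z)\<^sup>2) \<le> norm ((2 * pi) powr (- 1 / 4) * (w z)\<^sup>2)"
      using u0_pos ub by (intro AE_I2) (auto simp: abs_mult less_imp_le intro!: mult_right_mono)
  qed (use um wm in measurable)
  let ?s = "\<lambda>z. sqrt (u0 (x - z))"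
  have s2: "(?s z)\<^sup>2 = u0 (x - z)" for z using u0_pos[of "x - z"] by simp
  have sL: "?s \<in> L2 half"
    using u0_shift_integrable[of x] um by (auto simp: L2_def u0_pos less_imp_le)
  have swL: "(\<lambda>z. ?s z * w z) \<in> L2 half"
  proof -
    have "(\<lambda>z. (?s z * w z)\<^sup>2) = (\<lambda>z. u0 (x - z) * (w z)\<^sup>2)"
      unfolding power_mult_distrib s2 ..
    moreover have "(\<lambda>z. ?s z * w z) \<in> borel_measurable half" using um wm by (intro borel_measurable_times) auto
    ultimately show ?thesis using i by (simp add: L2_def)
  qed
  have "conv_u0 w x = (\<integral>z. ?s z * (?s z * w z) \<partial>half)"
    unfolding conv_u0_def by (simp add: mult.assoc[symmetric] power2_eq_square[symmetric] u0_pos less_imp_le)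
  also have "\<bar>\<dots>\<bar> \<le> L2_norm half ?s * L2_norm half (\<lambda>z. ?s z * w z)"
    by (rule Cauchy_Schwarz_half[OF sL swL])
  finally have "\<bar>conv_u0 w x\<bar>\<^sup>2 \<le> (L2_norm half ?s * L2_norm half (\<lambda>z. ?s z * w z))\<^sup>2"
    by (intro power_mono) auto
  then have "(conv_u0 w x)\<^sup>2 \<le> (L2_norm half ?s)\<^sup>2 * (L2_norm half (\<lambda>z. ?s z * w z))\<^sup>2"
    by (simp only: power2_abs power_mult_distrib)
  also have "(L2_norm half ?s)\<^sup>2 = (\<integral>z. u0 (x - z) \<partial>half)" by (simp add: L2_norm_def u0_pos less_imp_le)
  also have "(L2_norm half (\<lambda>z. ?s z * w z))\<^sup>2 = (\<integral>z. u0 (x - z) * (w z)\<^sup>2 \<partial>half)"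
    by (simp add: L2_norm_def power_mult_distrib u0_pos less_imp_le)
  also have "(\<integral>z. u0 (x - z) \<partial>half) * (\<integral>z. u0 (x - z) * (w z)\<^sup>2 \<partial>half) \<le> u0_mass * (\<integral>z. u0 (x - z) * (w z)\<^sup>2 \<partial>half)"
    using u0_pos by (intro mult_right_mono u0_shift_integral_le integral_nonneg_AE) (auto simp: less_imp_le)
  finally show "(conv_u0 w x)\<^sup>2 \<le> u0_mass * (\<integral>z. u0 (x - z) * (w z)\<^sup>2 \<partial>half)" .
qed

text \<open>The pointwise Cauchy-Schwarz estimate is integrated in x and the integrals are exchanged
  by Tonelli; each of the two steps contributes one factor \<open>u0_mass\<close>.\<close>

lemma conv_u0_L2:
  assumes w: "w \<in> L2 half"
  shows "integrable lborel (\<lambda>x. (conv_u0 w x)\<^sup>2)" "(\<integral>x. (conv_u0 w x)\<^sup>2 \<partial>lborel) \<le> u0_mass\<^sup>2 * (L2_norm half w)\<^sup>2"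
proof -
  have [measurable]: "w \<in> borel_measurable half" using w by (rule L2_measurable)
  have [measurable]: "conv_u0 w \<in> borel_measurable borel" by (rule conv_u0_measurable[OF w])
  let ?W = "\<integral>z. (w z)\<^sup>2 \<partial>half"
  have "(\<integral>\<^sup>+x. ennreal ((conv_u0 w x)\<^sup>2) \<partial>lborel) \<le> (\<integral>\<^sup>+x. ennreal u0_mass * (\<integral>\<^sup>+z. ennreal (u0 (x - z) * (w z)\<^sup>2) \<partial>half) \<partial>lborel)"
  proof (rule nn_integral_mono)
    fix x
    have "(\<integral>\<^sup>+z. ennreal (u0 (x - z) * (w z)\<^sup>2) \<partial>half) = ennreal (\<integral>z. u0 (x - z) * (w z)\<^sup>2 \<partial>half)"
      using u0_pos by (intro nn_integral_eq_integral conv_u0_sq_le w) (auto simp: less_imp_le)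
    then show "ennreal ((conv_u0 w x)\<^sup>2) \<le> ennreal u0_mass * (\<integral>\<^sup>+z. ennreal (u0 (x - z) * (w z)\<^sup>2) \<partial>half)"
      using conv_u0_sq_le(1)[OF w, of x] u0_mass_nonneg by (simp add: ennreal_mult'[symmetric] ennreal_leI)
  qed
  also have "\<dots> = ennreal u0_mass * (\<integral>\<^sup>+x. (\<integral>\<^sup>+z. ennreal (u0 (x - z) * (w z)\<^sup>2) \<partial>half) \<partial>lborel)"
    by (rule nn_integral_cmult) measurable
  also have "(\<integral>\<^sup>+x. (\<integral>\<^sup>+z. ennreal (u0 (x - z) * (w z)\<^sup>2) \<partial>half) \<partial>lborel)
      = (\<integral>\<^sup>+z. (\<integral>\<^sup>+x. ennreal (u0 (x - z) * (w z)\<^sup>2) \<partial>lborel) \<partial>half)"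
    by (rule lborel_half.Fubini'[symmetric]) measurable
  also have "\<dots> = (\<integral>\<^sup>+z. ennreal u0_mass * ennreal ((w z)\<^sup>2) \<partial>half)"
  proof (rule nn_integral_cong)
    fix z
    have "(\<integral>\<^sup>+x. ennreal (u0 (x - z) * (w z)\<^sup>2) \<partial>lborel) = (\<integral>\<^sup>+x. ennreal (u0 (x - z)) * ennreal ((w z)\<^sup>2) \<partial>lborel)"
      using u0_pos by (simp add: ennreal_mult'' )
    also have "\<dots> = (\<integral>\<^sup>+x. ennreal (u0 (x - z)) \<partial>lborel) * ennreal ((w z)\<^sup>2)"
    proof (rule nn_integral_multc)
      have "(\<lambda>x. u0 (x - z)) \<in> borel_measurable lborel"
        by (rule measurable_compose[OF _ u0_measurable]) simp
      then show "(\<lambda>x. ennreal (u0 (x - z))) \<in> borel_measurable lborel"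
        by (rule measurable_compose[OF _ measurable_ennreal])
    qed
    finally show "(\<integral>\<^sup>+x. ennreal (u0 (x - z) * (w z)\<^sup>2) \<partial>lborel) = ennreal u0_mass * ennreal ((w z)\<^sup>2)"
      by (simp add: u0_nn_integral)
  qed
  also have "\<dots> = ennreal u0_mass * ennreal ?W"
    using L2_square_integrable[OF w] by (simp add: nn_integral_cmult nn_integral_eq_integral)
  finally have le: "(\<integral>\<^sup>+x. ennreal ((conv_u0 w x)\<^sup>2) \<partial>lborel) \<le> ennreal (u0_mass\<^sup>2 * ?W)"
    using u0_mass_nonneg by (simp add: ennreal_mult'[symmetric] power2_eq_square mult.assoc)
  show i: "integrable lborel (\<lambda>x. (conv_u0 w x)\<^sup>2)"
    by (rule integrableI_bounded) (use le in \<open>auto intro: order_le_less_trans\<close>)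
  have "ennreal (\<integral>x. (conv_u0 w x)\<^sup>2 \<partial>lborel) \<le> ennreal (u0_mass\<^sup>2 * ?W)"
    using le by (subst nn_integral_eq_integral[symmetric, OF i]) auto
  then show "(\<integral>x. (conv_u0 w x)\<^sup>2 \<partial>lborel) \<le> u0_mass\<^sup>2 * (L2_norm half w)\<^sup>2"
    by (simp add: L2_norm_def)
qed

lemma conv_u0_bound: "w \<in> L2 half \<Longrightarrow> \<bar>conv_u0 w x\<bar> \<le> sqrt ((2 * pi) powr (- 1 / 4) * u0_mass) * L2_norm half w"
proof -
  assume w: "w \<in> L2 half"
  have "(\<integral>z. u0 (x - z) * (w z)\<^sup>2 \<partial>half) \<le> (\<integral>z. (2 * pi) powr (- 1 / 4) * (w z)\<^sup>2 \<partial>half)"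
  proof (rule integral_mono)
    show "u0 (x - z) * (w z)\<^sup>2 \<le> (2 * pi) powr (- 1 / 4) * (w z)\<^sup>2" for z
      by (intro mult_right_mono) (auto simp: u0_def mult_left_le)
  qed (use conv_u0_sq_le(2)[OF w] L2_square_integrable[OF w] in auto)
  then have "u0_mass * (\<integral>z. u0 (x - z) * (w z)\<^sup>2 \<partial>half) \<le> u0_mass * ((2 * pi) powr (- 1 / 4) * (L2_norm half w)\<^sup>2)"
    using u0_mass_nonneg by (intro mult_left_mono) (auto simp: L2_norm_def)
  then have "(conv_u0 w x)\<^sup>2 \<le> (2 * pi) powr (- 1 / 4) * u0_mass * (L2_norm half w)\<^sup>2"
    using conv_u0_sq_le(1)[OF w, of x] by (simp add: mult_ac)
  then have "sqrt ((conv_u0 w x)\<^sup>2) \<le> sqrt ((2 * pi) powr (- 1 / 4) * u0_mass * (L2_norm half w)\<^sup>2)"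
    by (rule real_sqrt_le_mono)
  then show ?thesis by (simp add: real_sqrt_mult L2_norm_nonneg)
qed

section \<open>Pairings with the Hermite functions\<close>

text \<open>The square of \<open>u0\<close> is the standard normal density, so these are its moments
  of order 0, 1 and 2.\<close>

lemma u0_sq_integrable: "integrable lborel (\<lambda>x. (u0 x)\<^sup>2)" "integrable lborel (\<lambda>x. (u1 x)\<^sup>2)"
  "(\<integral>x. (u0 x)\<^sup>2 \<partial>lborel) = 1" "integrable lborel (\<lambda>x. u0 x * u1 x)" "(\<integral>x. u0 x * u1 x \<partial>lborel) = 0"
proof -
  have 0: "(u0 x)\<^sup>2 = normal_density 0 1 x" for x using u0_sq[of x 0] by (simp add: power2_eq_square gauss_def)
  have 1: "u0 x * u1 x = normal_density 0 1 x * x" for x using 0[of x] by (simp add: u1_eq power2_eq_square)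
  have 2: "(u1 x)\<^sup>2 = normal_density 0 1 x * (x - 0) ^ 2" for x using 0[of x] by (simp add: u1_eq power_mult_distrib mult.commute)
  show "integrable lborel (\<lambda>x. (u0 x)\<^sup>2)" "integrable lborel (\<lambda>x. (u1 x)\<^sup>2)"
    unfolding 0 2 by (rule integrable_normal_density integrable_normal_moment, simp)+
  show "(\<integral>x. (u0 x)\<^sup>2 \<partial>lborel) = 1" unfolding 0 by (rule integral_normal_density) simp
  show "integrable lborel (\<lambda>x. u0 x * u1 x)" unfolding 1 by (rule integrable_normal_moment_nz_1) simp
  show "(\<integral>x. u0 x * u1 x \<partial>lborel) = 0" unfolding 1 by (rule integral_normal_moment_nz_1) simp
qed

lemma u1_measurable [measurable]: "u1 \<in> borel_measurable borel"
  unfolding u1_eq[abs_def] by measurable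

lemma u1_bound: "\<bar>u1 x\<bar> \<le> 4 * (2 * pi) powr (- 1 / 4)"
proof -
  have "\<bar>x\<bar> \<le> 1 + x\<^sup>2" using sum_squares_bound[of "\<bar>x\<bar>" 1] by simp
  also have "\<dots> \<le> 4 * exp (x\<^sup>2 / 4)" using exp_ge_add_one_self[of "x\<^sup>2 / 4"] by linarith
  finally have "\<bar>x\<bar> * exp (- x\<^sup>2 / 4) \<le> 4" by (simp add: exp_minus field_simps)
  then have "(2 * pi) powr (- 1 / 4) * (\<bar>x\<bar> * exp (- x\<^sup>2 / 4)) \<le> (2 * pi) powr (- 1 / 4) * 4"
    by (intro mult_left_mono) auto
  then show ?thesis by (simp add: u1_eq u0_def abs_mult mult_ac)
qed

lemma u0_yc_integral:
  assumes w: "w \<in> L2 half"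
  shows "(\<integral>x. u0 x * conv_u0 w x \<partial>lborel) = - kap w" "integrable lborel (\<lambda>x. u0 x * conv_u0 w x)"
proof -
  have wm [measurable]: "w \<in> borel_measurable half" using w by (rule L2_measurable)
  have aw: "(\<lambda>z. \<bar>w z\<bar>) \<in> L2 half" by (rule L2_bound[OF w, of _ 1]) auto
  have fi: "integrable half (\<lambda>z. u0 (x - z) * w z)" for x
    by (rule L2_mult_integrable[OF u0_shift_sq_L2 w])
  let ?K = "sqrt ((2 * pi) powr (- 1 / 4) * u0_mass) * L2_norm half (\<lambda>z. \<bar>w z\<bar>)"
  have int: "integrable (lborel \<Otimes>\<^sub>M half) (\<lambda>(x, z). u0 x * (u0 (x - z) * w z))"
  proof (rule lborel_half.Fubini_integrable)
    show "(\<lambda>(x, z). u0 x * (u0 (x - z) * w z)) \<in> borel_measurable (lborel \<Otimes>\<^sub>M half)" by measurable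
    show "integrable lborel (\<lambda>x. \<integral>z. norm (case (x, z) of (x, z) \<Rightarrow> u0 x * (u0 (x - z) * w z)) \<partial>half)"
    proof (rule Bochner_Integration.integrable_bound)
      show "integrable lborel (\<lambda>x. u0 x * ?K)" by (intro integrable_mult_left u0_integrable)
      have "(\<integral>z. norm (u0 x * (u0 (x - z) * w z)) \<partial>half) = u0 x * conv_u0 (\<lambda>z. \<bar>w z\<bar>) x" for x
        by (simp add: abs_mult u0_pos less_imp_le conv_u0_def)
      moreover have "\<bar>u0 x * conv_u0 (\<lambda>z. \<bar>w z\<bar>) x\<bar> \<le> u0 x * ?K" for x
        using conv_u0_bound[OF aw, of x] u0_pos[of x] by (simp add: abs_mult less_imp_le mult_left_mono)
      ultimately show "AE x in lborel. norm (\<integral>z. norm (case (x, z) of (x, z) \<Rightarrow> u0 x * (u0 (x - z) * w z)) \<partial>half) \<le> norm (u0 x * ?K)"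
        by (intro AE_I2) (simp only: prod.case real_norm_def, rule order_trans[OF _ abs_ge_self], simp)
    qed measurable
    show "AE x in lborel. integrable half (\<lambda>z. case (x, z) of (x, z) \<Rightarrow> u0 x * (u0 (x - z) * w z))"
      using fi by (intro AE_I2) simp
  qed
  have "(\<integral>x. u0 x * conv_u0 w x \<partial>lborel) = (\<integral>x. (\<integral>z. u0 x * (u0 (x - z) * w z) \<partial>half) \<partial>lborel)"
    by (simp add: conv_u0_def)
  also have "\<dots> = (\<integral>z. (\<integral>x. u0 x * (u0 (x - z) * w z) \<partial>lborel) \<partial>half)"
    by (rule lborel_half.Fubini_integral[OF int, symmetric])
  also have "\<dots> = (\<integral>z. gauss z * w z \<partial>half)"
  proof (rule Bochner_Integration.integral_cong)
    fix z
    have "(\<integral>x. u0 x * (u0 (x - z) * w z) \<partial>lborel) = (\<integral>x. (gauss z * w z) * normal_density (z / 2) 1 x \<partial>lborel)"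
      by (rule Bochner_Integration.integral_cong) (auto simp: u0_sq[symmetric] mult_ac)
    also have "\<dots> = (gauss z * w z) * (\<integral>x. normal_density (z / 2) 1 x \<partial>lborel)"
      by (rule Bochner_Integration.integral_mult_right_zero)
    also have "(\<integral>x. normal_density (z / 2) 1 x \<partial>lborel) = 1" by (rule integral_normal_density) simp
    finally show "(\<integral>x. u0 x * (u0 (x - z) * w z) \<partial>lborel) = gauss z * w z" by simp
  qed simp
  finally show "(\<integral>x. u0 x * conv_u0 w x \<partial>lborel) = - kap w" by (simp add: kap_def)
  show "integrable lborel (\<lambda>x. u0 x * conv_u0 w x)"
    using lborel_half.integrable_fst'[OF int] by (simp add: conv_u0_def)
qed

text \<open>Pairing with \<open>u0\<close> normalizes the first term and kills the second; the
  convolution contributes - \<open>kap w\<close>. Orthogonality thus determines a from w.\<close>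

lemma X_c_coefficient:
  assumes u: "u \<in> X_c" and w: "w \<in> L2 half" and ae: "AE x in lebesgue. u x = conv_form a b w x"
  shows "a = kap w"
proof -
  have [measurable]: "conv_u0 w \<in> borel_measurable borel" by (rule conv_u0_measurable[OF w])
  have "u \<in> borel_measurable lebesgue" using u by (auto simp: X_c_def H1_def L2_def)
  moreover have cf: "conv_form a b w \<in> borel_measurable borel" unfolding conv_form_yc[abs_def] by measurable
  then have cm: "(\<lambda>x. u0 x * conv_form a b w x) \<in> borel_measurable borel" by measurable
  moreover have "u0 \<in> borel_measurable lebesgue" by (simp add: measurable_completion)
  ultimately have "(\<integral>x. u0 x * u x \<partial>lebesgue) = (\<integral>x. u0 x * conv_form a b w x \<partial>lebesgue)"
    using ae cf by (intro integral_cong_AE borel_measurable_times) (auto simp: measurable_completion)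
  also have "\<dots> = (\<integral>x. u0 x * conv_form a b w x \<partial>lborel)"
    using cm by (simp add: integral_completion)
  also have "\<dots> = (\<integral>x. a * (u0 x)\<^sup>2 + b * (u0 x * u1 x) + u0 x * conv_u0 w x \<partial>lborel)"
    by (rule Bochner_Integration.integral_cong) (auto simp: conv_form_yc power2_eq_square algebra_simps)
  also have "\<dots> = a - kap w"
    using u0_sq_integrable u0_yc_integral[OF w] by simp
  finally show ?thesis using u by (simp add: X_c_def)
qed

section \<open>Norm bounds for the convolution form\<close>

lemma conv_form_L2_bound:
  assumes w: "w \<in> L2 half"
  shows "conv_form a b w \<in> L2 lebesgue"
    and "L2_norm lebesgue (conv_form a b w) \<le>
      sqrt (3 * (a\<^sup>2 + b\<^sup>2 * (\<integral>x. (u1 x)\<^sup>2 \<partial>lborel) + u0_mass\<^sup>2 * (L2_norm half w)\<^sup>2))"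
proof -
  have [measurable]: "conv_u0 w \<in> borel_measurable borel" by (rule conv_u0_measurable[OF w])
  have cm: "conv_form a b w \<in> borel_measurable borel" unfolding conv_form_yc[abs_def] by measurable
  let ?g = "\<lambda>x. 3 * (a\<^sup>2 * (u0 x)\<^sup>2 + b\<^sup>2 * (u1 x)\<^sup>2 + (conv_u0 w x)\<^sup>2)"
  have g: "integrable lborel ?g" using u0_sq_integrable conv_u0_L2[OF w] by simp
  have sq: "(p + q + r)\<^sup>2 \<le> 3 * (p\<^sup>2 + q\<^sup>2 + r\<^sup>2)" for p q r :: real
  proof -
    have "3 * (p\<^sup>2 + q\<^sup>2 + r\<^sup>2) - (p + q + r)\<^sup>2 = (p - q)\<^sup>2 + (q - r)\<^sup>2 + (p - r)\<^sup>2"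
      by (simp add: power2_eq_square algebra_simps)
    moreover have "0 \<le> (p - q)\<^sup>2 + (q - r)\<^sup>2 + (p - r)\<^sup>2" by simp
    ultimately show ?thesis by linarith
  qed
  have le: "(conv_form a b w x)\<^sup>2 \<le> ?g x" for x
    using sq[of "a * u0 x" "b * u1 x" "conv_u0 w x"] by (simp add: conv_form_yc power_mult_distrib)
  have i: "integrable lborel (\<lambda>x. (conv_form a b w x)\<^sup>2)"
    by (rule Bochner_Integration.integrable_bound[OF g]) (use cm le in \<open>auto intro: order_trans[OF _ abs_ge_self]\<close>)
  have i': "integrable lebesgue (\<lambda>x. (conv_form a b w x)\<^sup>2)" using i cm by (simp add: integrable_completion)
  then show "conv_form a b w \<in> L2 lebesgue" using cm by (auto simp: L2_def measurable_completion)
  have "(\<integral>x. (conv_form a b w x)\<^sup>2 \<partial>lebesgue) = (\<integral>x. (conv_form a b w x)\<^sup>2 \<partial>lborel)"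
    using cm by (simp add: integral_completion)
  also have "\<dots> \<le> (\<integral>x. ?g x \<partial>lborel)" by (rule integral_mono[OF i g le])
  also have "\<dots> = 3 * (a\<^sup>2 + b\<^sup>2 * (\<integral>x. (u1 x)\<^sup>2 \<partial>lborel) + (\<integral>x. (conv_u0 w x)\<^sup>2 \<partial>lborel))"
    using u0_sq_integrable conv_u0_L2[OF w] by simp
  also have "\<dots> \<le> 3 * (a\<^sup>2 + b\<^sup>2 * (\<integral>x. (u1 x)\<^sup>2 \<partial>lborel) + u0_mass\<^sup>2 * (L2_norm half w)\<^sup>2)"
    using conv_u0_L2(2)[OF w] by simp
  finally show "L2_norm lebesgue (conv_form a b w) \<le>
      sqrt (3 * (a\<^sup>2 + b\<^sup>2 * (\<integral>x. (u1 x)\<^sup>2 \<partial>lborel) + u0_mass\<^sup>2 * (L2_norm half w)\<^sup>2))"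
    unfolding L2_norm_def by (rule real_sqrt_le_mono)
qed

lemma conv_form_Linf_bound:
  assumes w: "w \<in> L2 half"
  defines "C \<equiv> (2 * pi) powr (- 1 / 4)"
  shows "conv_form a b w \<in> Linf lebesgue" "0 \<le> Linf_norm lebesgue (conv_form a b w)"
    and "Linf_norm lebesgue (conv_form a b w) \<le> ereal (C * \<bar>a\<bar> + 4 * C * \<bar>b\<bar> + sqrt (C * u0_mass) * L2_norm half w)"
proof -
  have [measurable]: "conv_u0 w \<in> borel_measurable borel" by (rule conv_u0_measurable[OF w])
  have cm: "conv_form a b w \<in> borel_measurable borel" unfolding conv_form_yc[abs_def] by measurable
  have C: "0 \<le> C" "u0 x \<le> C" for x by (simp_all add: C_def u0_def mult_left_le)
  have le: "\<bar>conv_form a b w x\<bar> \<le> C * \<bar>a\<bar> + 4 * C * \<bar>b\<bar> + sqrt (C * u0_mass) * L2_norm half w" for x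
  proof -
    have "\<bar>conv_form a b w x\<bar> \<le> \<bar>a * u0 x\<bar> + \<bar>b * u1 x\<bar> + \<bar>conv_u0 w x\<bar>" unfolding conv_form_yc by linarith
    moreover have "\<bar>a * u0 x\<bar> \<le> C * \<bar>a\<bar>"
      using C(2)[of x] u0_pos[of x] by (simp add: abs_mult mult.commute mult_right_mono)
    moreover have "\<bar>b * u1 x\<bar> \<le> 4 * C * \<bar>b\<bar>"
      using mult_right_mono[OF u1_bound, of "\<bar>b\<bar>" x] by (simp add: abs_mult C_def mult.commute)
    ultimately show ?thesis using conv_u0_bound[OF w, of x] unfolding C_def by linarith
  qed
  have exp_kernel: "(\<lambda>x. ereal \<bar>conv_form a b w x\<bar>) \<in> borel_measurable lebesgue"
    using borel_measurable_ereal[OF borel_measurable_abs[OF cm]] by (intro measurable_completion) simp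
  show L: "Linf_norm lebesgue (conv_form a b w) \<le> ereal (C * \<bar>a\<bar> + 4 * C * \<bar>b\<bar> + sqrt (C * u0_mass) * L2_norm half w)"
    unfolding Linf_norm_def by (rule esssup_I[OF exp_kernel]) (use le in auto)
  then show "conv_form a b w \<in> Linf lebesgue"
    using cm by (auto simp: Linf_def measurable_completion intro: order_le_less_trans)
  have "esssup lebesgue (\<lambda>x::real. 0 :: ereal) \<le> Linf_norm lebesgue (conv_form a b w)"
    unfolding Linf_norm_def by (rule esssup_mono) auto
  moreover have "esssup lebesgue (\<lambda>x::real. 0 :: ereal) = 0" by (rule esssup_const) simp
  ultimately show "0 \<le> Linf_norm lebesgue (conv_form a b w)" by simp
qed

text \<open>Initial data are compared almost everywhere, whereas injectivity of the convolution form
  is stated pointwise. Continuity bridges the two, as a nonempty open set is not negligible.\<close>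

lemma continuous_AE_eq_imp_eq:
  fixes f g :: "real \<Rightarrow> real"
  assumes "continuous_on UNIV f" "continuous_on UNIV g" "AE x in lebesgue. f x = g x"
  shows "f x = g x"
proof (rule ccontr)
  assume ne: "f x \<noteq> g x"
  have op: "open {y. f y \<noteq> g y}" using assms(1,2) by (intro open_Collect_neq)
  then obtain e where e: "0 < e" "ball x e \<subseteq> {y. f y \<noteq> g y}"
    using ne open_contains_ball[of "{y. f y \<noteq> g y}"] by blast
  have "AE y in lebesgue. y \<notin> ball x e" using assms(3) by eventually_elim (use e(2) in auto)
  then have "ball x e \<in> null_sets lebesgue" by (subst AE_iff_null_sets) auto
  then have "negligible (ball x e)" by (simp add: negligible_iff_null_sets)
  then show False using e(1) open_not_negligible[OF open_ball] by (metis ball_eq_empty not_le)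
qed

lemma conv_form_continuous: "w \<in> L2 half \<Longrightarrow> continuous_on UNIV (conv_form a b w)"
proof -
  assume "w \<in> L2 half"
  from conv_form_regular(1)[OF this, of a b] have "conv_form a b w differentiable at x" for x
    by (metis funpow_0 zero_less_numeral)
  then show ?thesis
    by (auto intro!: continuous_at_imp_continuous_on differentiable_imp_continuous_within)
qed

section \<open>Existence, uniqueness and asymptotics\<close>

text \<open>The time derivative of the form is computed twice: term by term, with data (a', b', w'),
  and from the equation, with data (\<open>kap f\<close>, a/2, f) where f = H w. Injectivity of the
  form equates the data.\<close>

lemma conv_solution_reduced:
  assumes "conv_solution u a b w"
  obtains f where "\<And>t. t \<ge> 0 \<Longrightarrow> f t \<in> L2 half" "\<And>t. t \<ge> 0 \<Longrightarrow> w t \<in> L2 half"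
    "\<And>t. t \<ge> 0 \<Longrightarrow> abs_l2 (w t) = Hinv_l2 (abs_l2 (f t))"
    "\<And>t. t \<ge> 0 \<Longrightarrow> ((\<lambda>s. abs_l2 (w s)) has_vector_derivative abs_l2 (f t)) (at t within {0..})"
    "\<And>t. t \<ge> 0 \<Longrightarrow> (a has_real_derivative kap_l2 (abs_l2 (f t))) (at t within {0..})"
    "\<And>t. t \<ge> 0 \<Longrightarrow> (b has_real_derivative a t / 2) (at t within {0..})"
proof -
  define f where "f t = H_op (w t)" for t
  have D: "w t \<in> Dom_H" if "t \<ge> 0" for t using assms that by (simp add: conv_solution_def C0_halfline_def)
  have fL: "f t \<in> L2 half" if "t \<ge> 0" for t unfolding f_def by (rule H_op(1)[OF D[OF that]])
  have wL: "w t \<in> L2 half" if "t \<ge> 0" for t by (rule Dom_H_L2[OF D[OF that]])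
  obtain a' where a': "\<And>t. t \<ge> 0 \<Longrightarrow> (a has_real_derivative a' t) (at t within {0..})"
    using assms by (auto simp: conv_solution_def C1_real_halfline_def)
  obtain b' where b': "\<And>t. t \<ge> 0 \<Longrightarrow> (b has_real_derivative b' t) (at t within {0..})"
    using assms by (auto simp: conv_solution_def C1_real_halfline_def)
  obtain v where v: "\<And>t. t \<ge> 0 \<Longrightarrow> v t \<in> L2 half"
    "\<And>t. t \<ge> 0 \<Longrightarrow> ((\<lambda>s. abs_l2 (w s)) has_vector_derivative abs_l2 (v t)) (at t within {0..})"
    using assms unfolding conv_solution_def C1_halfline_L2_iff by blast
  have eq: "a' t = kap (f t) \<and> b' t = a t / 2 \<and> (AE z in half. v t z = f t z)" if t: "t \<ge> 0" for t
  proof -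
    have "conv_form (a' t) (b' t) (v t) x = conv_form (kap (f t)) (a t / 2) (f t) x" for x
    proof (rule has_field_derivative_unique)
      show "((\<lambda>s. conv_form (a s) (b s) (w s) x) has_real_derivative conv_form (a' t) (b' t) (v t) x) (at t within {0..})"
        by (rule conv_form_time_deriv[OF a'[OF t] b'[OF t] wL _ v(1)[OF t] v(2)[OF t]]) (use t in auto)
      have "((\<lambda>s. conv_form (a s) (b s) (w s) x) has_real_derivative deriv (L_op (conv_form (a t) (b t) (w t))) x) (at t within {0..})"
        using assms t by (auto simp: conv_solution_def solves_lin_logKdV_def)
      then show "((\<lambda>s. conv_form (a s) (b s) (w s) x) has_real_derivative conv_form (kap (f t)) (a t / 2) (f t) x) (at t within {0..})"
        using conv_form_rhs[OF wL[OF t] fL[OF t]] Dom_H_Gf[OF D[OF t]] by (simp add: f_def)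
      have "at_right t \<le> at t within {0..}" using t by (intro at_le) auto
      then show "at t within {0..} \<noteq> bot" using trivial_limit_at_right_real[of t] by (metis bot.extremum_uniqueI)
    qed
    from conv_form_inj[OF v(1)[OF t] fL[OF t] this] show ?thesis by auto
  qed
  show ?thesis
  proof (rule that)
    fix t :: real assume t: "t \<ge> 0"
    show "f t \<in> L2 half" "w t \<in> L2 half" by (rule fL[OF t], rule wL[OF t])
    show "abs_l2 (w t) = Hinv_l2 (abs_l2 (f t))" unfolding f_def by (rule Dom_H_abs[OF D[OF t]])
    have "abs_l2 (v t) = abs_l2 (f t)" using eq[OF t] v(1)[OF t] fL[OF t] by (simp add: abs_l2_eq_iff)
    then show "((\<lambda>s. abs_l2 (w s)) has_vector_derivative abs_l2 (f t)) (at t within {0..})"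
      using v(2)[OF t] by simp
    show "(a has_real_derivative kap_l2 (abs_l2 (f t))) (at t within {0..})"
      using a'[OF t] eq[OF t] kap_abs[OF fL[OF t]] by simp
    show "(b has_real_derivative a t / 2) (at t within {0..})"
      using b'[OF t] eq[OF t] by simp
  qed
qed

lemma halfline_DERIV_unique:
  fixes f g :: "real \<Rightarrow> real"
  assumes "\<And>t. t \<ge> 0 \<Longrightarrow> (f has_real_derivative d t) (at t within {0..})"
    and "\<And>t. t \<ge> 0 \<Longrightarrow> (g has_real_derivative d t) (at t within {0..})" and "f 0 = g 0" "0 \<le> t"
  shows "f t = g t"
proof -
  have "((\<lambda>t. f t - g t) has_real_derivative 0) (at t within {0..})" if "t \<in> {0..}" for t
    using DERIV_diff[OF assms(1) assms(2), of t] that by simp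
  then obtain c where "\<And>t. t \<in> {0..} \<Longrightarrow> f t - g t = c"
    using has_field_derivative_zero_constant[of "{0..}" "\<lambda>t. f t - g t"] by auto
  from this[of t] this[of 0] assms(3,4) show ?thesis by simp
qed

text \<open>The difference satisfies the energy inequality with zero initial value, so \<omega> and
  \<theta> agree. Injectivity of the inverse then identifies \<gamma> and \<eta>.\<close>

lemma evolution_unique:
  fixes \<gamma> \<eta> :: "real \<Rightarrow> l2"
  assumes "\<And>t. t \<ge> 0 \<Longrightarrow> ((\<lambda>s. \<omega> s) has_vector_derivative \<gamma> t) (at t within {0..})"
    and "\<And>t. t \<ge> 0 \<Longrightarrow> ((\<lambda>s. \<theta> s) has_vector_derivative \<eta> t) (at t within {0..})"
    and "\<And>t. t \<ge> 0 \<Longrightarrow> \<omega> t = Hinv_l2 (\<gamma> t)" "\<And>t. t \<ge> 0 \<Longrightarrow> \<theta> t = Hinv_l2 (\<eta> t)" "\<omega> 0 = \<theta> 0" "0 \<le> t"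
  shows "\<omega> t = \<theta> t" "\<gamma> t = \<eta> t"
proof -
  interpret G: bounded_linear Hinv_l2 by (rule bounded_linear_GT)
  have "norm (\<omega> t - \<theta> t) \<le> exp (- (1 / 2) * t) * norm (\<omega> 0 - \<theta> 0)"
  proof (rule energy_decay[where \<gamma> = "\<lambda>t. \<gamma> t - \<eta> t"])
    fix s :: real assume s: "0 \<le> s"
    show "((\<lambda>t. \<omega> t - \<theta> t) has_vector_derivative \<gamma> s - \<eta> s) (at s within {0..})"
      by (intro has_vector_derivative_diff assms s)
    have "\<omega> s - \<theta> s = Hinv_l2 (\<gamma> s - \<eta> s)" using assms(3,4)[OF s] by (simp add: G.diff)
    then show "inner (\<omega> s - \<theta> s) (\<gamma> s - \<eta> s) \<le> - (1 / 2) * (norm (\<omega> s - \<theta> s))\<^sup>2"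
      using Hinv_l2_energy[of "\<gamma> s - \<eta> s"] by simp
  qed (rule assms(6))
  then show 1: "\<omega> t = \<theta> t" using assms(5) by simp
  then have "Hinv_l2 (\<gamma> t - \<eta> t) = 0" using assms(3,4)[OF assms(6)] by (simp add: G.diff)
  from Hinv_l2_inj[OF this] show "\<gamma> t = \<eta> t" by simp
qed

text \<open>Since \<open>\<omega> = G \<gamma>\<close> and \<open>(G \<omega>)' = \<omega>\<close>, both modulation equations integrate explicitly.\<close>

theorem theorem6p6:
  fixes u_init w_init :: "real \<Rightarrow> real" and a_init b_init :: real
  assumes "u_init \<in> X_c"
    and "w_init \<in> Dom_H"
    and "AE x in lebesgue. u_init x = conv_form a_init b_init w_init x"
  shows "\<exists>a b w.
    conv_solution u_init a b w \<and>
    a 0 = a_init \<and> b 0 = b_init \<and> (AE z in lebesgue_on {..<0}. w 0 z = w_init z) \<and>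
    (\<forall>a' b' w'. conv_solution u_init a' b' w' \<longrightarrow>
       (\<forall>t\<ge>0. a' t = a t \<and> b' t = b t \<and> (AE z in lebesgue_on {..<0}. w' t z = w t z))) \<and>
    (\<exists>b_inf.
       (\<forall>t\<ge>0. (\<lambda>x. conv_form (a t) (b t) (w t) x - b_inf * u1 x) \<in> L2 lebesgue \<inter> Linf lebesgue) \<and>
       ((\<lambda>t. ereal (L2_norm lebesgue (\<lambda>x. conv_form (a t) (b t) (w t) x - b_inf * u1 x))
            + Linf_norm lebesgue (\<lambda>x. conv_form (a t) (b t) (w t) x - b_inf * u1 x)) \<longlongrightarrow> 0) at_top)"
proof -
  interpret G: bounded_linear Hinv_l2 by (rule bounded_linear_GT)
  \<comment> \<open>The evolution starts from H of the initial datum; applying the inverse at t = 0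
    returns \<open>w_init\<close> because it lies in the domain.\<close>
  define \<gamma> where "\<gamma> t = H.evolution t (abs_l2 (H_op w_init))" for t
  define \<omega> where "\<omega> t = Hinv_l2 (\<gamma> t)" for t
  \<comment> \<open>The relation that orthogonality to \<open>u0\<close> imposes is taken as the
    definition for all times. Membership of \<open>u_init\<close> in \<open>X_c\<close> makes it
    agree with \<open>a_init\<close> at t = 0.\<close>
  define a where "a t = kap_l2 (\<omega> t)" for t
  define b where "b t = b_init + (kap_l2 (Hinv_l2 (\<omega> t)) - kap_l2 (Hinv_l2 (\<omega> 0))) / 2" for t
  \<comment> \<open>This representative, rather than \<open>l2_rep\<close> of \<omega> t, lies in
    \<open>Dom_H\<close> with image \<gamma> t directly by \<open>is_H_Gf\<close>.\<close>
  define w where "w t = Hinv (l2_rep (\<gamma> t))" for t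
  have wi: "w_init \<in> L2 half" by (rule Dom_H_L2[OF assms(2)])
  have \<omega>0: "\<omega> 0 = abs_l2 w_init"
    using Dom_H_abs[OF assms(2)] by (simp add: \<omega>_def \<gamma>_def H.evolution_0)
  have \<omega>d: "(\<omega> has_vector_derivative \<gamma> t) (at t within {0..})" if "t \<ge> 0" for t
    using H.evolution_deriv[OF that] unfolding \<omega>_def[abs_def] \<gamma>_def Hinv_op_app .
  have \<gamma>c: "continuous_on {0..} \<gamma>" unfolding \<gamma>_def[abs_def] by (rule H.evolution_continuous)
  have \<omega>c: "continuous_on {0..} \<omega>" unfolding \<omega>_def[abs_def] by (rule G.continuous_on[OF \<gamma>c])
  have wL: "w t \<in> L2 half" for t unfolding w_def by (rule Hinv_L2[OF l2_rep_L2])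
  have absw: "abs_l2 (w t) = \<omega> t" for t by (simp add: w_def \<omega>_def Hinv_l2_def)
  have klc: "continuous_on S (\<lambda>t. kap_l2 (g t))" if "continuous_on S g" for S and g :: "real \<Rightarrow> l2"
    by (rule bounded_linear.continuous_on[OF bounded_linear_kl that])
  have ad: "(a has_real_derivative kap_l2 (\<gamma> t)) (at t within {0..})" if "t \<ge> 0" for t
    using bounded_linear.has_vector_derivative[OF bounded_linear_kl \<omega>d[OF that]]
    unfolding a_def[abs_def] by (simp add: has_real_derivative_iff_has_vector_derivative)
  have bd: "(b has_real_derivative a t / 2) (at t within {0..})" if "t \<ge> 0" for t
  proof -
    have "((\<lambda>t. kap_l2 (Hinv_l2 (\<omega> t))) has_real_derivative a t) (at t within {0..})"
      using bounded_linear.has_vector_derivative[OF bounded_linear_kl G.has_vector_derivative[OF \<omega>d[OF that]]]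
      by (simp add: has_real_derivative_iff_has_vector_derivative a_def \<omega>_def)
    then show ?thesis unfolding b_def[abs_def] by (auto intro!: derivative_eq_intros)
  qed
  have a0: "a 0 = a_init"
    using X_c_coefficient[OF assms(1) wi assms(3)] by (simp add: a_def \<omega>0 kap_abs wi)
  have b0: "b 0 = b_init" by (simp add: b_def)
  have w0: "AE z in half. w 0 z = w_init z"
    using absw[of 0] \<omega>0 abs_l2_eq_iff[OF wL wi, of 0] by simp
  have cf0: "conv_form (a 0) (b 0) (w 0) x = conv_form a_init b_init w_init x" for x
    using exp_moment_cong_AE[OF wL wi w0] by (simp add: conv_form_eq a0 b0)

  have sol: "conv_solution u_init a b w"
    unfolding conv_solution_def
  proof (intro conjI)
    show "C1_real_halfline a"
      unfolding C1_real_halfline_def using ad klc[OF \<gamma>c] by (intro exI[of _ "\<lambda>t. kap_l2 (\<gamma> t)"]) auto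
    have "continuous_on {0..} (\<lambda>t. a t / 2)"
      unfolding a_def by (intro continuous_intros klc \<omega>c) simp
    then show "C1_real_halfline b"
      unfolding C1_real_halfline_def using bd by (intro exI[of _ "\<lambda>t. a t / 2"]) auto
    show "C0_halfline Dom_H graph_norm_H w"
      unfolding C0_halfline_def
    proof (intro allI impI conjI)
      fix t :: real assume t: "0 \<le> t"
      show "w t \<in> Dom_H" unfolding w_def by (rule Hinv_in_Dom_H[OF l2_rep_L2])
      \<comment> \<open>By linearity of \<open>Hinv\<close>, H maps the difference of the w to the
        difference of the \<gamma>, so continuity in the graph norm is joint continuity of \<omega>
        and \<gamma>.\<close>
      have gn: "graph_norm_H (\<lambda>z. w s z - w t z) = norm (\<omega> s - \<omega> t) + norm (\<gamma> s - \<gamma> t)" for s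
      proof -
        let ?f = "\<lambda>z. l2_rep (\<gamma> s) z - l2_rep (\<gamma> t) z" and ?w = "\<lambda>z. w s z - w t z"
        have fL: "?f \<in> L2 half" and dL: "?w \<in> L2 half" by (intro L2_diff l2_rep_L2 wL)+
        have eq: "Hinv ?f z = ?w z" if "z < 0" for z
          using Hinv_linear(1)[OF fL l2_rep_L2 that, of "\<gamma> t"] by (simp add: w_def)
        have "is_H ?w ?f"
          unfolding is_H_iff[OF dL]
        proof
          fix \<phi> assume "\<phi> \<in> \<D>"
          have "(\<integral>z. ?w z * H_adj \<phi> z \<partial>half) = (\<integral>z. Hinv ?f z * H_adj \<phi> z \<partial>half)"
            by (rule Bochner_Integration.integral_cong) (auto simp: eq)
          then show "(\<integral>z. ?w z * H_adj \<phi> z \<partial>half) = (\<integral>z. ?f z * \<phi> z \<partial>half)"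
            using is_H_Gf[OF fL] \<open>\<phi> \<in> \<D>\<close> unfolding is_H_iff[OF Hinv_L2[OF fL]] by simp
        qed
        from graph_norm_H_eq[OF dL fL this] show ?thesis
          by (simp add: norm_abs_l2[symmetric] abs_l2_diff[symmetric] fL dL wL l2_rep_L2 absw abs_fn)
      qed
      have "((\<lambda>s. norm (\<omega> s - \<omega> t) + norm (\<gamma> s - \<gamma> t)) \<longlongrightarrow> 0 + 0) (at t within {0..})"
        using \<omega>c \<gamma>c t by (intro tendsto_add) (auto simp: continuous_on_def tendsto_norm_zero_iff LIM_zero_iff)
      then show "((\<lambda>s. graph_norm_H (\<lambda>z. w s z - w t z)) \<longlongrightarrow> 0) (at t within {0..})" by (simp add: gn)
    qed
    show "C1_halfline (L2 half) (L2_norm half) w"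
      unfolding C1_halfline_L2_iff absw using \<omega>d \<gamma>c
      by (intro conjI exI[of _ "\<lambda>t. l2_rep (\<gamma> t)"]) (auto simp: wL l2_rep_L2 abs_fn)
    show "solves_lin_logKdV (\<lambda>t. conv_form (a t) (b t) (w t))"
      unfolding solves_lin_logKdV_def
    proof (intro allI impI conjI)
      fix t x :: real assume t: "0 \<le> t"
      show "(deriv ^^ n) (conv_form (a t) (b t) (w t)) differentiable at x" if "n < 3" for n
        using conv_form_regular(1)[OF wL, of _ _ t x] that by blast
      have "((\<lambda>s. conv_form (a s) (b s) (w s) x) has_real_derivative
          conv_form (kap_l2 (\<gamma> t)) (a t / 2) (l2_rep (\<gamma> t)) x) (at t within {0..})"
        by (rule conv_form_time_deriv[OF ad[OF t] bd[OF t] wL _ l2_rep_L2])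
          (use t \<omega>d[OF t] in \<open>auto simp: absw abs_fn\<close>)
      moreover have "deriv (L_op (conv_form (a t) (b t) (w t))) x = conv_form (kap_l2 (\<gamma> t)) (a t / 2) (l2_rep (\<gamma> t)) x"
        using conv_form_rhs[OF wL l2_rep_L2, of t "\<gamma> t"] kap_abs[OF l2_rep_L2, of "\<gamma> t"] by (simp add: w_def abs_fn)
      ultimately show "((\<lambda>s. conv_form (a s) (b s) (w s) x) has_real_derivative
          deriv (L_op (conv_form (a t) (b t) (w t))) x) (at t within {0..})" by simp
    qed
    show "AE x in lebesgue. conv_form (a 0) (b 0) (w 0) x = u_init x"
      using assms(3) by eventually_elim (simp add: cf0)
  qed

  have uniq: "a' t = a t \<and> b' t = b t \<and> (AE z in half. w' t z = w t z)"
    if s: "conv_solution u_init a' b' w'" and t: "t \<ge> 0" for a' b' w' t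
  proof -
    obtain f where f: "\<And>t. t \<ge> 0 \<Longrightarrow> f t \<in> L2 half" "\<And>t. t \<ge> 0 \<Longrightarrow> w' t \<in> L2 half"
      "\<And>t. t \<ge> 0 \<Longrightarrow> abs_l2 (w' t) = Hinv_l2 (abs_l2 (f t))"
      "\<And>t. t \<ge> 0 \<Longrightarrow> ((\<lambda>s. abs_l2 (w' s)) has_vector_derivative abs_l2 (f t)) (at t within {0..})"
      "\<And>t. t \<ge> 0 \<Longrightarrow> (a' has_real_derivative kap_l2 (abs_l2 (f t))) (at t within {0..})"
      "\<And>t. t \<ge> 0 \<Longrightarrow> (b' has_real_derivative a' t / 2) (at t within {0..})"
      by (rule conv_solution_reduced[OF s], rule that)
    have "AE x in lebesgue. conv_form (a' 0) (b' 0) (w' 0) x = u_init x"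
      using s by (simp add: conv_solution_def)
    then have "AE x in lebesgue. conv_form (a' 0) (b' 0) (w' 0) x = conv_form a_init b_init w_init x"
      using assms(3) by eventually_elim simp
    then have "conv_form (a' 0) (b' 0) (w' 0) x = conv_form a_init b_init w_init x" for x
      by (intro continuous_AE_eq_imp_eq conv_form_continuous f(2) wi) auto
    from conv_form_inj[OF f(2) wi this] have i: "a' 0 = a 0" "b' 0 = b 0" "AE z in half. w' 0 z = w_init z"
      by (auto simp: a0 b0)
    have init: "abs_l2 (w' 0) = \<omega> 0" using i(3) f(2)[of 0] wi by (simp add: \<omega>0 abs_l2_eq_iff)
    have \<omega>G: "\<omega> s = Hinv_l2 (\<gamma> s)" if "s \<ge> 0" for s by (rule \<omega>_def)
    have e: "abs_l2 (w' s) = \<omega> s" "abs_l2 (f s) = \<gamma> s" if "s \<ge> 0" for s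
      by (rule evolution_unique[OF f(4) \<omega>d f(3) \<omega>G init that]; assumption)+
    have aa: "a' s = a s" if "s \<ge> 0" for s
      by (rule halfline_DERIV_unique[where d = "\<lambda>t. kap_l2 (\<gamma> t)"]) (use f(5) e(2) ad i(1) that in auto)
    moreover have "b' t = b t"
      by (rule halfline_DERIV_unique[where d = "\<lambda>t. a t / 2"]) (use f(6) aa bd i(2) t in auto)
    moreover have "AE z in half. w' t z = w t z"
      using e(1)[OF t] absw[of t] abs_l2_eq_iff[OF f(2)[OF t] wL, of t] by simp
    ultimately show ?thesis using t by simp
  qed

  \<comment> \<open>The value left in the explicit formula for b once \<omega> has decayed to
    0.\<close>
  define b_inf where "b_inf = b_init - kap_l2 (Hinv_l2 (\<omega> 0)) / 2"
  have diff: "conv_form (a t) (b t) (w t) x - b_inf * u1 x = conv_form (a t) (b t - b_inf) (w t) x" for t x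
    by (simp add: conv_form_def algebra_simps)
  have \<omega>lim: "((\<lambda>t. norm (\<omega> t)) \<longlongrightarrow> 0) at_top"
  proof (rule Lim_null_comparison)
    show "((\<lambda>t. exp (- (1 / 2) * t) * norm (\<omega> 0)) \<longlongrightarrow> 0) at_top"
    proof (rule tendsto_mult_left_zero)
      show "((\<lambda>t::real. exp (- (1 / 2) * t)) \<longlongrightarrow> 0) at_top" by real_asymp
    qed
    show "\<forall>\<^sub>F t in at_top. norm (norm (\<omega> t)) \<le> exp (- (1 / 2) * t) * norm (\<omega> 0)"
      using eventually_ge_at_top[of 0]
    proof eventually_elim
      case (elim t)
      have "norm (\<omega> t) \<le> exp (- (1 / 2) * t) * norm (\<omega> 0)"
      proof (rule energy_decay[OF \<omega>d _ elim])
        fix s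
        show "inner (\<omega> s) (\<gamma> s) \<le> - (1 / 2) * (norm (\<omega> s))\<^sup>2" unfolding \<omega>_def by (rule Hinv_l2_energy)
      qed
      then show ?case by simp
    qed
  qed
  then have \<omega>0lim: "(\<omega> \<longlongrightarrow> 0) at_top" by (simp add: tendsto_norm_zero_iff)
  have alim: "(a \<longlongrightarrow> 0) at_top"
    unfolding a_def[abs_def] using bounded_linear.tendsto_zero[OF bounded_linear_kl \<omega>0lim] .
  have blim: "((\<lambda>t. b t - b_inf) \<longlongrightarrow> 0) at_top"
  proof -
    have "((\<lambda>t. kap_l2 (Hinv_l2 (\<omega> t)) / 2) \<longlongrightarrow> 0) at_top"
      using tendsto_divide[OF bounded_linear.tendsto_zero[OF bounded_linear_kl G.tendsto_zero[OF \<omega>0lim]] tendsto_const[of 2]]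
      by simp
    moreover have "b t - b_inf = kap_l2 (Hinv_l2 (\<omega> t)) / 2" for t by (simp add: b_def b_inf_def field_simps)
    ultimately show ?thesis by (simp only:)
  qed
  let ?C = "(2 * pi) powr (- 1 / 4)" and ?U = "\<integral>x. (u1 x)\<^sup>2 \<partial>lborel"
  let ?r = "\<lambda>t x. conv_form (a t) (b t) (w t) x - b_inf * u1 x"
  define K where "K t = sqrt (3 * ((a t)\<^sup>2 + (b t - b_inf)\<^sup>2 * ?U + u0_mass\<^sup>2 * (norm (\<omega> t))\<^sup>2))
    + (?C * \<bar>a t\<bar> + 4 * ?C * \<bar>b t - b_inf\<bar> + sqrt (?C * u0_mass) * norm (\<omega> t))" for t
  have nw: "L2_norm half (w t) = norm (\<omega> t)" for t using norm_abs_l2[OF wL, of t] by (simp add: absw)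
  have "(K \<longlongrightarrow> sqrt (3 * (0\<^sup>2 + 0\<^sup>2 * ?U + u0_mass\<^sup>2 * 0\<^sup>2)) + (?C * \<bar>0\<bar> + 4 * ?C * \<bar>0\<bar> + sqrt (?C * u0_mass) * 0)) at_top"
    unfolding K_def[abs_def] by (intro tendsto_intros alim blim \<omega>lim)
  then have Klim: "((\<lambda>t. ereal (K t)) \<longlongrightarrow> 0) at_top" by (simp add: zero_ereal_def)
  have lim: "((\<lambda>t. ereal (L2_norm lebesgue (?r t)) + Linf_norm lebesgue (?r t)) \<longlongrightarrow> 0) at_top"
  proof (rule tendsto_sandwich[OF _ _ tendsto_const Klim])
    show "\<forall>\<^sub>F t in at_top. 0 \<le> ereal (L2_norm lebesgue (?r t)) + Linf_norm lebesgue (?r t)"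
      unfolding diff by (intro always_eventually allI add_nonneg_nonneg conv_form_Linf_bound(2) wL) (simp add: L2_norm_nonneg)
    show "\<forall>\<^sub>F t in at_top. ereal (L2_norm lebesgue (?r t)) + Linf_norm lebesgue (?r t) \<le> ereal (K t)"
    proof (intro always_eventually allI)
      fix t
      have "ereal (L2_norm lebesgue (?r t)) + Linf_norm lebesgue (?r t)
        \<le> ereal (sqrt (3 * ((a t)\<^sup>2 + (b t - b_inf)\<^sup>2 * ?U + u0_mass\<^sup>2 * (norm (\<omega> t))\<^sup>2)))
          + ereal (?C * \<bar>a t\<bar> + 4 * ?C * \<bar>b t - b_inf\<bar> + sqrt (?C * u0_mass) * norm (\<omega> t))"
        unfolding diff
        using conv_form_L2_bound(2)[OF wL, of "a t" "b t - b_inf" t] conv_form_Linf_bound(3)[OF wL, of "a t" "b t - b_inf" t]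
        by (intro add_mono) (auto simp: nw)
      then show "ereal (L2_norm lebesgue (?r t)) + Linf_norm lebesgue (?r t) \<le> ereal (K t)" by (simp add: K_def)
    qed
  qed
  have mem: "?r t \<in> L2 lebesgue \<inter> Linf lebesgue" for t
    unfolding diff using conv_form_L2_bound(1)[OF wL] conv_form_Linf_bound(1)[OF wL] by blast
  show ?thesis
  proof (rule exI[of _ a], rule exI[of _ b], rule exI[of _ w], intro conjI)
    show "\<forall>a' b' w'. conv_solution u_init a' b' w' \<longrightarrow>
       (\<forall>t\<ge>0. a' t = a t \<and> b' t = b t \<and> (AE z in lebesgue_on {..<0}. w' t z = w t z))"
      using uniq by blast
    show "\<exists>b_inf.
       (\<forall>t\<ge>0. (\<lambda>x. conv_form (a t) (b t) (w t) x - b_inf * u1 x) \<in> L2 lebesgue \<inter> Linf lebesgue) \<and>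
       ((\<lambda>t. ereal (L2_norm lebesgue (\<lambda>x. conv_form (a t) (b t) (w t) x - b_inf * u1 x))
            + Linf_norm lebesgue (\<lambda>x. conv_form (a t) (b t) (w t) x - b_inf * u1 x)) \<longlongrightarrow> 0) at_top"
      using mem lim by blast
  qed (fact sol a0 b0 w0)+
qed

end
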